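(* In the setting described in the context, suppose that the following hypotheses hold. (H1) There exists a Hilbert space $\mathbf{V}$ compactly embedded into $\mathbf{H}$ such that $S$ is twice continuously differentiable from $\mathcal{H}\times E$ to $\mathbf{V}\times M$ with bounded derivatives on bounded subsets. (H4) There exists an orthonormal basis $\{\varphi_j\}$ in $E$ such that $\eta_k=\sum_{j=1}^\infty b_j\xi_{jk}\varphi_j$, where $\{b_j\}$ are real numbers with $\sum_jb_j^2<\infty$ and $\{\xi_{jk}\}$ are independent random variables such that $\xi_{jk}$ has a Lipschitz-continuous density $\rho_j$ with respect to the Lebesgue measure on $\mathbb{R}$. (H5) $\mathcal{A}$ is twice continuously differentiable from $\mathcal{H}\times E$ to $\mathrm{SL}_d(\mathbb{R})$ with bounded derivatives on bounded subsets. (H7) For any $z\in\mathcal{X}$, the set $\widehat{\mathcal{K}}^z$ of all $\eta\in\mathcal{K}$ for which the derivative at $\eta$ of the map $\eta\mapsto(S(z,\eta),\mathcal{A}_{\eta,z})$, acting from $E$ to $\mathbf{H}\times T_yM\times T_{\mathcal{A}_{\eta,z}}\mathrm{SL}_d(\mathbb{R})$ (with $y$ the $M$-component of $S(z,\eta)$), has dense image satisfies $\ell(\widehat{\mathcal{K}}^z)=1$. Then for any $c>0$ there is a constant $C=C(c)>0$ such that $$\left|\int\widehat{P}_1(z_1,dy)g(y)-\int\widehat{P}_1(z_2,dy)g(y)\right|\le\left(C\|g\|_\infty+c|g|_{1/2}\right)d_{\mathcal{X}}(z_1,z_2)^{1/2}$$ for any $g\in C_b^{1/2}(\mathcal{X}\times\mathrm{SL}_d(\mathbb{R}))$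 and $z_1,z_2\in\mathcal{X}$.
   Context: Setting. $d\ge2$ is an integer, $\mathbf{H}$ and $E$ are separable Hilbert spaces, $M$ is a smooth compact Riemannian manifold without boundary, $\mathcal{H}=\mathbf{H}\times M$ with its product metric. The maps $S:\mathcal{H}\times E\to\mathcal{H}$ and $\mathcal{A}:\mathcal{H}\times E\to\mathrm{SL}_d(\mathbb{R})$, $(z,\eta)\mapsto\mathcal{A}_{\eta,z}$, are continuous. $\{\eta_n\}_{n\ge1}$ is a sequence of i.i.d. random variables in $E$ whose common law $\ell$ has compact support $\mathcal{K}$. $\mathcal{X}\subset\mathcal{H}$ is a compact set with $S(\mathcal{X}\times\mathcal{K})\subset\mathcal{X}$; $d_{\mathcal{X}}$ is the metric induced from $\mathcal{H}$. Extended transition function: $\widehat{P}_1(z,\Gamma)=\ell\{\eta\in\mathcal{K}:(S(z,\eta),\mathcal{A}_{\eta,z})\in\Gamma\}$ for $z\in\mathcal{X}$ and Borel $\Gamma\subset\mathcal{X}\times\mathrm{SL}_d(\mathbb{R})$. For a metric space $(Z,d_Z)$ and $\gamma\in(0,1]$, $C_b^\gamma(Z)$ is the space of continuous $f:Z\to\mathbb{R}$ with $|f|_\gamma:=\|f\|_\infty+\sup_{0<d_Z(z_1,z_2)\le1}|f(z_1)-f(z_2)|/d_Z(z_1,z_2)^\gamma<\infty$, where $\|f\|_\infty=\sup|f|$. $\mathrm{SL}_d(\mathbb{R})$ carries the metric induced by the Euclidean matrix norm, and $\mathcal{X}\times\mathrm{SL}_d(\mathbb{R})$ the product metric.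
   Formalization: In (H4) the real numbers b_j are additionally assumed to be nonzero for every j; if all b_j = 0 were allowed, the noise could be deterministic and the claimed estimate would fail. *)

theory Defs
  imports "HOL-Probability.Probability"
begin

section \<open>Compact Riemannian manifolds\<close>

text \<open>
  A chart of a manifold with points in \<open>'m\<close> is a pair of its domain and its coordinate map; the
  coordinate map is only relevant on the domain. The model space \<open>'b\<close> is a finite-dimensional
  inner product space rather than an instance of the class \<open>euclidean_space\<close>, because that class
  excludes dimension zero (and with it the case where the manifold is a point).
\<close>

type_synonym ('m, 'b) chart = "'m set \<times> ('m \<Rightarrow> 'b)"

abbreviation chart_dom :: "('m, 'b) chart \<Rightarrow> 'm set" where
  "chart_dom \<kappa> \<equiv> fst \<kappa>"

abbreviation chart_map :: "('m, 'b) chart \<Rightarrow> 'm \<Rightarrow> 'b" where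
  "chart_map \<kappa> \<equiv> snd \<kappa>"

definition chart_inv :: "('m, 'b) chart \<Rightarrow> 'b \<Rightarrow> 'm" where
  "chart_inv \<kappa> = inv_into (chart_dom \<kappa>) (chart_map \<kappa>)"

definition chart_range :: "('m, 'b) chart \<Rightarrow> 'b set" where
  "chart_range \<kappa> = chart_map \<kappa> ` chart_dom \<kappa>"

definition is_chart :: "('m::topological_space, 'b::real_inner) chart \<Rightarrow> bool" where
  "is_chart \<kappa> \<longleftrightarrow> open (chart_dom \<kappa>) \<and> open (chart_range \<kappa>) \<and>
     homeomorphism (chart_dom \<kappa>) (chart_range \<kappa>) (chart_map \<kappa>) (chart_inv \<kappa>)"

text \<open>
  For an open subset of a finite-dimensional space, existence and continuity of all iterated
  directional derivatives up to order \<open>n\<close>, as below, is the usual class of \<open>n\<close> times continuously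
  differentiable maps.
\<close>

primrec Ck_on :: "nat \<Rightarrow> 'a::real_normed_vector set \<Rightarrow> ('a \<Rightarrow> 'c::real_normed_vector) \<Rightarrow> bool" where
  "Ck_on 0 U f \<longleftrightarrow> continuous_on U f"
| "Ck_on (Suc n) U f \<longleftrightarrow> (\<forall>x\<in>U. f differentiable (at x)) \<and>
     (\<forall>v. Ck_on n U (\<lambda>x. frechet_derivative f (at x) v))"

definition smooth_on :: "'a::real_normed_vector set \<Rightarrow> ('a \<Rightarrow> 'c::real_normed_vector) \<Rightarrow> bool" where
  "smooth_on U f \<longleftrightarrow> (\<forall>n. Ck_on n U f)"

definition transition :: "('m, 'b) chart \<Rightarrow> ('m, 'b) chart \<Rightarrow> 'b \<Rightarrow> 'b" where
  "transition \<kappa> \<kappa>' = chart_map \<kappa>' \<circ> chart_inv \<kappa>"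

definition smooth_atlas :: "('m::topological_space, 'b::real_inner) chart set \<Rightarrow> bool" where
  "smooth_atlas \<A> \<longleftrightarrow> (\<forall>\<kappa>\<in>\<A>. is_chart \<kappa>) \<and> (\<Union>\<kappa>\<in>\<A>. chart_dom \<kappa>) = UNIV \<and>
     (\<forall>\<kappa>\<in>\<A>. \<forall>\<kappa>'\<in>\<A>. smooth_on (chart_map \<kappa> ` (chart_dom \<kappa> \<inter> chart_dom \<kappa>')) (transition \<kappa> \<kappa>'))"

text \<open>
  \<open>G \<kappa> p\<close> is the scalar product on the tangent space at \<open>p\<close>, written in the coordinates of the
  chart \<open>\<kappa>\<close> around \<open>p\<close>.
\<close>

type_synonym ('m, 'b) metric_tensor = "('m, 'b) chart \<Rightarrow> 'm \<Rightarrow> 'b \<Rightarrow> 'b \<Rightarrow> real"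

definition riemannian_metric ::
  "('m::topological_space, 'b::real_inner) chart set \<Rightarrow> ('m, 'b) metric_tensor \<Rightarrow> bool" where
  "riemannian_metric \<A> G \<longleftrightarrow>
     (\<forall>\<kappa>\<in>\<A>. \<forall>p\<in>chart_dom \<kappa>. bilinear (G \<kappa> p) \<and>
        (\<forall>v w. G \<kappa> p v w = G \<kappa> p w v) \<and> (\<forall>v. v \<noteq> 0 \<longrightarrow> G \<kappa> p v v > 0)) \<and>
     (\<forall>\<kappa>\<in>\<A>. \<forall>v w. smooth_on (chart_range \<kappa>) (\<lambda>x. G \<kappa> (chart_inv \<kappa> x) v w)) \<and>
     (\<forall>\<kappa>\<in>\<A>. \<forall>\<kappa>'\<in>\<A>. \<forall>p\<in>chart_dom \<kappa> \<inter> chart_dom \<kappa>'. \<forall>v w.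
        G \<kappa> p v w = G \<kappa>' p (frechet_derivative (transition \<kappa> \<kappa>') (at (chart_map \<kappa> p)) v)
                           (frechet_derivative (transition \<kappa> \<kappa>') (at (chart_map \<kappa> p)) w))"

text \<open>
  \<open>curve_length \<A> G p q L\<close>: some piecewise continuously differentiable curve from \<open>p\<close> to \<open>q\<close> has
  length \<open>L\<close>. Such a curve is cut into finitely many pieces, each parametrised by the unit interval
  and contained in the domain of a chart; \<open>\<gamma>\<close> is the last piece in coordinates.
\<close>

inductive curve_length ::
  "('m, 'b::real_inner) chart set \<Rightarrow> ('m, 'b) metric_tensor \<Rightarrow> 'm \<Rightarrow> 'm \<Rightarrow> real \<Rightarrow> bool"
  for \<A> G where
  refl: "curve_length \<A> G p p 0"
| piece: "\<lbrakk> curve_length \<A> G p q L; \<kappa> \<in> \<A>; q \<in> chart_dom \<kappa>; r \<in> chart_dom \<kappa>;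
     \<gamma> ` {0..1} \<subseteq> chart_range \<kappa>; \<gamma> 0 = chart_map \<kappa> q; \<gamma> 1 = chart_map \<kappa> r;
     \<forall>t\<in>{0..1}. (\<gamma> has_vector_derivative \<gamma>' t) (at t within {0..1});
     continuous_on {0..1} \<gamma>' \<rbrakk> \<Longrightarrow>
   curve_length \<A> G p r
     (L + integral {0..1::real} (\<lambda>t. sqrt (G \<kappa> (chart_inv \<kappa> (\<gamma> t)) (\<gamma>' t) (\<gamma>' t))))"

text \<open>
  The metric of the type \<open>'m\<close> induces the manifold topology and coincides with the Riemannian
  distance on each connected component. Connectedness is not required; the distance between points
  that no curve joins is left open. Since the charts map onto open sets, there is no boundary.
\<close>

definition compact_riemannian_manifold ::
  "('m::metric_space, 'b::real_inner) chart set \<Rightarrow> ('m, 'b) metric_tensor \<Rightarrow> bool" where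
  "compact_riemannian_manifold \<A> G \<longleftrightarrow>
     (\<exists>B::'b set. finite B \<and> span B = UNIV) \<and> compact (UNIV :: 'm set) \<and>
     smooth_atlas \<A> \<and> riemannian_metric \<A> G \<and>
     (\<forall>p q. (\<exists>L. curve_length \<A> G p q L) \<longrightarrow> dist p q = Inf {L. curve_length \<A> G p q L})"

section \<open>Twice continuously differentiable maps with locally bounded derivatives\<close>

text \<open>
  The Frechet derivatives are taken in the operator norm; \<open>D\<close> is meant to be open and the members
  of \<open>\<B>\<close> are the subsets of \<open>D\<close> on which the derivatives have to be bounded.
\<close>

definition C2_bounded ::
  "'a::real_normed_vector set \<Rightarrow> 'a set set \<Rightarrow> ('a \<Rightarrow> 'c::real_normed_vector) \<Rightarrow> bool" where
  "C2_bounded D \<B> f \<longleftrightarrow>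
     (\<exists>(f' :: 'a \<Rightarrow> 'a \<Rightarrow>\<^sub>L 'c) (f'' :: 'a \<Rightarrow> 'a \<Rightarrow>\<^sub>L ('a \<Rightarrow>\<^sub>L 'c)).
        (\<forall>x\<in>D. (f has_derivative blinfun_apply (f' x)) (at x)) \<and>
        (\<forall>x\<in>D. (f' has_derivative blinfun_apply (f'' x)) (at x)) \<and>
        continuous_on D f'' \<and>
        (\<forall>B\<in>\<B>. bounded (f' ` B) \<and> bounded (f'' ` B)))"

text \<open>
  For maps on \<open>('h \<times> M) \<times> 'e\<close>, derivatives are computed in the coordinates of charts of the compact
  manifold \<open>M\<close>, and a bound is required as long as the points of \<open>M\<close> stay in a compact part of the
  chart domain: near the edge of its domain a chart may be arbitrarily distorted. As \<open>M\<close> is compact,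
  finitely many such compact parts cover it, so that this is boundedness of the derivatives on
  bounded subsets of \<open>('h \<times> M) \<times> 'e\<close>, and it does not depend on the choice of the atlas.
\<close>

definition C2_bounded_into_vector ::
  "('m::topological_space, 'b::real_inner) chart set \<Rightarrow>
   ('h::real_normed_vector \<times> 'm \<Rightarrow> 'e::real_normed_vector \<Rightarrow> 'c::real_normed_vector) \<Rightarrow> bool" where
  "C2_bounded_into_vector \<A> F \<longleftrightarrow> (\<forall>\<kappa>\<in>\<A>.
     C2_bounded {(u, x, \<eta>). x \<in> chart_range \<kappa>}
       {{(u, x, \<eta>). (u, \<eta>) \<in> B \<and> x \<in> chart_map \<kappa> ` K} | B K.
          bounded B \<and> compact K \<and> K \<subseteq> chart_dom \<kappa>}
       (\<lambda>(u, x, \<eta>). F (u, chart_inv \<kappa> x) \<eta>))"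

definition C2_bounded_into_product ::
  "('m::topological_space, 'b::real_inner) chart set \<Rightarrow>
   ('h::real_normed_vector \<times> 'm \<Rightarrow> 'e::real_normed_vector \<Rightarrow> 'v::real_normed_vector \<times> 'm) \<Rightarrow> bool" where
  "C2_bounded_into_product \<A> F \<longleftrightarrow> (\<forall>\<kappa>\<in>\<A>. \<forall>\<kappa>'\<in>\<A>.
     C2_bounded {(u, x, \<eta>). x \<in> chart_range \<kappa> \<and> snd (F (u, chart_inv \<kappa> x) \<eta>) \<in> chart_dom \<kappa>'}
       {{(u, x, \<eta>). (u, \<eta>) \<in> B \<and> x \<in> chart_map \<kappa> ` K \<and> snd (F (u, chart_inv \<kappa> x) \<eta>) \<in> K'} | B K K'.
          bounded B \<and> compact K \<and> K \<subseteq> chart_dom \<kappa> \<and> compact K' \<and> K' \<subseteq> chart_dom \<kappa>'}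
       (\<lambda>(u, x, \<eta>). let y = F (u, chart_inv \<kappa> x) \<eta> in (fst y, chart_map \<kappa>' (snd y))))"

definition compact_embedding :: "('v::real_normed_vector \<Rightarrow> 'h::real_normed_vector) \<Rightarrow> bool" where
  "compact_embedding \<iota> \<longleftrightarrow> bounded_linear \<iota> \<and> inj \<iota> \<and>
     (\<forall>B. bounded B \<longrightarrow> compact (closure (\<iota> ` B)))"

section \<open>The special linear group\<close>

text \<open>The norm of \<open>real^'d^'d\<close> is the Euclidean norm of the vector of all entries.\<close>

definition SL :: "(real^'d^'d) set" where
  "SL = {Q. det Q = 1}"

definition tangent_SL :: "real^'d^'d \<Rightarrow> (real^'d^'d) set" where
  "tangent_SL Q = {Q ** X | X. trace X = 0}"

section \<open>The noise\<close>

definition measure_support :: "'e::topological_space measure \<Rightarrow> 'e set" where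
  "measure_support \<mu> = {x. \<forall>U. open U \<and> x \<in> U \<longrightarrow> emeasure \<mu> U > 0}"

definition iid_with_law :: "'w measure \<Rightarrow> (nat \<Rightarrow> 'w \<Rightarrow> 'e::topological_space) \<Rightarrow> 'e measure \<Rightarrow> bool" where
  "iid_with_law P \<eta> \<mu> \<longleftrightarrow>
     prob_space.indep_vars P (\<lambda>_. borel) \<eta> {1..} \<and> (\<forall>n\<ge>1. distr P borel (\<eta> n) = \<mu>)"

definition orthonormal_basis_on :: "nat set \<Rightarrow> (nat \<Rightarrow> 'e::real_inner) \<Rightarrow> bool" where
  "orthonormal_basis_on J \<phi> \<longleftrightarrow>
     (\<forall>i\<in>J. \<forall>j\<in>J. \<phi> i \<bullet> \<phi> j = (if i = j then 1 else 0)) \<and> closure (span (\<phi> ` J)) = UNIV"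

text \<open>
  The index set \<open>J\<close> of the basis is \<open>{1..}\<close>, or \<open>{1..N}\<close> if the space has finite dimension. By
  orthogonality, the series converges in the order of the indices if and only if it converges
  unconditionally.

  The coefficients \<open>b j\<close> are nonzero. With vanishing coefficients the noise could be deterministic,
  and then the transition function has no smoothing property, although the derivative with respect
  to the noise argument may still have a dense image.
\<close>

definition noise_decomposition ::
  "'w measure \<Rightarrow> (nat \<Rightarrow> 'w \<Rightarrow> 'e::real_inner) \<Rightarrow> nat set \<Rightarrow> (nat \<Rightarrow> 'e) \<Rightarrow> (nat \<Rightarrow> real) \<Rightarrow>
   (nat \<Rightarrow> nat \<Rightarrow> 'w \<Rightarrow> real) \<Rightarrow> (nat \<Rightarrow> real \<Rightarrow> real) \<Rightarrow> bool" where
  "noise_decomposition P \<eta> J \<phi> b \<xi> \<rho> \<longleftrightarrow>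
     (J = {1..} \<or> (\<exists>N. J = {1..N})) \<and> orthonormal_basis_on J \<phi> \<and>
     (\<forall>j\<in>J. b j \<noteq> 0) \<and> (\<lambda>j. (b j)\<^sup>2) summable_on J \<and>
     prob_space.indep_vars P (\<lambda>_. borel) (\<lambda>(j, k). \<xi> j k) (J \<times> {1..}) \<and>
     (\<forall>j\<in>J. (\<forall>x. \<rho> j x \<ge> 0) \<and> (\<exists>L. L-lipschitz_on UNIV (\<rho> j)) \<and>
        (\<forall>k\<ge>1. distributed P lborel (\<xi> j k) (\<lambda>x. ennreal (\<rho> j x)))) \<and>
     (\<forall>k\<ge>1. AE \<omega> in P. ((\<lambda>j. (b j * \<xi> j k \<omega>) *\<^sub>R \<phi> j) has_sum \<eta> k \<omega>) J)"

section \<open>The extended transition function\<close>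

definition ext_transition ::
  "('h::real_normed_vector \<times> 'm::metric_space) set \<Rightarrow> 'e::topological_space measure \<Rightarrow>
   ('h \<times> 'm \<Rightarrow> 'e \<Rightarrow> 'h \<times> 'm) \<Rightarrow> ('h \<times> 'm \<Rightarrow> 'e \<Rightarrow> real^'d^'d) \<Rightarrow> 'h \<times> 'm \<Rightarrow>
   (('h \<times> 'm) \<times> (real^'d^'d)) measure" where
  "ext_transition X \<mu> S A z =
     distr (restrict_space \<mu> (measure_support \<mu>)) (restrict_space borel (X \<times> SL)) (\<lambda>\<eta>. (S z \<eta>, A z \<eta>))"

text \<open>
  The set of all \<open>\<eta>\<close> in the support such that the derivative of \<open>\<eta> \<mapsto> (S z \<eta>, A z \<eta>)\<close> has dense
  image; the tangent space of \<open>M\<close> at the second component of \<open>S z \<eta>\<close> is identified with \<open>'b\<close> by a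
  chart around that point.
\<close>

definition dense_image_set ::
  "('m::topological_space, 'b::real_inner) chart set \<Rightarrow> 'e::real_normed_vector measure \<Rightarrow>
   ('h::real_normed_vector \<times> 'm \<Rightarrow> 'e \<Rightarrow> 'h \<times> 'm) \<Rightarrow> ('h \<times> 'm \<Rightarrow> 'e \<Rightarrow> real^'d^'d) \<Rightarrow>
   'h \<times> 'm \<Rightarrow> 'e set" where
  "dense_image_set \<A> \<mu> S A z =
     {\<eta> \<in> measure_support \<mu>. \<exists>\<kappa>\<in>\<A>. snd (S z \<eta>) \<in> chart_dom \<kappa> \<and>
        (\<exists>D. ((\<lambda>\<zeta>. (fst (S z \<zeta>), chart_map \<kappa> (snd (S z \<zeta>)), A z \<zeta>)) has_derivative D) (at \<eta>) \<and>
             closure (range D) = UNIV \<times> UNIV \<times> tangent_SL (A z \<eta>))}"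

section \<open>Hoelder functions\<close>

text \<open>
  The element 0 is inserted only to give the supremum of the empty set the value 0; all other
  elements are nonnegative.
\<close>

definition sup_norm_on :: "'z set \<Rightarrow> ('z \<Rightarrow> real) \<Rightarrow> real" where
  "sup_norm_on Z f = Sup (insert 0 ((\<lambda>z. \<bar>f z\<bar>) ` Z))"

definition holder_quotients :: "real \<Rightarrow> 'z::metric_space set \<Rightarrow> ('z \<Rightarrow> real) \<Rightarrow> real set" where
  "holder_quotients \<alpha> Z f =
     {\<bar>f x - f y\<bar> / dist x y powr \<alpha> | x y. x \<in> Z \<and> y \<in> Z \<and> 0 < dist x y \<and> dist x y \<le> 1}"

definition holder_norm :: "real \<Rightarrow> 'z::metric_space set \<Rightarrow> ('z \<Rightarrow> real) \<Rightarrow> real" where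
  "holder_norm \<alpha> Z f = sup_norm_on Z f + Sup (insert 0 (holder_quotients \<alpha> Z f))"

definition holder_space :: "real \<Rightarrow> 'z::metric_space set \<Rightarrow> ('z \<Rightarrow> real) set" where
  "holder_space \<alpha> Z = {f. continuous_on Z f \<and> bdd_above ((\<lambda>z. \<bar>f z\<bar>) ` Z) \<and>
     bdd_above (holder_quotients \<alpha> Z f)}"

end

theory Submission
  imports Defs
begin

text \<open>
  Write \<open>\<psi> z e = (S z e, A z e)\<close> and let \<open>\<mu>\<close> be the law of the noise. The claim is a smoothing
  property: if \<open>z1\<close> and \<open>z2\<close> are close, the effect of replacing \<open>z1\<close> by \<open>z2\<close> can almost be undone by
  shifting the noise, and the law of the noise hardly notices the shift.

  Steering. Fix \<open>z0\<close> and a noise value \<open>e0\<close> at which the derivative of \<open>\<psi> z0\<close> has dense image. In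
  charts \<open>\<psi>\<close> is strictly differentiable at \<open>(z0, e0)\<close>, with a derivative \<open>T\<close>. By the compact
  embedding and the finite dimension of the manifold and of the matrices, the vectors \<open>T (w, 0)\<close> with
  \<open>norm w \<le> 1\<close> lie in a compact set, and \<open>T (w, 0)\<close> is tangent to the target, so that it can be
  approximated by some \<open>- T (0, v)\<close>. Compactness leaves finitely many directions to approximate, hence
  \<open>v\<close> may be taken from the span of finitely many basis vectors, with norm at most a constant times
  that of \<open>w\<close> (\<open>approximate_steering\<close>). Strict differentiability makes the same shift \<open>v\<close> work for all
  \<open>e\<close> in a fixed ball around \<open>e0\<close>: the distance of \<open>\<psi> z1 e\<close> and \<open>\<psi> z2 (e + v)\<close> is at most
  \<open>\<delta> * dist z1 z2\<close>, with \<open>\<delta>\<close> as small as desired (\<open>noise_steering\<close>). Passing between distances on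
  the manifold and norms in coordinates requires that charts are locally bi-Lipschitz for the
  Riemannian distance (\<open>chart_locally_bilipschitz\<close>).

  Invariance. Along each basis vector the noise has an independent coordinate with a Lipschitz
  density of bounded support. Therefore shifting the noise by \<open>v\<close> changes the integral of a function
  bounded by \<open>B\<close> by at most a constant times \<open>B * norm v\<close>, as long as \<open>v\<close> stays in the span of finitely
  many basis vectors (\<open>noise_translation\<close>).

  Conclusion. The noise values \<open>e0\<close> as above have full measure, so finitely many balls as
  above miss only a set of measure \<open>\<epsilon>\<close>. With cutoff functions, on the balls the difference of the
  integrals is at most a constant times \<open>dist z1 z2\<close> times the supremum norm of \<open>g\<close>, by invariance, plus
  \<open>2 * sqrt (\<delta> * dist z1 z2)\<close> times the Hoelder norm, by steering. Outside the balls the Lipschitz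
  continuity of \<open>\<psi>\<close> gives the Hoelder norm times \<open>2 * \<epsilon> * sqrt (L * dist z1 z2)\<close>, where \<open>L\<close> does not depend
  on \<open>\<delta>\<close> and \<open>\<epsilon>\<close>; so \<open>\<delta>\<close> and \<open>\<epsilon>\<close> can be chosen to make the factor of the Hoelder norm at most \<open>c\<close>
  (\<open>local_estimate\<close>). Compactness of the state space makes the constants uniform
  (\<open>global_estimate\<close>).
\<close>

section \<open>Finite-dimensional inner product spaces\<close>

text \<open>
  The induction step is one step of the Gram-Schmidt process. The result is stated outside the class
  \<open>euclidean_space\<close> because the model space of a manifold may have dimension zero.
\<close>

lemma finite_spanning_orthonormal:
  fixes B :: "'b::real_inner set"
  assumes "finite B"
  shows "\<exists>C. finite C \<and> span C = span B \<and> (\<forall>a\<in>C. \<forall>b\<in>C. a \<bullet> b = (if a = b then 1 else 0))"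
  using assms
proof (induction B rule: finite_induct)
  case empty
  show ?case by (intro exI[of _ "{}"]) auto
next
  case (insert x B)
  then obtain C where C: "finite C" "span C = span B"
    and on: "\<And>a b. a \<in> C \<Longrightarrow> b \<in> C \<Longrightarrow> a \<bullet> b = (if a = b then 1 else 0)" by blast
  define y where "y = x - (\<Sum>c\<in>C. (x \<bullet> c) *\<^sub>R c)"
  have yc: "y \<bullet> c = 0" if "c \<in> C" for c
  proof -
    have "(\<Sum>d\<in>C. (x \<bullet> d) *\<^sub>R d) \<bullet> c = (\<Sum>d\<in>C. (x \<bullet> d) * (if d = c then 1 else 0))"
      using that by (simp add: inner_sum_left on)
    also have "\<dots> = x \<bullet> c" using that C(1) by (simp add: if_distrib cong: if_cong)
    finally show ?thesis by (simp add: y_def inner_diff_left)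
  qed
  have sumC: "(\<Sum>c\<in>C. (x \<bullet> c) *\<^sub>R c) \<in> span C"
    by (intro span_sum span_scale span_base)
  have sp: "span (insert x B) = span (insert y C)"
  proof -
    have "span (insert x B) = span (insert x C)"
      using C(2) by (simp add: span_insert)
    also have "\<dots> = span (insert y C)"
      by (rule eq_span_insert_eq) (simp add: y_def sumC)
    finally show ?thesis .
  qed
  show ?case
  proof (cases "y = 0")
    case True
    then have "span (insert x B) = span C" using sp by (simp add: span_insert_0)
    then show ?thesis using C(1) on by blast
  next
    case False
    define e where "e = y /\<^sub>R norm y"
    have ee: "e \<bullet> e = 1" using False by (simp add: e_def power2_norm_eq_inner[symmetric] power2_eq_square field_simps)
    have ec: "e \<bullet> c = 0" "c \<bullet> e = 0" if "c \<in> C" for c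
      using yc[OF that] by (simp_all add: e_def inner_commute)
    have "span (insert e C) = span (insert y C)"
    proof (rule span_eq[THEN iffD2], intro conjI insert_subsetI)
      show "e \<in> span (insert y C)" by (simp add: e_def span_base span_scale)
      have "y = norm y *\<^sub>R e" using False by (simp add: e_def)
      then show "y \<in> span (insert e C)" by (metis insertI1 span_base span_scale)
    qed (auto intro: span_base)
    moreover have "e \<notin> C" using ee ec(1) by auto
    ultimately show ?thesis using C(1) on sp ee ec
      by (intro exI[of _ "insert e C"]) auto
  qed
qed

lemma finite_dimensional_frame:
  assumes "\<exists>B::'b::real_inner set. finite B \<and> span B = UNIV"
  obtains B :: "'b::real_inner set" where "finite B" "\<And>b. b \<in> B \<Longrightarrow> norm b = 1"
    "\<And>v. v = (\<Sum>b\<in>B. (v \<bullet> b) *\<^sub>R b)"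
proof -
  obtain B :: "'b set" where B: "finite B" "span B = UNIV"
    and on: "\<And>a b. a \<in> B \<Longrightarrow> b \<in> B \<Longrightarrow> a \<bullet> b = (if a = b then 1 else 0)"
    using assms finite_spanning_orthonormal by metis
  have "v = (\<Sum>b\<in>B. (v \<bullet> b) *\<^sub>R b)" for v
  proof -
    have "v \<in> span B" by (simp add: B)
    then obtain t where t: "v = (\<Sum>b\<in>B. t b *\<^sub>R b)"
      using span_finite[OF B(1)] by auto
    have "v \<bullet> b = t b" if "b \<in> B" for b
    proof -
      have "v \<bullet> b = (\<Sum>d\<in>B. t d * (if d = b then 1 else 0))"
        unfolding t using that by (simp add: inner_sum_left on)
      also have "\<dots> = t b" using that B(1) by (simp add: if_distrib cong: if_cong)
      finally show ?thesis .
    qed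
    then show ?thesis using t by simp
  qed
  moreover have "norm b = 1" if "b \<in> B" for b using on[OF that that] by (simp add: norm_eq_1)
  ultimately show ?thesis using that B(1) by blast
qed

text \<open>
  The ball lies in the continuous image of a cube of coordinates.
\<close>

lemma finite_dimensional_compact_cball:
  fixes x :: "'b::real_inner"
  assumes "\<exists>B::'b set. finite B \<and> span B = UNIV"
  shows "compact (cball x r)"
proof -
  obtain B :: "'b set" where B: "finite B" "\<And>b. b \<in> B \<Longrightarrow> norm b = 1"
    "\<And>v. v = (\<Sum>b\<in>B. (v \<bullet> b) *\<^sub>R b)"
    using finite_dimensional_frame[OF assms] by blast
  define R where "R = norm x + r"
  have comp: "compact {\<Sum>b\<in>C. t b *\<^sub>R b | t. \<forall>b\<in>C. \<bar>t b\<bar> \<le> R}" if "finite C" for C :: "'b set"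
    using that
  proof (induction C rule: finite_induct)
    case empty
    show ?case by simp
  next
    case (insert c C)
    let ?K = "{\<Sum>b\<in>C. t b *\<^sub>R b | t. \<forall>b\<in>C. \<bar>t b\<bar> \<le> R}"
    have "{\<Sum>b\<in>insert c C. t b *\<^sub>R b | t. \<forall>b\<in>insert c C. \<bar>t b\<bar> \<le> R}
       = (\<lambda>(s, y). s *\<^sub>R c + y) ` ({-R..R} \<times> ?K)" (is "?L = ?Q")
    proof (intro equalityI subsetI)
      fix y assume "y \<in> ?L"
      then obtain t where "y = (\<Sum>b\<in>insert c C. t b *\<^sub>R b)" "\<forall>b\<in>insert c C. \<bar>t b\<bar> \<le> R" by blast
      then show "y \<in> ?Q" using insert
        by (intro image_eqI[of _ _ "(t c, \<Sum>b\<in>C. t b *\<^sub>R b)"]) (auto simp: abs_le_iff)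
    next
      fix y assume "y \<in> ?Q"
      then obtain z where z: "y = (\<lambda>(s, y). s *\<^sub>R c + y) z" "z \<in> {-R..R} \<times> ?K"
        by (rule imageE)
      define s w where "s = fst z" and "w = snd z"
      have sw: "s \<in> {-R..R}" "w \<in> ?K" "y = s *\<^sub>R c + w"
        using z unfolding s_def w_def mem_Times_iff case_prod_beta by (blast, blast, blast)
      from sw(2) obtain t where t: "w = (\<Sum>b\<in>C. t b *\<^sub>R b)" "\<forall>b\<in>C. \<bar>t b\<bar> \<le> R" by blast
      have st: "\<bar>s\<bar> \<le> R" "\<forall>b\<in>C. \<bar>t b\<bar> \<le> R" "y = s *\<^sub>R c + (\<Sum>b\<in>C. t b *\<^sub>R b)"
        using sw t by (simp_all add: abs_le_iff)
      have "(\<Sum>b\<in>C. t b *\<^sub>R b) = (\<Sum>b\<in>C. (t(c := s)) b *\<^sub>R b)"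
        using insert by (intro sum.cong) auto
      then have "y = (\<Sum>b\<in>insert c C. (t(c := s)) b *\<^sub>R b)" using st insert by simp
      moreover have "\<forall>b\<in>insert c C. \<bar>(t(c := s)) b\<bar> \<le> R" using st by auto
      ultimately show "y \<in> ?L" by blast
    qed
    moreover have "compact ?Q"
      by (intro compact_continuous_image compact_Times insert.IH compact_Icc)
         (auto simp: case_prod_beta intro!: continuous_intros)
    ultimately show ?case by simp
  qed
  have "cball x r \<subseteq> {\<Sum>b\<in>B. t b *\<^sub>R b | t. \<forall>b\<in>B. \<bar>t b\<bar> \<le> R}"
  proof
    fix v assume "v \<in> cball x r"
    then have "norm (v - x) \<le> r" by (simp add: dist_norm norm_minus_commute)
    then have "norm v \<le> R" unfolding R_def by norm
    then have "\<bar>v \<bullet> b\<bar> \<le> R" if "b \<in> B" for b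
      using Cauchy_Schwarz_ineq2[of v b] B(2)[OF that] by simp
    then show "v \<in> {\<Sum>b\<in>B. t b *\<^sub>R b | t. \<forall>b\<in>B. \<bar>t b\<bar> \<le> R}"
      using B(3)[of v] by blast
  qed
  then have "{\<Sum>b\<in>B. t b *\<^sub>R b | t. \<forall>b\<in>B. \<bar>t b\<bar> \<le> R} \<inter> cball x r = cball x r" by blast
  with compact_Int_closed[OF comp[OF B(1)] closed_cball[of x r]] show ?thesis by (simp only:)
qed

section \<open>Riemannian metrics and curves in charts\<close>

lemma chart_inv_map [simp]: "is_chart \<kappa> \<Longrightarrow> p \<in> chart_dom \<kappa> \<Longrightarrow> chart_inv \<kappa> (chart_map \<kappa> p) = p"
  and chart_map_inv [simp]: "is_chart \<kappa> \<Longrightarrow> x \<in> chart_range \<kappa> \<Longrightarrow> chart_map \<kappa> (chart_inv \<kappa> x) = x"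
  and chart_inv_in_dom [simp]: "is_chart \<kappa> \<Longrightarrow> x \<in> chart_range \<kappa> \<Longrightarrow> chart_inv \<kappa> x \<in> chart_dom \<kappa>"
  and chart_map_in_range [simp]: "p \<in> chart_dom \<kappa> \<Longrightarrow> chart_map \<kappa> p \<in> chart_range \<kappa>"
  and continuous_on_chart_map: "is_chart \<kappa> \<Longrightarrow> continuous_on (chart_dom \<kappa>) (chart_map \<kappa>)"
  and continuous_on_chart_inv: "is_chart \<kappa> \<Longrightarrow> continuous_on (chart_range \<kappa>) (chart_inv \<kappa>)"
  and open_chart_dom: "is_chart \<kappa> \<Longrightarrow> open (chart_dom \<kappa>)"
  and open_chart_range: "is_chart \<kappa> \<Longrightarrow> open (chart_range \<kappa>)"
  unfolding is_chart_def homeomorphism_def chart_range_def by auto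

lemma manifold_is_chart: "compact_riemannian_manifold \<A> G \<Longrightarrow> \<kappa> \<in> \<A> \<Longrightarrow> is_chart \<kappa>"
  unfolding compact_riemannian_manifold_def smooth_atlas_def by blast

lemma manifold_chart_exists:
  assumes "compact_riemannian_manifold \<A> G"
  obtains \<kappa> where "\<kappa> \<in> \<A>" "p \<in> chart_dom \<kappa>"
  using assms unfolding compact_riemannian_manifold_def smooth_atlas_def by blast

lemma smooth_on_continuous: "smooth_on U f \<Longrightarrow> continuous_on U f"
  unfolding smooth_on_def by (metis Ck_on.simps(1))

lemma smooth_on_has_derivative:
  "smooth_on U f \<Longrightarrow> x \<in> U \<Longrightarrow> (f has_derivative frechet_derivative f (at x)) (at x)"
  unfolding smooth_on_def by (metis Ck_on.simps(2) frechet_derivative_works)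

lemma open_chart_overlap:
  assumes "is_chart \<kappa>" "is_chart \<kappa>'"
  shows "open (chart_map \<kappa> ` (chart_dom \<kappa> \<inter> chart_dom \<kappa>'))"
proof -
  have "chart_map \<kappa> ` (chart_dom \<kappa> \<inter> chart_dom \<kappa>') = chart_range \<kappa> \<inter> chart_inv \<kappa> -` chart_dom \<kappa>'"
  proof (intro equalityI subsetI)
    fix x assume "x \<in> chart_range \<kappa> \<inter> chart_inv \<kappa> -` chart_dom \<kappa>'"
    then show "x \<in> chart_map \<kappa> ` (chart_dom \<kappa> \<inter> chart_dom \<kappa>')"
      using assms by (intro image_eqI[of _ _ "chart_inv \<kappa> x"]) auto
  qed (use assms in auto)
  then show ?thesis
    using continuous_open_preimage[OF continuous_on_chart_inv open_chart_range open_chart_dom] assms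
    by metis
qed

text \<open>
  Smoothness of the metric tensor is assumed for fixed vectors only; expanding in a basis gives joint
  continuity in the point and the vector.
\<close>

lemma metric_tensor_continuous_along:
  fixes \<A> :: "('m::metric_space, 'b::real_inner) chart set"
  assumes M: "compact_riemannian_manifold \<A> G" and \<kappa>: "\<kappa> \<in> \<A>"
    and \<gamma>: "continuous_on T \<gamma>" "\<gamma> ` T \<subseteq> chart_range \<kappa>" and v: "continuous_on T v"
  shows "continuous_on T (\<lambda>t. G \<kappa> (chart_inv \<kappa> (\<gamma> t)) (v t) (v t))"
proof -
  have fd: "\<exists>B::'b set. finite B \<and> span B = UNIV"
    using M by (simp add: compact_riemannian_manifold_def)
  obtain B :: "'b set" where B: "finite B" "\<And>b. b \<in> B \<Longrightarrow> norm b = 1"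
    and Bv: "\<And>v. v = (\<Sum>b\<in>B. (v \<bullet> b) *\<^sub>R b)"
    using finite_dimensional_frame[OF fd] by blast
  note ch = manifold_is_chart[OF M \<kappa>]
  have rm: "riemannian_metric \<A> G" using M by (simp add: compact_riemannian_manifold_def)
  have "G \<kappa> (chart_inv \<kappa> (\<gamma> t)) (v t) (v t) =
      (\<Sum>(a, b)\<in>B \<times> B. (v t \<bullet> a) * ((v t \<bullet> b) * G \<kappa> (chart_inv \<kappa> (\<gamma> t)) a b))" if "t \<in> T" for t
  proof -
    have bl: "bilinear (G \<kappa> (chart_inv \<kappa> (\<gamma> t)))"
      using rm \<kappa> ch \<gamma>(2) that unfolding riemannian_metric_def by (metis chart_inv_in_dom image_subset_iff)
    have "G \<kappa> (chart_inv \<kappa> (\<gamma> t)) (v t) (v t) =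
      G \<kappa> (chart_inv \<kappa> (\<gamma> t)) (\<Sum>b\<in>B. (v t \<bullet> b) *\<^sub>R b) (\<Sum>b\<in>B. (v t \<bullet> b) *\<^sub>R b)"
      using Bv[of "v t"] by simp
    then show ?thesis
      by (simp add: bilinear_sum[OF bl] bilinear_lmul[OF bl] bilinear_rmul[OF bl] ac_simps)
  qed
  moreover have "continuous_on T (\<lambda>t. G \<kappa> (chart_inv \<kappa> (\<gamma> t)) a b)" for a b
    using rm \<kappa> \<gamma> unfolding riemannian_metric_def
    by (intro continuous_on_compose2[of "chart_range \<kappa>" "\<lambda>x. G \<kappa> (chart_inv \<kappa> x) a b" T \<gamma>]
         smooth_on_continuous) auto
  then have "continuous_on T
      (\<lambda>t. \<Sum>(a, b)\<in>B \<times> B. (v t \<bullet> a) * ((v t \<bullet> b) * G \<kappa> (chart_inv \<kappa> (\<gamma> t)) a b))"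
    by (auto simp: case_prod_beta intro!: continuous_intros v)
  ultimately show ?thesis by (simp cong: continuous_on_cong)
qed

text \<open>
  The quadratic form is continuous and positive on the compact product of a small ball with the unit
  sphere; the bounds on the sphere extend to all vectors by homogeneity.
\<close>

lemma metric_tensor_bounds:
  fixes \<A> :: "('m::metric_space, 'b::real_inner) chart set"
  assumes M: "compact_riemannian_manifold \<A> G" and \<kappa>: "\<kappa> \<in> \<A>" and x0: "x0 \<in> chart_range \<kappa>"
  obtains r m K :: real where "r > 0" "m > 0" "K > 0" "cball x0 r \<subseteq> chart_range \<kappa>"
    "\<And>x v. x \<in> cball x0 r \<Longrightarrow> m * (norm v)\<^sup>2 \<le> G \<kappa> (chart_inv \<kappa> x) v v"
    "\<And>x v. x \<in> cball x0 r \<Longrightarrow> G \<kappa> (chart_inv \<kappa> x) v v \<le> K * (norm v)\<^sup>2"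
proof -
  note ch = manifold_is_chart[OF M \<kappa>]
  have fd: "\<exists>B::'b set. finite B \<and> span B = UNIV" and rm: "riemannian_metric \<A> G"
    using M by (simp_all add: compact_riemannian_manifold_def)
  have bl: "bilinear (G \<kappa> (chart_inv \<kappa> x))" if "x \<in> chart_range \<kappa>" for x
    using rm \<kappa> ch that unfolding riemannian_metric_def by (metis chart_inv_in_dom)
  have pos: "G \<kappa> (chart_inv \<kappa> x) v v > 0" if "x \<in> chart_range \<kappa>" "v \<noteq> 0" for x v
    using rm \<kappa> ch that unfolding riemannian_metric_def by (metis chart_inv_in_dom)
  obtain R where R: "R > 0" "cball x0 R \<subseteq> chart_range \<kappa>"
    using open_chart_range[OF ch] x0 open_contains_cball by blast
  let ?Q = "cball x0 R \<times> sphere (0::'b) 1"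
  have "closed (sphere (0::'b) 1)"
    unfolding sphere_def by (intro closed_Collect_eq continuous_intros)
  moreover have "cball 0 1 \<inter> sphere (0::'b) 1 = sphere 0 1" by auto
  ultimately have "compact (sphere (0::'b) 1)"
    using compact_Int_closed[OF finite_dimensional_compact_cball[OF fd, of "0::'b" 1]] by metis
  then have cQ: "compact ?Q" by (intro compact_Times finite_dimensional_compact_cball[OF fd])
  let ?g = "\<lambda>(x, v). G \<kappa> (chart_inv \<kappa> x) v v"
  have cg: "continuous_on ?Q ?g"
    unfolding case_prod_beta using R(2)
    by (intro metric_tensor_continuous_along[OF M \<kappa>] continuous_intros) auto
  have "\<exists>m K. m > 0 \<and> K > 0 \<and> (\<forall>p\<in>?Q. m \<le> ?g p \<and> ?g p \<le> K)"
  proof (cases "?Q = {}")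
    case True
    then show ?thesis by (intro exI[of _ 1]) auto
  next
    case False
    obtain p where p: "p \<in> ?Q" "\<And>q. q \<in> ?Q \<Longrightarrow> ?g p \<le> ?g q"
      using continuous_attains_inf[OF cQ False cg] by blast
    obtain p' where p': "p' \<in> ?Q" "\<And>q. q \<in> ?Q \<Longrightarrow> ?g q \<le> ?g p'"
      using continuous_attains_sup[OF cQ False cg] by blast
    have "fst p \<in> chart_range \<kappa>" "snd p \<noteq> 0" using p(1) R(2) by (auto simp: mem_Times_iff)
    then have "?g p > 0" using pos[of "fst p" "snd p"] by (simp add: case_prod_beta)
    moreover have "?g p' > 0" using \<open>?g p > 0\<close> p(2)[OF p'(1)] by linarith
    ultimately show ?thesis using p p' by blast
  qed
  then obtain m K where mK: "m > 0" "K > 0" "\<And>p. p \<in> ?Q \<Longrightarrow> m \<le> ?g p" "\<And>p. p \<in> ?Q \<Longrightarrow> ?g p \<le> K"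
    by blast
  have hom: "G \<kappa> (chart_inv \<kappa> x) v v = (norm v)\<^sup>2 * G \<kappa> (chart_inv \<kappa> x) (v /\<^sub>R norm v) (v /\<^sub>R norm v)"
    if "x \<in> chart_range \<kappa>" "v \<noteq> 0" for x v
    using that by (simp add: bilinear_lmul[OF bl] bilinear_rmul[OF bl] power2_eq_square field_simps)
  have zero: "G \<kappa> (chart_inv \<kappa> x) 0 0 = 0" if "x \<in> chart_range \<kappa>" for x
    using bilinear_lzero[OF bl[OF that]] .
  show ?thesis
  proof (rule that[OF R(1) mK(1,2) R(2)])
    fix x v assume x: "x \<in> cball x0 R"
    then have xr: "x \<in> chart_range \<kappa>" using R(2) by blast
    show "m * (norm v)\<^sup>2 \<le> G \<kappa> (chart_inv \<kappa> x) v v"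
    proof (cases "v = 0")
      case False
      have "m \<le> G \<kappa> (chart_inv \<kappa> x) (v /\<^sub>R norm v) (v /\<^sub>R norm v)"
        using mK(3)[of "(x, v /\<^sub>R norm v)"] x False by simp
      then show ?thesis by (subst hom[OF xr False]) (metis mult.commute mult_left_mono zero_le_power2)
    qed (simp add: zero[OF xr])
    show "G \<kappa> (chart_inv \<kappa> x) v v \<le> K * (norm v)\<^sup>2"
    proof (cases "v = 0")
      case False
      have "G \<kappa> (chart_inv \<kappa> x) (v /\<^sub>R norm v) (v /\<^sub>R norm v) \<le> K"
        using mK(4)[of "(x, v /\<^sub>R norm v)"] x False by simp
      then show ?thesis by (subst hom[OF xr False]) (metis mult.commute mult_left_mono zero_le_power2)
    qed (simp add: zero[OF xr])
  qed
qed

lemma metric_tensor_nonneg: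
  assumes "compact_riemannian_manifold \<A> G" "\<kappa> \<in> \<A>" "p \<in> chart_dom \<kappa>"
  shows "G \<kappa> p v v \<ge> 0"
proof (cases "v = 0")
  case True
  have "bilinear (G \<kappa> p)" using assms by (auto simp: compact_riemannian_manifold_def riemannian_metric_def)
  then show ?thesis using True by (simp add: bilinear_lzero)
next
  case False
  have "riemannian_metric \<A> G" using assms by (simp add: compact_riemannian_manifold_def)
  then have "G \<kappa> p v v > 0"
    using assms False unfolding riemannian_metric_def by blast
  then show ?thesis by simp
qed

text \<open>
  Without integrability of the speed the integral in \<open>curve_length\<close> would have the default value 0.
\<close>

lemma speed_continuous:
  assumes "compact_riemannian_manifold \<A> G" "\<kappa> \<in> \<A>" "\<gamma> ` {0..1::real} \<subseteq> chart_range \<kappa>"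
    and "\<forall>t\<in>{0..1}. (\<gamma> has_vector_derivative \<gamma>' t) (at t within {0..1})" "continuous_on {0..1} \<gamma>'"
  shows "continuous_on {0..1} (\<lambda>t. sqrt (G \<kappa> (chart_inv \<kappa> (\<gamma> t)) (\<gamma>' t) (\<gamma>' t)))"
proof -
  have "continuous_on {0..1} \<gamma>"
    using assms(4) by (meson continuous_on_eq_continuous_within has_vector_derivative_continuous)
  then show ?thesis
    using metric_tensor_continuous_along[OF assms(1,2) _ assms(3,5)] continuous_on_real_sqrt by blast
qed

lemma curve_length_nonneg:
  assumes M: "compact_riemannian_manifold \<A> G" and "curve_length \<A> G p q L"
  shows "L \<ge> 0"
  using assms(2)
proof (induction rule: curve_length.induct)
  case (piece p q L \<kappa> r \<gamma> \<gamma>')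
  have "0 \<le> integral {0..1::real} (\<lambda>t. sqrt (G \<kappa> (chart_inv \<kappa> (\<gamma> t)) (\<gamma>' t) (\<gamma>' t)))"
    using piece speed_continuous[OF M piece(2,5,8,9)] manifold_is_chart[OF M piece(2)]
    by (intro integral_nonneg integrable_continuous_real)
       (auto intro!: metric_tensor_nonneg[OF M piece(2)] simp: image_subset_iff)
  then show ?case using piece by simp
qed simp

lemma dist_le_curve_length:
  assumes "compact_riemannian_manifold \<A> G" "curve_length \<A> G p q L"
  shows "dist p q \<le> L"
proof -
  have "dist p q = Inf {L. curve_length \<A> G p q L}"
    using assms unfolding compact_riemannian_manifold_def by blast
  also have "\<dots> \<le> L"
    using assms curve_length_nonneg by (intro cInf_lower bdd_belowI[of _ 0]) auto
  finally show ?thesis .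
qed

lemma curve_length_segment:
  assumes M: "compact_riemannian_manifold \<A> G" and \<kappa>: "\<kappa> \<in> \<A>"
    and pq: "p \<in> chart_dom \<kappa>" "q \<in> chart_dom \<kappa>"
    and C: "convex C" "C \<subseteq> chart_range \<kappa>" "chart_map \<kappa> p \<in> C" "chart_map \<kappa> q \<in> C"
    and K: "K > 0" "\<And>x v. x \<in> C \<Longrightarrow> G \<kappa> (chart_inv \<kappa> x) v v \<le> K * (norm v)\<^sup>2"
  shows "\<exists>L \<le> sqrt K * norm (chart_map \<kappa> q - chart_map \<kappa> p). curve_length \<A> G p q L"
proof -
  define x y where "x = chart_map \<kappa> p" and "y = chart_map \<kappa> q"
  define \<gamma> where "\<gamma> t = x + t *\<^sub>R (y - x)" for t :: real
  have \<gamma>C: "\<gamma> t \<in> C" if "t \<in> {0..1}" for t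
    using convexD_alt[OF C(1), of x y t] C(3,4) that unfolding \<gamma>_def x_def y_def
    by (simp add: algebra_simps)
  have der: "\<forall>t\<in>{0..1}. (\<gamma> has_vector_derivative (y - x)) (at t within {0..1})"
    unfolding \<gamma>_def by (auto intro!: derivative_eq_intros)
  have ran: "\<gamma> ` {0..1} \<subseteq> chart_range \<kappa>" using \<gamma>C C(2) by auto
  have "curve_length \<A> G p q (0 + integral {0..1::real} (\<lambda>t. sqrt (G \<kappa> (chart_inv \<kappa> (\<gamma> t)) (y - x) (y - x))))"
    using curve_length.piece[OF curve_length.refl \<kappa> pq ran _ _ der] by (simp add: \<gamma>_def x_def y_def)
  moreover have "integral {0..1::real} (\<lambda>t. sqrt (G \<kappa> (chart_inv \<kappa> (\<gamma> t)) (y - x) (y - x)))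
      \<le> integral {0..1::real} (\<lambda>t. sqrt K * norm (y - x))"
  proof (rule integral_le)
    show "(\<lambda>t. sqrt (G \<kappa> (chart_inv \<kappa> (\<gamma> t)) (y - x) (y - x))) integrable_on {0..1}"
      using der by (intro integrable_continuous_real speed_continuous[OF M \<kappa> ran]) auto
    show "sqrt (G \<kappa> (chart_inv \<kappa> (\<gamma> t)) (y - x) (y - x)) \<le> sqrt K * norm (y - x)" if "t \<in> {0..1}" for t
    proof -
      have "sqrt (G \<kappa> (chart_inv \<kappa> (\<gamma> t)) (y - x) (y - x)) \<le> sqrt (K * (norm (y - x))\<^sup>2)"
        using K(2)[OF \<gamma>C[OF that], of "y - x"] by simp
      then show ?thesis using K(1) by (simp add: real_sqrt_mult)
    qed
  qed auto
  ultimately show ?thesis by (auto simp: x_def y_def)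
qed

text \<open>
  A global function on the manifold can be followed along a curve through all its charts, piece by
  piece. Lower bounds for the Riemannian distance are obtained in this way, without cutting a curve at
  the point where it leaves a chart.
\<close>

lemma lipschitz_along_curves:
  fixes \<Phi> :: "'m::metric_space \<Rightarrow> 'c::real_normed_vector"
  assumes M: "compact_riemannian_manifold \<A> G" and C: "C \<ge> 0"
    and der: "\<And>\<kappa> x. \<kappa> \<in> \<A> \<Longrightarrow> x \<in> chart_range \<kappa> \<Longrightarrow>
      \<exists>D. ((\<lambda>x. \<Phi> (chart_inv \<kappa> x)) has_derivative D) (at x) \<and>
          (\<forall>v. norm (D v) \<le> C * sqrt (G \<kappa> (chart_inv \<kappa> x) v v))"
    and "curve_length \<A> G p q L"
  shows "norm (\<Phi> q - \<Phi> p) \<le> C * L"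
  using assms(4)
proof (induction rule: curve_length.induct)
  case (piece p q L \<kappa> r \<gamma> \<gamma>')
  note ch = manifold_is_chart[OF M piece(2)]
  let ?s = "\<lambda>t. sqrt (G \<kappa> (chart_inv \<kappa> (\<gamma> t)) (\<gamma>' t) (\<gamma>' t))"
  have s: "continuous_on {0..1} ?s" by (rule speed_continuous[OF M piece(2,5,8,9)])
  obtain D where D: "\<And>x. x \<in> chart_range \<kappa> \<Longrightarrow> ((\<lambda>x. \<Phi> (chart_inv \<kappa> x)) has_derivative D x) (at x)"
    "\<And>x v. x \<in> chart_range \<kappa> \<Longrightarrow> norm (D x v) \<le> C * sqrt (G \<kappa> (chart_inv \<kappa> x) v v)"
    using der[OF piece(2)] by metis
  let ?f = "\<lambda>t. \<Phi> (chart_inv \<kappa> (\<gamma> t))" and ?\<phi> = "\<lambda>t. C * integral {0..t} ?s"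
  have f': "(?f has_vector_derivative D (\<gamma> t) (\<gamma>' t)) (at t within {0..1})" if t: "t \<in> {0..1}" for t
  proof -
    have "(\<gamma> has_vector_derivative \<gamma>' t) (at t within {0..1})" and r: "\<gamma> t \<in> chart_range \<kappa>"
      using piece t by auto
    then have "((\<lambda>x. \<Phi> (chart_inv \<kappa> x)) \<circ> \<gamma> has_derivative D (\<gamma> t) \<circ> (\<lambda>h. h *\<^sub>R \<gamma>' t)) (at t within {0..1})"
      by (intro diff_chain_within[OF _ has_derivative_at_withinI[OF D(1)]])
         (simp_all add: has_vector_derivative_def)
    moreover have "D (\<gamma> t) \<circ> (\<lambda>h. h *\<^sub>R \<gamma>' t) = (\<lambda>h. h *\<^sub>R D (\<gamma> t) (\<gamma>' t))"
      using has_derivative_linear[OF D(1)[OF r]] by (auto simp: linear_cmul)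
    ultimately show ?thesis by (simp add: has_vector_derivative_def o_def)
  qed
  have \<phi>': "(?\<phi> has_vector_derivative C * ?s t) (at t within {0..1})" if "t \<in> {0..1}" for t
    using integral_has_vector_derivative[OF s that]
    by (auto intro!: derivative_eq_intros simp: has_real_derivative_iff_has_vector_derivative[symmetric])
  have "norm (?f 1 - ?f 0) \<le> ?\<phi> 1 - ?\<phi> 0"
  proof (rule differentiable_bound_general)
    show "continuous_on {0..1} ?f" "continuous_on {0..1} ?\<phi>"
      using f' \<phi>' by (meson continuous_on_eq_continuous_within has_vector_derivative_continuous)+
    fix t :: real assume t: "0 < t" "t < 1"
    then show "(?f has_vector_derivative D (\<gamma> t) (\<gamma>' t)) (at t)"
      "(?\<phi> has_vector_derivative C * ?s t) (at t)"
      using f'[of t] \<phi>'[of t] at_within_Icc_at[of 0 t 1] by auto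
    show "norm (D (\<gamma> t) (\<gamma>' t)) \<le> C * ?s t"
      using D(2) piece(5) t by (simp add: image_subset_iff)
  qed simp
  then have "norm (\<Phi> r - \<Phi> q) \<le> C * integral {0..1} ?s"
    using piece ch by simp
  then have "norm (\<Phi> r - \<Phi> p) \<le> C * integral {0..1} ?s + C * L"
    using piece.IH norm_triangle_ineq[of "\<Phi> r - \<Phi> q" "\<Phi> q - \<Phi> p"] by simp
  then show ?case by (simp add: algebra_simps)
qed simp

section \<open>Charts are locally bi-Lipschitz\<close>

lemma has_derivative_pos_part_square:
  "((\<lambda>s::real. (max 0 s)\<^sup>2) has_real_derivative 2 * max 0 s) (at s)"
proof -
  consider "s > 0" | "s < 0" | "s = 0" by linarith
  then show ?thesis
  proof cases
    case 1
    have "((\<lambda>s::real. s\<^sup>2) has_real_derivative 2 * s) (at s)" by (auto intro!: derivative_eq_intros)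
    then have "((\<lambda>s::real. (max 0 s)\<^sup>2) has_real_derivative 2 * s) (at s)"
      by (rule DERIV_cong_ev[THEN iffD1, rotated 3])
         (use 1 in \<open>auto simp: max_def intro!: eventually_nhds_in_open[of "{0<..}", THEN eventually_mono]\<close>)
    then show ?thesis using 1 by (simp add: max_def)
  next
    case 2
    have "((\<lambda>s::real. 0) has_real_derivative 0) (at s)" by simp
    then have "((\<lambda>s::real. (max 0 s)\<^sup>2) has_real_derivative 0) (at s)"
      by (rule DERIV_cong_ev[THEN iffD1, rotated 3])
         (use 2 in \<open>auto simp: max_def intro!: eventually_nhds_in_open[of "{..<0}", THEN eventually_mono]\<close>)
    then show ?thesis using 2 by (simp add: max_def)
  next
    case 3
    have "((\<lambda>h::real. (max 0 h)\<^sup>2 / h) \<longlongrightarrow> 0) (at 0)"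
    proof (rule Lim_null_comparison)
      show "((\<lambda>h::real. \<bar>h\<bar>) \<longlongrightarrow> 0) (at 0)" by (rule tendsto_rabs_zero[OF tendsto_ident_at])
      show "\<forall>\<^sub>F h::real in at 0. norm ((max 0 h)\<^sup>2 / h) \<le> \<bar>h\<bar>"
        by (intro always_eventually) (auto simp: max_def power2_eq_square)
    qed
    then show ?thesis using 3 by (simp add: DERIV_def)
  qed
qed

text \<open>
  A continuously differentiable map that vanishes outside the ball of radius \<open>r\<close> and is close to the
  identity near 0. Composed with a chart and extended by zero, it becomes a function on the whole
  manifold that can be used in \<open>lipschitz_along_curves\<close>.
\<close>

definition radial_cutoff :: "real \<Rightarrow> 'b::real_inner \<Rightarrow> 'b" where
  "radial_cutoff r y = (max 0 (1 - (y \<bullet> y) / r\<^sup>2))\<^sup>2 *\<^sub>R y"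

definition radial_cutoff_deriv :: "real \<Rightarrow> 'b::real_inner \<Rightarrow> 'b \<Rightarrow> 'b" where
  "radial_cutoff_deriv r y v = (max 0 (1 - (y \<bullet> y) / r\<^sup>2))\<^sup>2 *\<^sub>R v
     - (4 * max 0 (1 - (y \<bullet> y) / r\<^sup>2) * (y \<bullet> v) / r\<^sup>2) *\<^sub>R y"

lemma has_derivative_radial_cutoff:
  assumes "r > 0"
  shows "(radial_cutoff r has_derivative radial_cutoff_deriv r y) (at y)"
proof -
  have "((\<lambda>y. (max 0 (1 - (y \<bullet> y) / r\<^sup>2))\<^sup>2) has_derivative
      (\<lambda>v. (2 * max 0 (1 - (y \<bullet> y) / r\<^sup>2)) * (- (2 * (y \<bullet> v)) / r\<^sup>2))) (at y)"
    by (rule has_derivative_compose[OF _ has_derivative_pos_part_square[THEN has_field_derivative_imp_has_derivative]])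
       (use assms in \<open>auto intro!: derivative_eq_intros simp: inner_commute field_simps power2_eq_square power4_eq_xxxx\<close>)
  from has_derivative_scaleR[OF this has_derivative_ident] show ?thesis
    unfolding radial_cutoff_def[abs_def] radial_cutoff_deriv_def[abs_def]
    by (simp add: algebra_simps)
qed

lemma radial_cutoff_deriv_outside:
  assumes "r > 0" "norm y \<ge> r"
  shows "radial_cutoff r y = 0" "radial_cutoff_deriv r y v = 0"
proof -
  have "y \<bullet> y \<ge> r\<^sup>2" using assms power_mono[of r "norm y" 2] by (simp add: power2_norm_eq_inner)
  then have "max 0 (1 - (y \<bullet> y) / r\<^sup>2) = 0" using assms by (simp add: field_simps)
  then show "radial_cutoff r y = 0" "radial_cutoff_deriv r y v = 0"
    by (simp_all add: radial_cutoff_def radial_cutoff_deriv_def)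
qed

lemma radial_cutoff_deriv_bound:
  assumes "r > 0"
  shows "norm (radial_cutoff_deriv r y v) \<le> 5 * norm v"
proof (cases "norm y \<ge> r")
  case False
  define q where "q = max 0 (1 - (y \<bullet> y) / r\<^sup>2)"
  have q: "0 \<le> q" "q \<le> 1" using assms by (auto simp: q_def)
  have "norm y * norm y \<le> r * r" using False assms by (intro mult_mono) auto
  then have y: "(norm y)\<^sup>2 / r\<^sup>2 \<le> 1" using assms by (simp add: power2_eq_square)
  have "norm (radial_cutoff_deriv r y v) \<le> norm (q\<^sup>2 *\<^sub>R v) + norm ((4 * q * (y \<bullet> v) / r\<^sup>2) *\<^sub>R y)"
    unfolding radial_cutoff_deriv_def q_def by (rule norm_triangle_ineq4)
  also have "norm (q\<^sup>2 *\<^sub>R v) \<le> norm v" using q by (simp add: power_le_one mult_left_le_one_le)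
  also have "norm ((4 * q * (y \<bullet> v) / r\<^sup>2) *\<^sub>R y) = q * (4 * (\<bar>y \<bullet> v\<bar> * norm y / r\<^sup>2))"
    using q by (simp add: abs_mult)
  also have "\<dots> \<le> 1 * (4 * (norm y * norm v * norm y / r\<^sup>2))"
    using q assms by (intro mult_mono divide_right_mono Cauchy_Schwarz_ineq2) auto
  also have "\<dots> = 4 * ((norm y)\<^sup>2 / r\<^sup>2 * norm v)" by (simp add: power2_eq_square)
  also have "\<dots> \<le> 4 * (1 * norm v)" using y by (intro mult_left_mono mult_right_mono) auto
  finally show ?thesis by simp
qed (use assms in \<open>simp add: radial_cutoff_deriv_outside\<close>)

text \<open>
  On the ball of radius \<open>r / 4\<close> the derivative differs from the identity by at most 3/8 in norm.
\<close>

lemma radial_cutoff_expanding_near_0: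
  assumes r: "r > 0" and yz: "norm y \<le> r / 4" "norm z \<le> r / 4"
  shows "norm (y - z) \<le> 2 * norm (radial_cutoff r y - radial_cutoff r z)"
proof -
  have "norm ((radial_cutoff r y - y) - (radial_cutoff r z - z)) \<le> 1/2 * norm (y - z)"
  proof (rule differentiable_bound[of "cball 0 (r/4)"])
    fix x :: 'a assume x: "x \<in> cball 0 (r/4)"
    show "((\<lambda>x. radial_cutoff r x - x) has_derivative (\<lambda>v. radial_cutoff_deriv r x v - v)) (at x within cball 0 (r/4))"
      by (intro has_derivative_diff has_derivative_ident has_derivative_at_withinI[OF has_derivative_radial_cutoff[OF r]])
    define a where "a = (x \<bullet> x) / r\<^sup>2"
    have "norm x * norm x \<le> (r/4) * (r/4)" using x r by (intro mult_mono) auto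
    then have xx: "(norm x)\<^sup>2 / r\<^sup>2 \<le> 1/16" using r by (simp add: power2_eq_square field_simps)
    then have a: "0 \<le> a" "a \<le> 1/16" by (simp_all add: a_def power2_norm_eq_inner)
    have "norm (radial_cutoff_deriv r x v - v) \<le> 1/2 * norm v" for v
    proof -
      have "radial_cutoff_deriv r x v - v = (a\<^sup>2 - 2 * a) *\<^sub>R v - (4 * (1 - a) * (x \<bullet> v) / r\<^sup>2) *\<^sub>R x"
      proof -
        have "max 0 (1 - a) = 1 - a" using a by simp
        then show ?thesis
          unfolding radial_cutoff_deriv_def a_def[symmetric]
          by (simp add: algebra_simps power2_eq_square)
      qed
      then have "norm (radial_cutoff_deriv r x v - v) \<le>
          norm ((a\<^sup>2 - 2 * a) *\<^sub>R v) + norm ((4 * (1 - a) * (x \<bullet> v) / r\<^sup>2) *\<^sub>R x)"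
        by (simp only: norm_triangle_ineq4)
      also have "norm ((a\<^sup>2 - 2 * a) *\<^sub>R v) \<le> 1/8 * norm v"
      proof -
        have "a\<^sup>2 - 2 * a = - (a * (2 - a))" by (simp add: power2_eq_square algebra_simps)
        then have "\<bar>a\<^sup>2 - 2 * a\<bar> = a * (2 - a)" using a by simp
        also have "\<dots> \<le> 1/16 * 2" using a by (intro mult_mono) auto
        finally have "\<bar>a\<^sup>2 - 2 * a\<bar> \<le> 1/8" by simp
        from mult_right_mono[OF this norm_ge_zero[of v]] show ?thesis by simp
      qed
      also have "norm ((4 * (1 - a) * (x \<bullet> v) / r\<^sup>2) *\<^sub>R x) = (1 - a) * (4 * (\<bar>x \<bullet> v\<bar> * norm x / r\<^sup>2))"
        using a by (simp add: abs_mult)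
      also have "\<dots> \<le> 1 * (4 * (norm x * norm v * norm x / r\<^sup>2))"
        using a r by (intro mult_mono divide_right_mono Cauchy_Schwarz_ineq2) auto
      also have "\<dots> = 4 * ((norm x)\<^sup>2 / r\<^sup>2 * norm v)" by (simp add: power2_eq_square)
      also have "\<dots> \<le> 4 * (1/16 * norm v)" using xx by (intro mult_left_mono mult_right_mono) auto
      finally show ?thesis using norm_ge_zero[of v] by linarith
    qed
    then show "onorm (\<lambda>v. radial_cutoff_deriv r x v - v) \<le> 1/2" by (intro onorm_bound) auto
  qed (use yz in auto)
  then have "norm (y - z) - norm (radial_cutoff r y - radial_cutoff r z) \<le> 1/2 * norm (y - z)"
    using norm_triangle_ineq2[of "y - z" "radial_cutoff r y - radial_cutoff r z"]
    by (simp add: algebra_simps norm_minus_commute)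
  then show ?thesis by simp
qed

text \<open>
  The distance is at most the length of the coordinate segment, which the upper bound of the metric
  tensor controls. Conversely, the cut-off chart changes along any curve, however far it strays, by at
  most a constant times the length, because the lower bound of the metric tensor holds wherever the
  cutoff has a nonzero derivative. The factor \<open>5 / sqrt m\<close> is the bound 5 for the derivative of the
  cutoff over the square root of the lower bound.
\<close>

lemma chart_locally_bilipschitz:
  fixes \<A> :: "('m::metric_space, 'b::real_inner) chart set"
  assumes M: "compact_riemannian_manifold \<A> G" and \<kappa>: "\<kappa> \<in> \<A>" and p0: "p0 \<in> chart_dom \<kappa>"
  obtains r L :: real where "r > 0" "L > 0" "ball p0 r \<subseteq> chart_dom \<kappa>"
    "\<And>p q. p \<in> ball p0 r \<Longrightarrow> q \<in> ball p0 r \<Longrightarrow>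
       dist p q \<le> L * norm (chart_map \<kappa> p - chart_map \<kappa> q)"
    "\<And>p q. p \<in> ball p0 r \<Longrightarrow> q \<in> ball p0 r \<Longrightarrow>
       norm (chart_map \<kappa> p - chart_map \<kappa> q) \<le> L * dist p q"
proof -
  note ch = manifold_is_chart[OF M \<kappa>]
  have fd: "\<exists>B::'b set. finite B \<and> span B = UNIV" and at: "smooth_atlas \<A>"
    and rm: "riemannian_metric \<A> G"
    using M by (simp_all add: compact_riemannian_manifold_def)
  define x0 where "x0 = chart_map \<kappa> p0"
  have x0: "x0 \<in> chart_range \<kappa>" using p0 by (simp add: x0_def)
  obtain r m K :: real where rmK: "r > 0" "m > 0" "K > 0" and cb: "cball x0 r \<subseteq> chart_range \<kappa>"
    and lo: "\<And>x v. x \<in> cball x0 r \<Longrightarrow> m * (norm v)\<^sup>2 \<le> G \<kappa> (chart_inv \<kappa> x) v v"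
    and up: "\<And>x v. x \<in> cball x0 r \<Longrightarrow> G \<kappa> (chart_inv \<kappa> x) v v \<le> K * (norm v)\<^sup>2"
    using metric_tensor_bounds[OF M \<kappa> x0] by blast
  let ?c = "radial_cutoff r :: 'b \<Rightarrow> 'b" and ?c' = "radial_cutoff_deriv r :: 'b \<Rightarrow> 'b \<Rightarrow> 'b"
  define \<Phi> where "\<Phi> p = (if p \<in> chart_dom \<kappa> then ?c (chart_map \<kappa> p - x0) else 0)" for p
  define C where "C = 5 / sqrt m"
  have C: "C \<ge> 0" using rmK by (simp add: C_def)
  have der: "\<exists>D. ((\<lambda>x. \<Phi> (chart_inv \<kappa>' x)) has_derivative D) (at x) \<and>
          (\<forall>v. norm (D v) \<le> C * sqrt (G \<kappa>' (chart_inv \<kappa>' x) v v))"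
    if \<kappa>': "\<kappa>' \<in> \<A>" and x: "x \<in> chart_range \<kappa>'" for \<kappa>' x
  proof (cases "chart_inv \<kappa>' x \<in> chart_dom \<kappa>")
    case True
    note ch' = manifold_is_chart[OF M \<kappa>']
    define U where "U = chart_map \<kappa>' ` (chart_dom \<kappa>' \<inter> chart_dom \<kappa>)"
    have xU: "x \<in> U" unfolding U_def using True x ch'
      by (intro image_eqI[of _ _ "chart_inv \<kappa>' x"]) auto
    have oU: "open U" unfolding U_def by (rule open_chart_overlap[OF ch' ch])
    define T where "T = frechet_derivative (transition \<kappa>' \<kappa>) (at x)"
    have "smooth_on U (transition \<kappa>' \<kappa>)"
      using at \<kappa> \<kappa>' unfolding smooth_atlas_def U_def by blast
    then have T: "(transition \<kappa>' \<kappa> has_derivative T) (at x)"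
      unfolding T_def by (rule smooth_on_has_derivative) (rule xU)
    let ?y = "transition \<kappa>' \<kappa> x - x0"
    have "((\<lambda>x. transition \<kappa>' \<kappa> x - x0) has_derivative T) (at x)"
      using T by (auto intro!: derivative_eq_intros)
    then have d1: "((\<lambda>x. ?c (transition \<kappa>' \<kappa> x - x0)) has_derivative (\<lambda>v. ?c' ?y (T v))) (at x)"
      by (rule has_derivative_compose) (rule has_derivative_radial_cutoff[OF rmK(1)])
    have d2: "?c (transition \<kappa>' \<kappa> z - x0) = \<Phi> (chart_inv \<kappa>' z)" if "z \<in> U" for z
      using that ch' unfolding U_def \<Phi>_def transition_def by auto
    have "((\<lambda>x. \<Phi> (chart_inv \<kappa>' x)) has_derivative (\<lambda>v. ?c' ?y (T v))) (at x)"
      by (rule has_derivative_transform_within_open[OF d1 oU xU d2])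
    moreover have "norm (?c' ?y (T v)) \<le> C * sqrt (G \<kappa>' (chart_inv \<kappa>' x) v v)" for v
    proof (cases "norm ?y \<ge> r")
      case True
      then show ?thesis
        using radial_cutoff_deriv_outside[OF rmK(1) True] C metric_tensor_nonneg[OF M \<kappa>'] ch' x
        by simp
    next
      case False
      let ?p = "chart_inv \<kappa>' x"
      have yc: "transition \<kappa>' \<kappa> x \<in> cball x0 r" using False by (simp add: dist_norm norm_minus_commute)
      have pe: "chart_inv \<kappa> (transition \<kappa>' \<kappa> x) = ?p"
        using True ch by (simp add: transition_def)
      have "\<forall>p\<in>chart_dom \<kappa>' \<inter> chart_dom \<kappa>. \<forall>v w. G \<kappa>' p v w =
         G \<kappa> p (frechet_derivative (transition \<kappa>' \<kappa>) (at (chart_map \<kappa>' p)) v)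
               (frechet_derivative (transition \<kappa>' \<kappa>) (at (chart_map \<kappa>' p)) w)"
        using rm \<kappa> \<kappa>' unfolding riemannian_metric_def by blast
      then have "G \<kappa>' ?p v v = G \<kappa> ?p (T v) (T v)"
        using True x ch' by (simp add: T_def)
      then have "sqrt (m * (norm (T v))\<^sup>2) \<le> sqrt (G \<kappa>' ?p v v)"
        using lo[OF yc, of "T v"] pe by simp
      then have "sqrt m * norm (T v) \<le> sqrt (G \<kappa>' ?p v v)"
        using rmK(2) by (simp add: real_sqrt_mult)
      then have "5 * norm (T v) \<le> C * sqrt (G \<kappa>' ?p v v)"
        using rmK(2) by (simp add: C_def field_simps)
      then show ?thesis using radial_cutoff_deriv_bound[OF rmK(1), of ?y "T v"] by linarith
    qed
    ultimately show ?thesis by blast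
  next
    case False
    note ch' = manifold_is_chart[OF M \<kappa>']
    \<comment> \<open>\<open>\<Phi>\<close> vanishes outside the compact set \<open>Q\<close>, hence near every point outside the domain of \<open>\<kappa>\<close>\<close>
    define Q where "Q = chart_inv \<kappa> ` cball x0 r"
    have "compact Q" unfolding Q_def
      using continuous_on_subset[OF continuous_on_chart_inv[OF ch] cb]
      by (intro compact_continuous_image finite_dimensional_compact_cball[OF fd])
    define U where "U = chart_range \<kappa>' \<inter> chart_inv \<kappa>' -` (- Q)"
    have oU: "open U" unfolding U_def
      using compact_imp_closed[OF \<open>compact Q\<close>]
      by (intro continuous_open_preimage[OF continuous_on_chart_inv[OF ch'] open_chart_range[OF ch']]) auto
    have Qd: "Q \<subseteq> chart_dom \<kappa>" using cb ch by (auto simp: Q_def)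
    have xU: "x \<in> U" using False x Qd by (auto simp: U_def)
    have "0 = \<Phi> (chart_inv \<kappa>' z)" if "z \<in> U" for z
    proof (cases "chart_inv \<kappa>' z \<in> chart_dom \<kappa>")
      case True
      have "chart_map \<kappa> (chart_inv \<kappa>' z) \<notin> cball x0 r"
        using that True ch image_eqI[of "chart_inv \<kappa>' z" "chart_inv \<kappa>" "chart_map \<kappa> (chart_inv \<kappa>' z)" "cball x0 r"]
        by (auto simp: U_def Q_def)
      then have "norm (chart_map \<kappa> (chart_inv \<kappa>' z) - x0) \<ge> r" by (simp add: dist_norm norm_minus_commute)
      from radial_cutoff_deriv_outside(1)[OF rmK(1) this] show ?thesis by (simp add: \<Phi>_def)
    qed (simp add: \<Phi>_def)
    then have "((\<lambda>x. \<Phi> (chart_inv \<kappa>' x)) has_derivative (\<lambda>v. 0)) (at x)"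
      by (intro has_derivative_transform_within_open[OF has_derivative_const oU xU])
    moreover have "0 \<le> C * sqrt (G \<kappa>' (chart_inv \<kappa>' x) v v)" for v
      using C metric_tensor_nonneg[OF M \<kappa>'] ch' x by simp
    ultimately show ?thesis by force
  qed
  \<comment> \<open>on \<open>V\<close> the cutoff is expanding and coordinate segments stay in the chart\<close>
  define V where "V = chart_dom \<kappa> \<inter> chart_map \<kappa> -` ball x0 (r/4)"
  have "open V" unfolding V_def
    by (intro continuous_open_preimage[OF continuous_on_chart_map[OF ch] open_chart_dom[OF ch]]) auto
  moreover have "p0 \<in> V" using p0 rmK(1) by (simp add: V_def x0_def)
  ultimately obtain s where s: "s > 0" "ball p0 s \<subseteq> V" using open_contains_ball by blast
  have seg: "\<exists>L \<le> sqrt K * norm (chart_map \<kappa> p - chart_map \<kappa> q). curve_length \<A> G p q L"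
    if "p \<in> V" "q \<in> V" for p q
    using that cb rmK up
      curve_length_segment[OF M \<kappa>, of p q "ball x0 (r/4)" K]
    by (force simp: V_def norm_minus_commute)
  have up': "dist p q \<le> sqrt K * norm (chart_map \<kappa> p - chart_map \<kappa> q)" if "p \<in> V" "q \<in> V" for p q
    using seg[OF that] dist_le_curve_length[OF M] order_trans by blast
  have lo': "norm (chart_map \<kappa> p - chart_map \<kappa> q) \<le> 2 * (C + 1) * dist p q" if pq: "p \<in> V" "q \<in> V" for p q
  proof -
    have d: "dist p q = Inf {L. curve_length \<A> G p q L}"
      using seg[OF pq] M unfolding compact_riemannian_manifold_def by blast
    have "norm (\<Phi> p - \<Phi> q) / (C + 1) \<le> dist p q"
      unfolding d
    proof (rule cInf_greatest)
      show "{L. curve_length \<A> G p q L} \<noteq> {}" using seg[OF pq] by blast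
      fix L assume "L \<in> {L. curve_length \<A> G p q L}"
      then have L: "curve_length \<A> G p q L" by simp
      have "norm (\<Phi> p - \<Phi> q) \<le> C * L"
        using lipschitz_along_curves[OF M C der L] by (simp add: norm_minus_commute)
      also have "\<dots> \<le> (C + 1) * L" using curve_length_nonneg[OF M L] by (simp add: algebra_simps)
      finally show "norm (\<Phi> p - \<Phi> q) / (C + 1) \<le> L" using C by (simp add: field_simps)
    qed
    then have "norm (\<Phi> p - \<Phi> q) \<le> (C + 1) * dist p q" using C by (simp add: field_simps)
    moreover have "norm (chart_map \<kappa> p - chart_map \<kappa> q) \<le> 2 * norm (\<Phi> p - \<Phi> q)"
      using radial_cutoff_expanding_near_0[OF rmK(1), of "chart_map \<kappa> p - x0" "chart_map \<kappa> q - x0"] pq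
      by (simp add: V_def \<Phi>_def dist_norm norm_minus_commute)
    ultimately show ?thesis by (simp add: algebra_simps)
  qed
  show ?thesis
  proof (rule that[OF s(1), of "sqrt K + 2 * (C + 1)"])
    show "0 < sqrt K + 2 * (C + 1)" using rmK C by (simp add: add_pos_nonneg)
    show "ball p0 s \<subseteq> chart_dom \<kappa>" using s(2) by (auto simp: V_def)
    fix p q assume "p \<in> ball p0 s" "q \<in> ball p0 s"
    then have pq: "p \<in> V" "q \<in> V" using s(2) by auto
    have "0 \<le> 2 * (C + 1) * norm (chart_map \<kappa> p - chart_map \<kappa> q)" using C by simp
    then show "dist p q \<le> (sqrt K + 2 * (C + 1)) * norm (chart_map \<kappa> p - chart_map \<kappa> q)"
      using up'[OF pq] by (simp add: algebra_simps)
    have "0 \<le> sqrt K * dist p q" using rmK by simp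
    then show "norm (chart_map \<kappa> p - chart_map \<kappa> q) \<le> (sqrt K + 2 * (C + 1)) * dist p q"
      using lo'[OF pq] by (simp add: algebra_simps)
  qed
qed

section \<open>Strict derivatives\<close>

text \<open>
  Strict differentiability at a point expresses the local consequence of continuous
  differentiability that is used below: increments between any two points near \<open>p\<close> are controlled by
  one linear map. Unlike continuous differentiability it refers to the point \<open>p\<close> only, which makes the
  composition with linear maps immediate.
\<close>

definition strict_derivative ::
  "('a::real_normed_vector \<Rightarrow> 'c::real_normed_vector) \<Rightarrow> ('a \<Rightarrow> 'c) \<Rightarrow> 'a \<Rightarrow> bool" where
  "strict_derivative F T p \<longleftrightarrow> bounded_linear T \<and>
     (\<forall>\<epsilon>>0. \<exists>r>0. \<forall>x\<in>ball p r. \<forall>y\<in>ball p r. norm (F y - F x - T (y - x)) \<le> \<epsilon> * norm (y - x))"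

lemma strict_derivative_has_derivative:
  assumes "strict_derivative F T p"
  shows "(F has_derivative T) (at p)"
  unfolding has_derivative_at_alt
proof (intro conjI allI impI)
  show "bounded_linear T" using assms by (simp add: strict_derivative_def)
  fix e :: real assume "e > 0"
  then obtain r where r: "r > 0"
    "\<And>x y. x \<in> ball p r \<Longrightarrow> y \<in> ball p r \<Longrightarrow> norm (F y - F x - T (y - x)) \<le> e * norm (y - x)"
    using assms unfolding strict_derivative_def by meson
  show "\<exists>d>0. \<forall>y. norm (y - p) < d \<longrightarrow> norm (F y - F p - T (y - p)) \<le> e * norm (y - p)"
  proof (intro exI[of _ r] conjI allI impI r(1))
    fix y assume "norm (y - p) < r"
    then show "norm (F y - F p - T (y - p)) \<le> e * norm (y - p)"
      using r(1) by (intro r(2)) (simp_all add: dist_norm norm_minus_commute)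
  qed
qed

lemma C2_bounded_strict_derivative:
  assumes "C2_bounded D \<B> f" "open D" "p \<in> D"
  shows "\<exists>T. strict_derivative f T p"
proof -
  from assms(1) obtain f' f'' where
    f': "\<And>x. x \<in> D \<Longrightarrow> (f has_derivative blinfun_apply (f' x)) (at x)" and
    f'': "\<And>x. x \<in> D \<Longrightarrow> (f' has_derivative blinfun_apply (f'' x)) (at x)"
    unfolding C2_bounded_def by blast
  have "\<exists>r>0. \<forall>x\<in>ball p r. \<forall>y\<in>ball p r. norm (f y - f x - f' p (y - x)) \<le> \<epsilon> * norm (y - x)"
    if \<epsilon>: "\<epsilon> > 0" for \<epsilon>
  proof -
    have "isCont f' p" using has_derivative_continuous[OF f''[OF assms(3)]] .
    then obtain r1 where r1: "r1 > 0" "\<And>x. dist x p < r1 \<Longrightarrow> dist (f' x) (f' p) < \<epsilon>"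
      using \<epsilon> unfolding continuous_at_eps_delta by metis
    obtain r2 where r2: "r2 > 0" "ball p r2 \<subseteq> D" using assms(2,3) open_contains_ball by blast
    define r where "r = min r1 r2"
    have rD: "ball p r \<subseteq> D" using r2 by (auto simp: r_def)
    have "norm (f y - f x - f' p (y - x)) \<le> norm (y - x) * \<epsilon>" if "x \<in> ball p r" "y \<in> ball p r" for x y
    proof (rule differentiable_bound_linearization[of x y "ball p r" f "\<lambda>x. blinfun_apply (f' x)" p \<epsilon>])
      show "x + t *\<^sub>R (y - x) \<in> ball p r" if "t \<in> {0..1}" for t
        using convexD_alt[OF convex_ball \<open>x \<in> ball p r\<close> \<open>y \<in> ball p r\<close>, of t] that
        by (simp add: algebra_simps)
      show "(f has_derivative blinfun_apply (f' z)) (at z within ball p r)" if "z \<in> ball p r" for z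
        using f' rD that has_derivative_at_withinI by blast
      show "onorm (blinfun_apply (f' z) - blinfun_apply (f' p)) \<le> \<epsilon>" if "z \<in> ball p r" for z
      proof -
        have "norm (f' z - f' p) \<le> \<epsilon>"
          using r1(2)[of z] that by (simp add: r_def dist_norm dist_commute norm_minus_commute)
        then show ?thesis by (simp add: norm_blinfun.rep_eq minus_blinfun.rep_eq fun_diff_def)
      qed
      show "p \<in> ball p r" using r1 r2 by (simp add: r_def)
    qed
    then show ?thesis using r1 r2 by (intro exI[of _ r]) (auto simp: r_def mult.commute)
  qed
  then show ?thesis unfolding strict_derivative_def using blinfun.bounded_linear_right by blast
qed

lemma strict_derivative_linear_compose:
  assumes "strict_derivative F T p" and B: "bounded_linear B"
  shows "strict_derivative (\<lambda>x. B (F x)) (\<lambda>v. B (T v)) p"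
  unfolding strict_derivative_def
proof (intro conjI allI impI)
  interpret B: bounded_linear B by fact
  show "bounded_linear (\<lambda>v. B (T v))"
    using bounded_linear_compose[OF B] assms(1) unfolding strict_derivative_def by blast
  obtain K where K: "K > 0" "\<And>x. norm (B x) \<le> norm x * K" using B.pos_bounded by blast
  fix e :: real assume "e > 0"
  then have "e / K > 0" using K by simp
  then obtain r where r: "r > 0"
    "\<And>x y. x \<in> ball p r \<Longrightarrow> y \<in> ball p r \<Longrightarrow> norm (F y - F x - T (y - x)) \<le> e / K * norm (y - x)"
    using assms unfolding strict_derivative_def by meson
  have "norm (B (F y) - B (F x) - B (T (y - x))) \<le> e * norm (y - x)"
    if "x \<in> ball p r" "y \<in> ball p r" for x y
  proof -
    have "norm (B (F y) - B (F x) - B (T (y - x))) = norm (B (F y - F x - T (y - x)))"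
      by (simp add: B.diff)
    also have "\<dots> \<le> norm (F y - F x - T (y - x)) * K" by (rule K)
    also have "\<dots> \<le> e / K * norm (y - x) * K" using r(2)[OF that] K by (intro mult_right_mono) auto
    finally show ?thesis using K by simp
  qed
  then show "\<exists>r>0. \<forall>x\<in>ball p r. \<forall>y\<in>ball p r.
      norm (B (F y) - B (F x) - B (T (y - x))) \<le> e * norm (y - x)"
    using r(1) by blast
qed

lemma strict_derivative_Pair:
  assumes "strict_derivative F T p" "strict_derivative F' T' p"
  shows "strict_derivative (\<lambda>x. (F x, F' x)) (\<lambda>v. (T v, T' v)) p"
  unfolding strict_derivative_def
proof (intro conjI allI impI)
  show "bounded_linear (\<lambda>v. (T v, T' v))"
    using assms unfolding strict_derivative_def by (intro bounded_linear_Pair) auto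
  fix e :: real assume "e > 0"
  then have e: "e / 2 > 0" by simp
  from assms(1) e obtain r where r: "r > 0"
    "\<And>x y. x \<in> ball p r \<Longrightarrow> y \<in> ball p r \<Longrightarrow> norm (F y - F x - T (y - x)) \<le> e / 2 * norm (y - x)"
    unfolding strict_derivative_def by meson
  from assms(2) e obtain r' where r': "r' > 0"
    "\<And>x y. x \<in> ball p r' \<Longrightarrow> y \<in> ball p r' \<Longrightarrow> norm (F' y - F' x - T' (y - x)) \<le> e / 2 * norm (y - x)"
    unfolding strict_derivative_def by meson
  have "norm ((F y, F' y) - (F x, F' x) - (T (y - x), T' (y - x))) \<le> e * norm (y - x)"
    if "x \<in> ball p (min r r')" "y \<in> ball p (min r r')" for x y
  proof -
    have "norm ((F y, F' y) - (F x, F' x) - (T (y - x), T' (y - x)))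
      \<le> norm (F y - F x - T (y - x)) + norm (F' y - F' x - T' (y - x))"
      using norm_Pair_le by simp
    also have "\<dots> \<le> e / 2 * norm (y - x) + e / 2 * norm (y - x)"
      using that by (intro add_mono r r') auto
    finally show ?thesis by simp
  qed
  then show "\<exists>r>0. \<forall>x\<in>ball p r. \<forall>y\<in>ball p r.
      norm ((F y, F' y) - (F x, F' x) - (T (y - x), T' (y - x))) \<le> e * norm (y - x)"
    using r(1) r'(1) by (intro exI[of _ "min r r'"]) auto
qed

section \<open>Tangent spaces of the special linear group\<close>

text \<open>
  In the Leibniz formula a permutation other than the identity moves at least two points, so that its
  product vanishes to second order at the identity matrix.
\<close>

lemma has_derivative_det_at_1:
  "(det has_derivative trace) (at (mat 1 :: real^'n^'n))"
proof -
  have "((\<lambda>X::real^'n^'n. det X) has_derivative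
     (\<lambda>X. \<Sum>p | p permutes (UNIV::'n set). of_int (sign p) *
        (\<Sum>i\<in>UNIV. X $ i $ p i * (\<Prod>j\<in>UNIV - {i}. mat 1 $ j $ p j)))) (at (mat 1))"
    unfolding det_def
    by (intro has_derivative_sum has_derivative_mult_right has_derivative_prod
          bounded_linear.has_derivative[OF bounded_linear_vec_nth] has_derivative_ident)
  moreover have "(\<Sum>p | p permutes (UNIV::'n set). of_int (sign p) *
        (\<Sum>i\<in>UNIV. X $ i $ p i * (\<Prod>j\<in>UNIV - {i}. (mat 1 :: real^'n^'n) $ j $ p j))) = trace X" for X :: "real^'n^'n"
  proof -
    have zero: "(\<Prod>j\<in>UNIV - {i}. (mat 1 :: real^'n^'n) $ j $ p j) = 0" if p: "p permutes UNIV" "p \<noteq> id" for p i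
    proof -
      have "\<exists>j. j \<noteq> i \<and> p j \<noteq> j"
      proof (rule ccontr)
        assume "\<not> ?thesis"
        then have *: "\<And>j. j \<noteq> i \<Longrightarrow> p j = j" by blast
        moreover have "p i = i"
          using * permutes_inj[OF p(1)] by (metis injD)
        ultimately show False using p(2) by (metis eq_id_iff)
      qed
      then show ?thesis by (force simp: mat_def intro!: prod_zero)
    qed
    have "(\<Sum>p | p permutes (UNIV::'n set). of_int (sign p) *
        (\<Sum>i\<in>UNIV. X $ i $ p i * (\<Prod>j\<in>UNIV - {i}. (mat 1 :: real^'n^'n) $ j $ p j)))
      = (\<Sum>p\<in>{id}. of_int (sign p) *
        (\<Sum>i\<in>UNIV. X $ i $ p i * (\<Prod>j\<in>UNIV - {i}. (mat 1 :: real^'n^'n) $ j $ p j)))"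
      by (rule sum.mono_neutral_right) (auto simp: permutes_id zero finite_permutations)
    also have "\<dots> = trace X" by (simp add: trace_def mat_def)
    finally show ?thesis .
  qed
  ultimately show ?thesis by simp
qed

text \<open>
  After multiplication by the inverse of \<open>f p\<close> the map passes through the identity matrix, where the
  derivative of the constant determinant is the trace.
\<close>

lemma derivative_of_SL_valued_in_tangent_SL:
  fixes f :: "'a::real_normed_vector \<Rightarrow> real^'d^'d"
  assumes f: "(f has_derivative T) (at p)" and U: "open U" "p \<in> U" "\<And>q. q \<in> U \<Longrightarrow> f q \<in> SL"
  shows "T v \<in> tangent_SL (f p)"
proof -
  have "det (f p) = 1" using U by (auto simp: SL_def)
  then obtain Q where Q: "f p ** Q = mat 1" "Q ** f p = mat 1"
    using invertible_det_nz[of "f p"] unfolding invertible_def by auto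
  have "det Q * det (f p) = 1" using det_mul[of Q "f p"] Q(2) by simp
  then have dQ: "det Q = 1" using \<open>det (f p) = 1\<close> by simp
  have bl: "bounded_linear (\<lambda>X. Q ** X)"
    by (intro linear_conv_bounded_linear[THEN iffD1] linearI)
       (auto simp: matrix_add_ldistrib matrix_matrix_mult_def vec_eq_iff sum_distrib_left sum.distrib algebra_simps)
  have "((\<lambda>q. Q ** f q) has_derivative (\<lambda>v. Q ** T v)) (at p)"
    by (rule bounded_linear.has_derivative[OF bl f])
  then have "((\<lambda>q. det (Q ** f q)) has_derivative (\<lambda>v. trace (Q ** T v))) (at p)"
    by (rule has_derivative_compose) (simp add: Q has_derivative_det_at_1)
  moreover have "((\<lambda>q. det (Q ** f q)) has_derivative (\<lambda>v. 0)) (at p)"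
    by (rule has_derivative_transform_within_open[OF has_derivative_const U(1,2)])
       (use U(3) dQ in \<open>auto simp: det_mul SL_def\<close>)
  ultimately have "trace (Q ** T v) = 0" using has_derivative_unique by metis
  moreover have "f p ** (Q ** T v) = T v" using Q by (simp add: matrix_mul_assoc)
  ultimately show ?thesis unfolding tangent_SL_def by (metis (mono_tags, lifting) mem_Collect_eq)
qed

lemma uminus_tangent_SL: "X \<in> tangent_SL Q \<Longrightarrow> - X \<in> tangent_SL Q"
proof -
  assume "X \<in> tangent_SL Q"
  then obtain Y where Y: "X = Q ** Y" "trace Y = 0" unfolding tangent_SL_def by blast
  have "- X = Q ** (- Y)"
    using Y(1) by (simp add: matrix_matrix_mult_def vec_eq_iff sum_negf)
  moreover have "trace (- Y) = 0" using Y(2) by (simp add: trace_def sum_negf)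
  ultimately show ?thesis unfolding tangent_SL_def by blast
qed

section \<open>Steering by the noise\<close>

text \<open>
  Each \<open>A x\<close> with \<open>norm x \<le> 1\<close> can be nearly cancelled by some \<open>B v\<close> with \<open>v\<close> in the span of \<open>W\<close>. As
  these vectors \<open>A x\<close> form a totally bounded set, finitely many \<open>v\<close> suffice for all of them, and
  scaling yields all \<open>x\<close>. The choice of \<open>v\<close> need not be linear in \<open>x\<close>.
\<close>

lemma approximate_steering:
  fixes A :: "'x::real_normed_vector \<Rightarrow> 'y::real_normed_vector" and B :: "'e::real_normed_vector \<Rightarrow> 'y"
  assumes A: "bounded_linear A" and B: "bounded_linear B"
    and C: "compact C" "A ` cball 0 1 \<subseteq> C"
    and range: "\<And>x. - A x \<in> closure (range B)"
    and W: "closure (span W) = UNIV" and \<delta>: "\<delta> > 0"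
  obtains I K where "finite I" "I \<subseteq> W" "K > 0"
    "\<And>x. \<exists>v\<in>span I. norm v \<le> K * norm x \<and> norm (A x + B v) \<le> \<delta> * norm x"
proof -
  interpret A: bounded_linear A by fact
  interpret B: bounded_linear B by fact
  have "\<exists>I v. finite I \<and> I \<subseteq> W \<and> v \<in> span I \<and> norm (y + B v) < \<delta> / 2" if "y \<in> A ` cball 0 1" for y
  proof -
    have "- y \<in> closure (range B)" using that range by auto
    moreover have "closure (range B) \<subseteq> closure (B ` span W)"
    proof (rule closure_minimal)
      have "B ` closure (span W) \<subseteq> closure (B ` span W)"
        by (intro image_closure_subset[where T = "closure (B ` span W)"])
           (auto intro: linear_continuous_on B closure_subset[THEN subsetD])
      then show "range B \<subseteq> closure (B ` span W)" using W by simp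
    qed auto
    ultimately have "- y \<in> closure (B ` span W)" by blast
    then obtain v where v: "v \<in> span W" "dist (B v) (- y) < \<delta> / 2"
      using \<delta> unfolding closure_approachable by (metis half_gt_zero imageE)
    obtain I r where I: "finite I" "I \<subseteq> W" "v = (\<Sum>a\<in>I. r a *\<^sub>R a)"
      using v(1) unfolding span_explicit by blast
    moreover have "v \<in> span I" unfolding I(3) by (intro span_sum span_scale span_base)
    moreover have "norm (y + B v) < \<delta> / 2" using v(2) by (simp add: dist_norm add.commute)
    ultimately show ?thesis by blast
  qed
  then obtain I v where Iv: "\<And>y. y \<in> A ` cball 0 1 \<Longrightarrow>
      finite (I y) \<and> I y \<subseteq> W \<and> v y \<in> span (I y) \<and> norm (y + B (v y)) < \<delta> / 2" by metis
  have cc: "compact (closure (A ` cball 0 1))"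
    using C closure_minimal[OF C(2) compact_imp_closed[OF C(1)]] closed_Int_compact[OF closed_closure C(1)]
    by (metis inf.absorb1)
  have cov: "closure (A ` cball 0 1) \<subseteq> (\<Union>y\<in>A ` cball 0 1. ball y (\<delta> / 2))"
  proof
    fix x assume "x \<in> closure (A ` cball 0 1)"
    then obtain y where "y \<in> A ` cball 0 1" "dist y x < \<delta> / 2"
      using \<delta> unfolding closure_approachable by (meson half_gt_zero)
    then show "x \<in> (\<Union>y\<in>A ` cball 0 1. ball y (\<delta> / 2))" by auto
  qed
  obtain N where N: "finite N" "N \<subseteq> A ` cball 0 1"
    "closure (A ` cball 0 1) \<subseteq> (\<Union>y\<in>N. ball y (\<delta> / 2))"
    by (rule compactE_image[OF cc _ cov]) auto
  define I0 where "I0 = (\<Union>y\<in>N. I y)"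
  define K where "K = 1 + (\<Sum>y\<in>N. norm (v y))"
  have Kv: "norm (v y) \<le> K" if "y \<in> N" for y
    using member_le_sum[OF that, of "\<lambda>y. norm (v y)"] N(1) by (simp add: K_def)
  have K0: "K > 0" unfolding K_def by (simp add: add_pos_nonneg sum_nonneg)
  have "\<exists>u\<in>span I0. norm u \<le> K * norm x \<and> norm (A x + B u) \<le> \<delta> * norm x" for x
  proof (cases "x = 0")
    case True
    then show ?thesis by (intro bexI[of _ 0]) (auto simp: A.zero B.zero span_zero)
  next
    case False
    let ?x = "x /\<^sub>R norm x"
    have "A ?x \<in> closure (A ` cball 0 1)" using False by (intro closure_subset[THEN subsetD] imageI) simp
    then obtain y where y: "y \<in> N" "dist y (A ?x) < \<delta> / 2" using N(3) by auto
    have "norm (A ?x + B (v y)) \<le> norm (A ?x - y) + norm (y + B (v y))"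
      using norm_triangle_ineq[of "A ?x - y" "y + B (v y)"] by simp
    also have "\<dots> \<le> \<delta>" using y Iv[of y] N(2) by (auto simp: dist_norm norm_minus_commute)
    finally have le: "norm (A ?x + B (v y)) \<le> \<delta>" .
    have "A x + B (norm x *\<^sub>R v y) = norm x *\<^sub>R (A ?x + B (v y))"
      using False by (simp add: A.scaleR B.scaleR scaleR_add_right)
    then have "norm (A x + B (norm x *\<^sub>R v y)) = norm x * norm (A ?x + B (v y))" by simp
    also have "\<dots> \<le> \<delta> * norm x" using le by (metis mult.commute mult_left_mono norm_ge_zero)
    finally have "norm (A x + B (norm x *\<^sub>R v y)) \<le> \<delta> * norm x" .
    moreover have "norm (norm x *\<^sub>R v y) \<le> K * norm x"
      using mult_left_mono[OF Kv[OF y(1)] norm_ge_zero[of x]] by (simp add: mult.commute)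
    moreover have "v y \<in> span I0"
      using Iv[of y] y(1) N(2) span_mono[of "I y" I0] by (auto simp: I0_def)
    ultimately show ?thesis using span_scale by blast
  qed
  moreover have "finite I0" "I0 \<subseteq> W" using N(1,2) Iv by (auto simp: I0_def)
  ultimately show ?thesis using that K0 by blast
qed

text \<open>
  The geometric and regularity assumptions on the step of the random dynamical system, without the
  probabilistic ones.
\<close>

locale driven_cocycle =
  fixes \<A> :: "('m::metric_space, 'b::real_inner) chart set"
    and G :: "('m, 'b) metric_tensor"
    and S :: "'h::real_normed_vector \<times> 'm \<Rightarrow> 'e::real_normed_vector \<Rightarrow> 'h \<times> 'm"
    and A :: "'h \<times> 'm \<Rightarrow> 'e \<Rightarrow> real^'d^'d"
    and \<iota> :: "'v::real_normed_vector \<Rightarrow> 'h"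
    and SV :: "'h \<times> 'm \<Rightarrow> 'e \<Rightarrow> 'v"
  assumes manifold: "compact_riemannian_manifold \<A> G"
    and S_cont: "continuous_on UNIV (\<lambda>(z, e). S z e)"
    and A_SL: "\<And>z e. A z e \<in> SL"
    and embedding: "compact_embedding \<iota>"
    and S_factor: "\<And>z e. fst (S z e) = \<iota> (SV z e)"
    and S_C2: "C2_bounded_into_product \<A> (\<lambda>z e. (SV z e, snd (S z e)))"
    and A_C2: "C2_bounded_into_vector \<A> A"
begin

abbreviation step :: "'h \<times> 'm \<Rightarrow> 'e \<Rightarrow> ('h \<times> 'm) \<times> (real^'d^'d)" where
  "step z e \<equiv> (S z e, A z e)"

definition step_in_charts ::
  "('m, 'b) chart \<Rightarrow> ('m, 'b) chart \<Rightarrow> 'h \<times> 'b \<times> 'e \<Rightarrow> 'h \<times> 'b \<times> (real^'d^'d)" where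
  "step_in_charts \<kappa> \<kappa>' = (\<lambda>(u, x, \<eta>).
     (fst (S (u, chart_inv \<kappa> x) \<eta>), chart_map \<kappa>' (snd (S (u, chart_inv \<kappa> x) \<eta>)),
      A (u, chart_inv \<kappa> x) \<eta>))"

text \<open>
  Here \<open>(h, k)\<close> is the coordinate vector of the displacement from \<open>z1\<close> to \<open>z2\<close>. It is chosen before
  the noise \<open>\<eta>\<close> and its shift \<open>v\<close>, so that \<open>v\<close> can be made to depend on \<open>(h, k)\<close> alone. The constant
  \<open>\<Lambda>\<close> collects the Lipschitz constants of the charts; it has to be independent of the error \<open>\<epsilon>\<close> of
  the linearization.
\<close>

definition linear_comparison ::
  "('h \<times> 'b \<times> 'e \<Rightarrow> 'h \<times> 'b \<times> (real^'d^'d)) \<Rightarrow> real \<Rightarrow> real \<Rightarrow> 'h \<times> 'm \<Rightarrow> 'e \<Rightarrow> real \<Rightarrow> bool" where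
  "linear_comparison T \<Lambda> \<epsilon> z0 \<eta>0 r \<longleftrightarrow> (\<forall>z1\<in>ball z0 r. \<forall>z2\<in>ball z0 r. \<exists>h k. norm (h, k) \<le> \<Lambda> * dist z1 z2 \<and>
       (\<forall>\<eta>\<in>ball \<eta>0 r. \<forall>v. \<eta> + v \<in> ball \<eta>0 r \<longrightarrow>
         dist (step z1 \<eta>) (step z2 (\<eta> + v))
           \<le> \<Lambda> * (norm (T (h, k, v)) + \<epsilon> * (norm (h, k) + norm v))))"

text \<open>
  The first component of the derivative factors through the compact embedding and the other two take
  values in finite-dimensional spaces; this is the source of the compact set. The last component is
  tangent to the special linear group because the matrices stay in it.
\<close>

lemma step_in_charts_strict_derivative:
  assumes \<kappa>: "\<kappa> \<in> \<A>" and \<kappa>': "\<kappa>' \<in> \<A>" and x0: "x0 \<in> chart_range \<kappa>"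
    and y0: "snd (S (u0, chart_inv \<kappa> x0) \<eta>0) \<in> chart_dom \<kappa>'"
  shows "\<exists>T. strict_derivative (step_in_charts \<kappa> \<kappa>') T (u0, x0, \<eta>0) \<and>
    (\<exists>C. compact C \<and> (\<forall>h k. norm (h, k) \<le> 1 \<longrightarrow> T (h, k, 0) \<in> C)) \<and>
    (\<forall>w. snd (snd (T w)) \<in> tangent_SL (A (u0, chart_inv \<kappa> x0) \<eta>0))"
proof -
  note ch = manifold_is_chart[OF manifold \<kappa>] and ch' = manifold_is_chart[OF manifold \<kappa>']
  have fd: "\<exists>B::'b set. finite B \<and> span B = UNIV"
    using manifold by (simp add: compact_riemannian_manifold_def)
  interpret \<iota>: bounded_linear \<iota> using embedding by (simp add: compact_embedding_def)
  let ?p = "(u0, x0, \<eta>0)"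
  define D2 where "D2 = (UNIV :: 'h set) \<times> chart_range \<kappa> \<times> (UNIV :: 'e set)"
  define D1 where "D1 = D2 \<inter> (\<lambda>(u, x, \<eta>). snd (S (u, chart_inv \<kappa> x) \<eta>)) -` chart_dom \<kappa>'"
  define f1 where "f1 = (\<lambda>(u, x, \<eta>). (SV (u, chart_inv \<kappa> x) \<eta>, chart_map \<kappa>' (snd (S (u, chart_inv \<kappa> x) \<eta>))))"
  define f2 where "f2 = (\<lambda>(u, x, \<eta>). A (u, chart_inv \<kappa> x) \<eta>)"
  have oD2: "open D2" unfolding D2_def by (intro open_Times open_UNIV open_chart_range[OF ch])
  have cont: "continuous_on D2 (\<lambda>p. (\<lambda>(z, e). S z e) ((fst p, chart_inv \<kappa> (fst (snd p))), snd (snd p)))"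
    by (intro continuous_on_compose2[OF S_cont] continuous_intros
         continuous_on_compose2[OF continuous_on_chart_inv[OF ch]]) (auto simp: D2_def)
  have oD1: "open D1" unfolding D1_def
    using continuous_on_snd[OF cont]
    by (intro continuous_open_preimage oD2 open_chart_dom[OF ch']) (simp add: case_prod_beta)
  have pD2: "?p \<in> D2" using x0 by (simp add: D2_def)
  have pD1: "?p \<in> D1" using pD2 y0 by (simp add: D1_def)
  obtain \<B>1 where C1: "C2_bounded D1 \<B>1 f1"
  proof -
    have "D1 = {(u, x, \<eta>). x \<in> chart_range \<kappa> \<and> snd (SV (u, chart_inv \<kappa> x) \<eta>, snd (S (u, chart_inv \<kappa> x) \<eta>)) \<in> chart_dom \<kappa>'}"
      by (auto simp: D1_def D2_def)
    then show ?thesis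
      using S_C2 \<kappa> \<kappa>' that unfolding C2_bounded_into_product_def f1_def Let_def by auto
  qed
  obtain T1 where T1: "strict_derivative f1 T1 ?p"
    using C2_bounded_strict_derivative[OF C1 oD1 pD1] by blast
  obtain \<B>2 where C2: "C2_bounded D2 \<B>2 f2"
  proof -
    have "D2 = {(u, x, \<eta>). x \<in> chart_range \<kappa>}" by (auto simp: D2_def)
    then show ?thesis using A_C2 \<kappa> that unfolding C2_bounded_into_vector_def f2_def by auto
  qed
  obtain T2 where T2: "strict_derivative f2 T2 ?p"
    using C2_bounded_strict_derivative[OF C2 oD2 pD2] by blast
  interpret T1: bounded_linear T1 using T1 by (simp add: strict_derivative_def)
  interpret T2: bounded_linear T2 using T2 by (simp add: strict_derivative_def)
  define T where "T w = (\<iota> (fst (T1 w)), snd (T1 w), T2 w)" for w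
  have step_eq: "step_in_charts \<kappa> \<kappa>' = (\<lambda>p. (\<iota> (fst (f1 p)), snd (f1 p), f2 p))"
    by (auto simp: step_in_charts_def f1_def f2_def S_factor)
  have "strict_derivative (step_in_charts \<kappa> \<kappa>') T ?p"
    unfolding step_eq T_def
    by (intro strict_derivative_Pair T2 strict_derivative_linear_compose[OF T1]
          bounded_linear_compose[OF \<iota>.bounded_linear_axioms] bounded_linear_fst bounded_linear_snd)
  moreover have "\<exists>C. compact C \<and> (\<forall>h k. norm (h, k) \<le> 1 \<longrightarrow> T (h, k, 0) \<in> C)"
  proof -
    obtain K1 where K1: "\<And>w. norm (T1 w) \<le> norm w * K1" using T1.bounded by blast
    obtain K2 where K2: "\<And>w. norm (T2 w) \<le> norm w * K2" using T2.bounded by blast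
    define K where "K = \<bar>K1\<bar> + \<bar>K2\<bar>"
    have T1K: "norm (T1 w) \<le> K" and T2K: "norm (T2 w) \<le> K" if "norm w \<le> 1" for w
    proof -
      have "norm w * k \<le> 1 * \<bar>k\<bar>" for k
        using mult_left_mono[OF abs_ge_self[of k] norm_ge_zero[of w]]
          mult_right_mono[OF that abs_ge_zero[of k]] by linarith
      from this[of K1] this[of K2]
      show "norm (T1 w) \<le> K" "norm (T2 w) \<le> K" using K1[of w] K2[of w] by (simp_all add: K_def)
    qed
    let ?C = "closure (\<iota> ` cball 0 K) \<times> cball (0::'b) K \<times> cball (0::real^'d^'d) K"
    have "compact ?C"
      using embedding unfolding compact_embedding_def
      by (intro compact_Times finite_dimensional_compact_cball[OF fd] compact_cball) auto
    moreover have "T (h, k, 0) \<in> ?C" if "norm (h, k) \<le> 1" for h k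
    proof -
      have w: "norm (h, k, 0::'e) \<le> 1" using that by (simp add: norm_Pair)
      have "norm (fst q) \<le> norm q" "norm (snd q) \<le> norm q" for q :: "'v \<times> 'b"
        using norm_fst_le[of "fst q" "snd q"] norm_snd_le[of "snd q" "fst q"] by simp_all
      from this[of "T1 (h, k, 0)"]
      have "norm (fst (T1 (h, k, 0))) \<le> K" "norm (snd (T1 (h, k, 0))) \<le> K"
        using T1K[OF w] by linarith+
      then show ?thesis
        using T2K[OF w] closure_subset[of "\<iota> ` cball 0 K"] by (auto simp: T_def)
    qed
    ultimately show ?thesis by blast
  qed
  moreover have "snd (snd (T w)) \<in> tangent_SL (A (u0, chart_inv \<kappa> x0) \<eta>0)" for w
    using derivative_of_SL_valued_in_tangent_SL[OF strict_derivative_has_derivative[OF T2] oD2 pD2, of w] A_SL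
    by (auto simp: T_def f2_def)
  ultimately show ?thesis by blast
qed

text \<open>
  All passages between points and coordinates are made here.
\<close>

lemma step_local_comparison:
  assumes \<kappa>: "\<kappa> \<in> \<A>" "snd z0 \<in> chart_dom \<kappa>" and \<kappa>': "\<kappa>' \<in> \<A>" "snd (S z0 \<eta>0) \<in> chart_dom \<kappa>'"
    and T: "strict_derivative (step_in_charts \<kappa> \<kappa>') T (fst z0, chart_map \<kappa> (snd z0), \<eta>0)"
  shows "\<exists>\<Lambda>>0. \<forall>\<epsilon>>0. \<exists>r>0. linear_comparison T \<Lambda> \<epsilon> z0 \<eta>0 r"
proof -
  note ch = manifold_is_chart[OF manifold \<kappa>(1)] and ch' = manifold_is_chart[OF manifold \<kappa>'(1)]
  let ?F = "step_in_charts \<kappa> \<kappa>'"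
  let ?p0 = "(fst z0, chart_map \<kappa> (snd z0), \<eta>0)"
  obtain r1 L1 :: real where r1: "r1 > 0" "L1 > 0" "ball (snd z0) r1 \<subseteq> chart_dom \<kappa>"
    and L1: "\<And>p q. p \<in> ball (snd z0) r1 \<Longrightarrow> q \<in> ball (snd z0) r1 \<Longrightarrow>
       norm (chart_map \<kappa> p - chart_map \<kappa> q) \<le> L1 * dist p q"
    using chart_locally_bilipschitz[OF manifold \<kappa>] by metis
  obtain r2 L2 :: real where r2: "r2 > 0" "L2 > 0" "ball (snd (S z0 \<eta>0)) r2 \<subseteq> chart_dom \<kappa>'"
    and L2: "\<And>p q. p \<in> ball (snd (S z0 \<eta>0)) r2 \<Longrightarrow> q \<in> ball (snd (S z0 \<eta>0)) r2 \<Longrightarrow>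
       dist p q \<le> L2 * norm (chart_map \<kappa>' p - chart_map \<kappa>' q)"
    using chart_locally_bilipschitz[OF manifold \<kappa>'] by metis
  have "continuous_on UNIV (\<lambda>p. snd (S (fst p) (snd p)))"
    using continuous_on_snd[OF S_cont] by (simp add: case_prod_beta)
  then have "isCont (\<lambda>p. snd (S (fst p) (snd p))) (z0, \<eta>0)"
    using continuous_on_eq_continuous_at open_UNIV UNIV_I by blast
  then obtain d where d: "d > 0" "\<And>p. dist p (z0, \<eta>0) < d \<Longrightarrow> dist (snd (S (fst p) (snd p))) (snd (S z0 \<eta>0)) < r2"
    using r2(1) unfolding continuous_at_eps_delta by (metis fst_conv snd_conv)
  define \<Lambda> where "\<Lambda> = 3 + L1 + L2"
  have dP: "dist (a, b) (a', b') \<le> dist a a' + dist b b'"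
    for a a' :: "'x::metric_space" and b b' :: "'y::metric_space"
    by (simp add: dist_Pair_Pair sqrt_sum_squares_le_sum)
  show ?thesis
  proof (rule exI[of _ \<Lambda>], intro conjI allI impI)
    show "\<Lambda> > 0" using r1 r2 by (simp add: \<Lambda>_def)
    fix \<epsilon> :: real assume "\<epsilon> > 0"
    then obtain s where s: "s > 0" "\<And>p q. p \<in> ball ?p0 s \<Longrightarrow> q \<in> ball ?p0 s \<Longrightarrow>
        norm (?F q - ?F p - T (q - p)) \<le> \<epsilon> * norm (q - p)"
      using T unfolding strict_derivative_def by meson
    define r where "r = min r1 (min (d / 2) (s / (2 + L1)))"
    have "s / (2 + L1) > 0" using r1 s by simp
    then have r: "r > 0" "r \<le> r1" "r \<le> d / 2" "r \<le> s / (2 + L1)"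
      unfolding r_def using r1(1) d(1) by linarith+
    have near: "(fst z, chart_map \<kappa> (snd z), \<eta>) \<in> ball ?p0 s" "snd z \<in> ball (snd z0) r1"
      "snd (S z \<eta>) \<in> ball (snd (S z0 \<eta>0)) r2"
      "?F (fst z, chart_map \<kappa> (snd z), \<eta>) = (fst (S z \<eta>), chart_map \<kappa>' (snd (S z \<eta>)), A z \<eta>)"
      if "z \<in> ball z0 r" "\<eta> \<in> ball \<eta>0 r" for z \<eta>
    proof -
      have z: "dist (snd z0) (snd z) < r" "dist (fst z0) (fst z) < r"
        using that dist_snd_le[of z0 z] dist_fst_le[of z0 z] by auto
      then show sz: "snd z \<in> ball (snd z0) r1" using r by simp
      have "dist ?p0 (fst z, chart_map \<kappa> (snd z), \<eta>)
        \<le> dist (fst z0) (fst z) + (dist (chart_map \<kappa> (snd z0)) (chart_map \<kappa> (snd z)) + dist \<eta>0 \<eta>)"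
        using dP[of "fst z0" "(chart_map \<kappa> (snd z0), \<eta>0)" "fst z" "(chart_map \<kappa> (snd z), \<eta>)"]
          dP[of "chart_map \<kappa> (snd z0)" \<eta>0 "chart_map \<kappa> (snd z)" \<eta>] by linarith
      also have "\<dots> < r + (L1 * r + r)"
      proof -
        have "dist (chart_map \<kappa> (snd z0)) (chart_map \<kappa> (snd z)) \<le> L1 * dist (snd z0) (snd z)"
          using L1[of "snd z0" "snd z"] sz r1 by (simp add: dist_norm)
        also have "\<dots> \<le> L1 * r" using z r1 by (intro mult_left_mono) auto
        finally show ?thesis using z that by simp
      qed
      also have "\<dots> \<le> s" using r(4) r1 by (simp add: field_simps)
      finally show "(fst z, chart_map \<kappa> (snd z), \<eta>) \<in> ball ?p0 s" by simp
      have "dist (z, \<eta>) (z0, \<eta>0) < d"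
        using dP[of z \<eta> z0 \<eta>0] that r(3) by (simp add: dist_commute)
      then show "snd (S z \<eta>) \<in> ball (snd (S z0 \<eta>0)) r2" using d(2)[of "(z, \<eta>)"] by (simp add: dist_commute)
      show "?F (fst z, chart_map \<kappa> (snd z), \<eta>) = (fst (S z \<eta>), chart_map \<kappa>' (snd (S z \<eta>)), A z \<eta>)"
        using sz r1 ch by (auto simp: step_in_charts_def)
    qed
    show "\<exists>r>0. linear_comparison T \<Lambda> \<epsilon> z0 \<eta>0 r"
      unfolding linear_comparison_def
    proof (intro exI[of _ r] conjI ballI allI impI r(1))
      fix z1 z2 assume z: "z1 \<in> ball z0 r" "z2 \<in> ball z0 r"
      define h k where "h = fst z2 - fst z1" and "k = chart_map \<kappa> (snd z2) - chart_map \<kappa> (snd z1)"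
      have \<eta>0: "\<eta>0 \<in> ball \<eta>0 r" using r by simp
      have "norm (h, k) \<le> norm h + norm k" by (rule norm_Pair_le)
      also have "\<dots> \<le> dist z1 z2 + L1 * dist z1 z2"
      proof (rule add_mono)
        show "norm h \<le> dist z1 z2" using dist_fst_le[of z1 z2] by (simp add: h_def dist_norm norm_minus_commute)
        have "norm k \<le> L1 * dist (snd z1) (snd z2)"
          unfolding k_def using L1[of "snd z2" "snd z1"] near(2)[OF z(1) \<eta>0] near(2)[OF z(2) \<eta>0]
          by (simp add: dist_commute)
        also have "\<dots> \<le> L1 * dist z1 z2" using r1 dist_snd_le[of z1 z2] by simp
        finally show "norm k \<le> L1 * dist z1 z2" .
      qed
      also have "\<dots> \<le> \<Lambda> * dist z1 z2" using r2 by (simp add: \<Lambda>_def distrib_right)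
      finally have w: "norm (h, k) \<le> \<Lambda> * dist z1 z2" .
      have "dist (step z1 \<eta>) (step z2 (\<eta> + v))
           \<le> \<Lambda> * (norm (T (h, k, v)) + \<epsilon> * (norm (h, k) + norm v))"
        if \<eta>: "\<eta> \<in> ball \<eta>0 r" "\<eta> + v \<in> ball \<eta>0 r" for \<eta> v
      proof -
        let ?p = "(fst z1, chart_map \<kappa> (snd z1), \<eta>)" and ?q = "(fst z2, chart_map \<kappa> (snd z2), \<eta> + v)"
        note n1 = near[OF z(1) \<eta>(1)] and n2 = near[OF z(2) \<eta>(2)]
        define \<Delta> where "\<Delta> = norm (?F ?q - ?F ?p)"
        have \<Delta>: "\<Delta> = norm (fst (S z2 (\<eta> + v)) - fst (S z1 \<eta>),
            chart_map \<kappa>' (snd (S z2 (\<eta> + v))) - chart_map \<kappa>' (snd (S z1 \<eta>)), A z2 (\<eta> + v) - A z1 \<eta>)"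
          unfolding \<Delta>_def n1(4) n2(4) by simp
        have parts: "norm a \<le> norm (a, b, c)" "norm b \<le> norm (a, b, c)" "norm c \<le> norm (a, b, c)"
          for a :: 'h and b :: 'b and c :: "real^'d^'d"
          using norm_fst_le[of a "(b, c)"] norm_snd_le[of "(b, c)" a] norm_fst_le[of b c] norm_snd_le[of c b]
          by linarith+
        have "dist (step z1 \<eta>) (step z2 (\<eta> + v))
          \<le> dist (S z1 \<eta>) (S z2 (\<eta> + v)) + dist (A z1 \<eta>) (A z2 (\<eta> + v))" by (rule dP)
        also have "dist (S z1 \<eta>) (S z2 (\<eta> + v))
          \<le> dist (fst (S z1 \<eta>)) (fst (S z2 (\<eta> + v))) + dist (snd (S z1 \<eta>)) (snd (S z2 (\<eta> + v)))"
          using dP[of "fst (S z1 \<eta>)" "snd (S z1 \<eta>)" "fst (S z2 (\<eta> + v))" "snd (S z2 (\<eta> + v))"] by simp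
        also have "dist (fst (S z1 \<eta>)) (fst (S z2 (\<eta> + v))) \<le> \<Delta>"
          unfolding \<Delta> dist_norm by (subst norm_minus_commute) (rule parts)
        also have "dist (snd (S z1 \<eta>)) (snd (S z2 (\<eta> + v))) \<le> L2 * \<Delta>"
        proof -
          have "dist (snd (S z1 \<eta>)) (snd (S z2 (\<eta> + v)))
            \<le> L2 * norm (chart_map \<kappa>' (snd (S z2 (\<eta> + v))) - chart_map \<kappa>' (snd (S z1 \<eta>)))"
            using L2[OF n1(3) n2(3)] by (simp add: norm_minus_commute)
          also have "\<dots> \<le> L2 * \<Delta>" unfolding \<Delta> using r2 by (intro mult_left_mono parts) auto
          finally show ?thesis .
        qed
        also have "dist (A z1 \<eta>) (A z2 (\<eta> + v)) \<le> \<Delta>"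
          unfolding \<Delta> dist_norm by (subst norm_minus_commute) (rule parts)
        also have "\<Delta> + L2 * \<Delta> + \<Delta> \<le> \<Lambda> * \<Delta>"
          using r1 by (simp add: \<Lambda>_def distrib_right \<Delta>_def)
        also have "\<Lambda> * \<Delta> \<le> \<Lambda> * (norm (T (h, k, v)) + \<epsilon> * (norm (h, k) + norm v))"
        proof (intro mult_left_mono)
          have qp: "?q - ?p = (h, k, v)" by (simp add: h_def k_def)
          have "\<Delta> \<le> norm (T (?q - ?p)) + norm (?F ?q - ?F ?p - T (?q - ?p))"
            unfolding \<Delta>_def using norm_triangle_sub by blast
          also have "norm (?F ?q - ?F ?p - T (?q - ?p)) \<le> \<epsilon> * norm (?q - ?p)"
            by (rule s(2)[OF n1(1) n2(1)])
          also have "\<dots> \<le> \<epsilon> * (norm (h, k) + norm v)"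
          proof -
            have "norm (h, k, v) \<le> norm (h, k) + norm v"
            proof -
              have "norm (h, k, v) = norm ((h, k), v)" by (simp add: norm_Pair add.assoc)
              then show ?thesis by (simp add: norm_Pair_le)
            qed
            then show ?thesis unfolding qp using \<open>\<epsilon> > 0\<close> by (intro mult_left_mono) auto
          qed
          finally show "\<Delta> \<le> norm (T (h, k, v)) + \<epsilon> * (norm (h, k) + norm v)" unfolding qp by simp
          show "0 \<le> \<Lambda>" using r1 r2 by (simp add: \<Lambda>_def)
        qed
        finally show ?thesis by simp
      qed
      with w show "\<exists>h k. norm (h, k) \<le> \<Lambda> * dist z1 z2 \<and>
       (\<forall>\<eta>\<in>ball \<eta>0 r. \<forall>v. \<eta> + v \<in> ball \<eta>0 r \<longrightarrow>
         dist (step z1 \<eta>) (step z2 (\<eta> + v))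
           \<le> \<Lambda> * (norm (T (h, k, v)) + \<epsilon> * (norm (h, k) + norm v)))" by blast
    qed
  qed
qed

text \<open>
  The properties of the linearization that no longer mention the chart around \<open>z0\<close>.
\<close>

lemma step_comparison:
  assumes \<kappa>': "\<kappa>' \<in> \<A>" "snd (S z0 \<eta>0) \<in> chart_dom \<kappa>'"
  obtains T \<Lambda> C where "bounded_linear T" "\<Lambda> > 0" "\<forall>\<epsilon>>0. \<exists>r>0. linear_comparison T \<Lambda> \<epsilon> z0 \<eta>0 r"
    "compact C" "\<forall>h k. norm (h, k) \<le> 1 \<longrightarrow> T (h, k, 0) \<in> C"
    "\<forall>w. snd (snd (T w)) \<in> tangent_SL (A z0 \<eta>0)"
    "((\<lambda>\<zeta>. (fst (S z0 \<zeta>), chart_map \<kappa>' (snd (S z0 \<zeta>)), A z0 \<zeta>)) has_derivative (\<lambda>v. T (0, 0, v))) (at \<eta>0)"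
proof -
  obtain \<kappa> where \<kappa>: "\<kappa> \<in> \<A>" "snd z0 \<in> chart_dom \<kappa>" using manifold_chart_exists[OF manifold] by metis
  have z0: "(fst z0, chart_inv \<kappa> (chart_map \<kappa> (snd z0))) = z0"
    using manifold_is_chart[OF manifold \<kappa>(1)] \<kappa>(2) by simp
  have x0: "chart_map \<kappa> (snd z0) \<in> chart_range \<kappa>" using \<kappa>(2) by simp
  have y0: "snd (S (fst z0, chart_inv \<kappa> (chart_map \<kappa> (snd z0))) \<eta>0) \<in> chart_dom \<kappa>'"
    unfolding z0 by (rule \<kappa>'(2))
  obtain T C where T: "strict_derivative (step_in_charts \<kappa> \<kappa>') T (fst z0, chart_map \<kappa> (snd z0), \<eta>0)"
    and TC: "compact C" "\<forall>h k. norm (h, k) \<le> 1 \<longrightarrow> T (h, k, 0) \<in> C"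
    and Ttan: "\<forall>w. snd (snd (T w)) \<in> tangent_SL (A z0 \<eta>0)"
    using step_in_charts_strict_derivative[OF \<kappa>(1) \<kappa>'(1) x0 y0] unfolding z0 by (elim exE conjE)
  have "((\<lambda>\<zeta>. (fst z0, chart_map \<kappa> (snd z0), \<zeta>)) has_derivative (\<lambda>v. (0, 0, v))) (at \<eta>0)"
    by (auto intro!: derivative_eq_intros)
  then have "((\<lambda>\<zeta>. step_in_charts \<kappa> \<kappa>' (fst z0, chart_map \<kappa> (snd z0), \<zeta>)) has_derivative (\<lambda>v. T (0, 0, v))) (at \<eta>0)"
    by (rule has_derivative_compose) (rule strict_derivative_has_derivative[OF T])
  then have D: "((\<lambda>\<zeta>. (fst (S z0 \<zeta>), chart_map \<kappa>' (snd (S z0 \<zeta>)), A z0 \<zeta>)) has_derivative (\<lambda>v. T (0, 0, v))) (at \<eta>0)"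
    by (simp add: step_in_charts_def z0)
  obtain \<Lambda> where \<Lambda>: "\<Lambda> > 0" "\<forall>\<epsilon>>0. \<exists>r>0. linear_comparison T \<Lambda> \<epsilon> z0 \<eta>0 r"
    using step_local_comparison[OF \<kappa> \<kappa>' T] by blast
  have "bounded_linear T" using T by (simp add: strict_derivative_def)
  from that[OF this \<Lambda> TC Ttan D] show ?thesis .
qed

text \<open>
  The comparison without a shift of the noise.
\<close>

lemma step_locally_lipschitz:
  "\<exists>r>0. \<exists>L>0. \<forall>z1\<in>ball z0 r. \<forall>z2\<in>ball z0 r. \<forall>\<eta>\<in>ball \<eta>0 r.
     dist (step z1 \<eta>) (step z2 \<eta>) \<le> L * dist z1 z2"
proof -
  obtain \<kappa>' where \<kappa>': "\<kappa>' \<in> \<A>" "snd (S z0 \<eta>0) \<in> chart_dom \<kappa>'"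
    using manifold_chart_exists[OF manifold] by metis
  obtain T \<Lambda> where T: "bounded_linear T" and \<Lambda>: "\<Lambda> > 0" "\<forall>\<epsilon>>0. \<exists>r>0. linear_comparison T \<Lambda> \<epsilon> z0 \<eta>0 r"
    by (rule step_comparison[OF \<kappa>'])
  obtain r where r: "r > 0" "linear_comparison T \<Lambda> 1 z0 \<eta>0 r" using \<Lambda>(2) zero_less_one by blast
  interpret T: bounded_linear T by (rule T)
  obtain K where K: "K > 0" "\<And>w. norm (T w) \<le> norm w * K" using T.pos_bounded by blast
  have "dist (step z1 \<eta>) (step z2 \<eta>) \<le> \<Lambda> * ((K + 1) * \<Lambda>) * dist z1 z2"
    if z: "z1 \<in> ball z0 r" "z2 \<in> ball z0 r" and \<eta>: "\<eta> \<in> ball \<eta>0 r" for z1 z2 \<eta>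
  proof -
    obtain h k where hk: "norm (h, k) \<le> \<Lambda> * dist z1 z2"
      "\<And>v. \<eta> + v \<in> ball \<eta>0 r \<Longrightarrow> dist (step z1 \<eta>) (step z2 (\<eta> + v))
           \<le> \<Lambda> * (norm (T (h, k, v)) + 1 * (norm (h, k) + norm v))"
      using r(2) z \<eta> unfolding linear_comparison_def by blast
    have n: "norm (h, k, 0::'e) = norm (h, k)" by (simp add: norm_Pair)
    have "dist (step z1 \<eta>) (step z2 \<eta>) \<le> \<Lambda> * (norm (T (h, k, 0)) + norm (h, k))"
      using hk(2)[of 0] \<eta> by simp
    also have "\<dots> \<le> \<Lambda> * ((K + 1) * norm (h, k))"
      using K(2)[of "(h, k, 0)"] \<Lambda>(1) unfolding n by (intro mult_left_mono) (simp_all add: algebra_simps)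
    also have "\<dots> \<le> \<Lambda> * ((K + 1) * (\<Lambda> * dist z1 z2))"
      using hk(1) \<Lambda>(1) K(1) by (intro mult_left_mono) simp_all
    finally show ?thesis by (simp add: mult.assoc)
  qed
  moreover have "\<Lambda> * ((K + 1) * \<Lambda>) > 0" using \<Lambda>(1) K(1) by simp
  ultimately show ?thesis using r(1) by blast
qed

lemma step_lipschitz_on_compact:
  assumes "compact Q"
  obtains r L where "r > 0" "L > 0"
    "\<And>z1 z2 \<eta>. z1 \<in> ball z0 r \<Longrightarrow> z2 \<in> ball z0 r \<Longrightarrow> \<eta> \<in> Q \<Longrightarrow>
       dist (step z1 \<eta>) (step z2 \<eta>) \<le> L * dist z1 z2"
proof -
  have "\<forall>\<eta>0. \<exists>r L. r > 0 \<and> L > 0 \<and> (\<forall>z1\<in>ball z0 r. \<forall>z2\<in>ball z0 r. \<forall>\<eta>\<in>ball \<eta>0 r.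
     dist (step z1 \<eta>) (step z2 \<eta>) \<le> L * dist z1 z2)"
    using step_locally_lipschitz[of z0] by blast
  then obtain r L where rL: "\<And>\<eta>0. r \<eta>0 > 0" "\<And>\<eta>0. L \<eta>0 > 0"
    "\<And>\<eta>0 z1 z2 \<eta>. z1 \<in> ball z0 (r \<eta>0) \<Longrightarrow> z2 \<in> ball z0 (r \<eta>0) \<Longrightarrow> \<eta> \<in> ball \<eta>0 (r \<eta>0) \<Longrightarrow>
     dist (step z1 \<eta>) (step z2 \<eta>) \<le> L \<eta>0 * dist z1 z2"
    by metis
  have cov: "Q \<subseteq> (\<Union>\<eta>0\<in>Q. ball \<eta>0 (r \<eta>0))" using rL(1) by force
  obtain N where N: "N \<subseteq> Q" "finite N" "Q \<subseteq> (\<Union>\<eta>0\<in>N. ball \<eta>0 (r \<eta>0))"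
    by (rule compactE_image[OF assms _ cov]) auto
  define r' where "r' = Min (insert 1 (r ` N))"
  define L' where "L' = 1 + (\<Sum>\<eta>0\<in>N. L \<eta>0)"
  have r': "r' > 0" "\<And>\<eta>0. \<eta>0 \<in> N \<Longrightarrow> r' \<le> r \<eta>0" using N(2) rL(1) by (auto simp: r'_def)
  have L': "L' > 0" "\<And>\<eta>0. \<eta>0 \<in> N \<Longrightarrow> L \<eta>0 \<le> L'"
  proof -
    show "L' > 0" using rL(2) by (simp add: L'_def add_pos_nonneg sum_nonneg less_imp_le)
    show "L \<eta>0 \<le> L'" if "\<eta>0 \<in> N" for \<eta>0
      using member_le_sum[OF that, of L] rL(2) N(2) by (simp add: L'_def less_imp_le)
  qed
  show ?thesis
  proof (rule that[OF r'(1) L'(1)])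
    fix z1 z2 \<eta> assume z: "z1 \<in> ball z0 r'" "z2 \<in> ball z0 r'" and "\<eta> \<in> Q"
    then obtain \<eta>0 where \<eta>0: "\<eta>0 \<in> N" "\<eta> \<in> ball \<eta>0 (r \<eta>0)" using N(3) by blast
    have "dist (step z1 \<eta>) (step z2 \<eta>) \<le> L \<eta>0 * dist z1 z2"
      using z r'(2)[OF \<eta>0(1)] \<eta>0(2) by (intro rL(3)) auto
    also have "\<dots> \<le> L' * dist z1 z2" using L'(2)[OF \<eta>0(1)] by (simp add: mult_right_mono)
    finally show "dist (step z1 \<eta>) (step z2 \<eta>) \<le> L' * dist z1 z2" .
  qed
qed

text \<open>
  The values \<open>\<delta>'\<close> and \<open>\<epsilon>\<close> are chosen such that the two error terms, the one of the approximate
  cancellation and the one of the linearization, contribute \<open>\<delta> / 2\<close> each after the passage through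
  the charts. The radius \<open>r'\<close> is small enough for the shifted noise to stay in the ball where the
  linearization is valid.
\<close>

lemma noise_steering:
  assumes \<kappa>': "\<kappa>' \<in> \<A>" "snd (S z0 \<eta>0) \<in> chart_dom \<kappa>'"
    and D: "((\<lambda>\<zeta>. (fst (S z0 \<zeta>), chart_map \<kappa>' (snd (S z0 \<zeta>)), A z0 \<zeta>)) has_derivative D) (at \<eta>0)"
    and dense: "closure (range D) = UNIV \<times> UNIV \<times> tangent_SL (A z0 \<eta>0)"
    and W: "closure (span W) = UNIV" and \<delta>: "\<delta> > 0"
  shows "\<exists>r K I. r > 0 \<and> K > 0 \<and> finite I \<and> I \<subseteq> W \<and>
    (\<forall>z1\<in>ball z0 r. \<forall>z2\<in>ball z0 r. \<exists>v\<in>span I. norm v \<le> K * dist z1 z2 \<and>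
      (\<forall>\<eta>\<in>ball \<eta>0 r. dist (step z1 \<eta>) (step z2 (\<eta> + v)) \<le> \<delta> * dist z1 z2))"
proof -
  obtain T \<Lambda> C where T: "bounded_linear T" and \<Lambda>: "\<Lambda> > 0" "\<forall>\<epsilon>>0. \<exists>r>0. linear_comparison T \<Lambda> \<epsilon> z0 \<eta>0 r"
    and TC: "compact C" "\<forall>h k. norm (h, k) \<le> 1 \<longrightarrow> T (h, k, 0) \<in> C"
    and Ttan: "\<forall>w. snd (snd (T w)) \<in> tangent_SL (A z0 \<eta>0)"
    and DT': "((\<lambda>\<zeta>. (fst (S z0 \<zeta>), chart_map \<kappa>' (snd (S z0 \<zeta>)), A z0 \<zeta>)) has_derivative (\<lambda>v. T (0, 0, v))) (at \<eta>0)"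
    by (rule step_comparison[OF \<kappa>'])
  interpret T: bounded_linear T by (rule T)
  have blA: "bounded_linear (\<lambda>w. T (fst w, snd w, 0))"
    by (intro bounded_linear_compose[OF T.bounded_linear_axioms] bounded_linear_Pair
         bounded_linear_fst bounded_linear_snd bounded_linear_zero)
  have blB: "bounded_linear (\<lambda>v. T (0, 0, v))"
    by (intro bounded_linear_compose[OF T.bounded_linear_axioms] bounded_linear_Pair
         bounded_linear_ident bounded_linear_zero)
  have DT: "D = (\<lambda>v. T (0, 0, v))" by (rule has_derivative_unique[OF D DT'])
  have range: "- T (fst w, snd w, 0) \<in> closure (range (\<lambda>v. T (0, 0, v)))" for w
    using dense uminus_tangent_SL[OF Ttan[rule_format, of "(fst w, snd w, 0)"]]
    by (simp add: DT mem_Times_iff)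
  have C: "(\<lambda>w. T (fst w, snd w, 0)) ` cball 0 1 \<subseteq> C" using TC(2) by force
  \<comment> \<open>the distance bound loses a factor \<open>\<Lambda>\<close> in the coordinates of the displacement and another one
      in the distance of the images\<close>
  define \<delta>' where "\<delta>' = \<delta> / (2 * \<Lambda>\<^sup>2)"
  have \<delta>': "\<delta>' > 0" using \<delta> \<Lambda>(1) by (simp add: \<delta>'_def)
  obtain I K where I: "finite I" "I \<subseteq> W" and K: "K > 0"
    and steer: "\<And>w. \<exists>v\<in>span I. norm v \<le> K * norm w \<and> norm (T (fst w, snd w, 0) + T (0, 0, v)) \<le> \<delta>' * norm w"
    by (rule approximate_steering[OF blA blB TC(1) C range W \<delta>']) blast
  define \<epsilon> where "\<epsilon> = \<delta>' / (1 + K)"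
  have \<epsilon>: "\<epsilon> > 0" using \<delta>' K by (simp add: \<epsilon>_def)
  obtain r where r: "r > 0" "linear_comparison T \<Lambda> \<epsilon> z0 \<eta>0 r" using \<Lambda>(2) \<epsilon> by blast
  define r' where "r' = r / (1 + 2 * (K * \<Lambda>))"
  have K\<Lambda>: "K * \<Lambda> > 0" using K \<Lambda>(1) by simp
  have r': "r' > 0" "r' + K * \<Lambda> * (2 * r') = r"
  proof -
    show "r' > 0" using r(1) K\<Lambda> by (simp add: r'_def)
    have "r' * (1 + 2 * (K * \<Lambda>)) = r" using K\<Lambda> by (simp add: r'_def)
    then show "r' + K * \<Lambda> * (2 * r') = r" by (simp add: algebra_simps)
  qed
  then have r'r: "r' \<le> r" using K\<Lambda> mult_nonneg_nonneg[of "K * \<Lambda>" "2 * r'"] by linarith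
  have "\<exists>v\<in>span I. norm v \<le> K * \<Lambda> * dist z1 z2 \<and>
      (\<forall>\<eta>\<in>ball \<eta>0 r'. dist (step z1 \<eta>) (step z2 (\<eta> + v)) \<le> \<delta> * dist z1 z2)"
    if z: "z1 \<in> ball z0 r'" "z2 \<in> ball z0 r'" for z1 z2
  proof -
    have "z1 \<in> ball z0 r" "z2 \<in> ball z0 r" using z r'r by auto
    then obtain h k where hk: "norm (h, k) \<le> \<Lambda> * dist z1 z2"
      "\<And>\<eta> v. \<eta> \<in> ball \<eta>0 r \<Longrightarrow> \<eta> + v \<in> ball \<eta>0 r \<Longrightarrow> dist (step z1 \<eta>) (step z2 (\<eta> + v))
           \<le> \<Lambda> * (norm (T (h, k, v)) + \<epsilon> * (norm (h, k) + norm v))"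
      using r(2) unfolding linear_comparison_def by blast
    obtain v where v: "v \<in> span I" "norm v \<le> K * norm (h, k)"
      "norm (T (h, k, 0) + T (0, 0, v)) \<le> \<delta>' * norm (h, k)"
      using steer[of "(h, k)"] by auto
    have "norm v \<le> K * (\<Lambda> * dist z1 z2)"
      using v(2) mult_left_mono[OF hk(1), of K] K by linarith
    then have vd: "norm v \<le> K * \<Lambda> * dist z1 z2" by (simp add: mult.assoc)
    have "dist z1 z2 < 2 * r'" using z dist_triangle2[of z1 z2 z0] by (simp add: dist_commute)
    then have "K * \<Lambda> * dist z1 z2 < K * \<Lambda> * (2 * r')" using K\<Lambda> by (intro mult_strict_left_mono)
    then have vr: "norm v < K * \<Lambda> * (2 * r')" using vd by linarith
    have "dist (step z1 \<eta>) (step z2 (\<eta> + v)) \<le> \<delta> * dist z1 z2" if \<eta>: "\<eta> \<in> ball \<eta>0 r'" for \<eta>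
    proof -
      have "dist \<eta>0 (\<eta> + v) \<le> dist \<eta>0 \<eta> + norm v"
        using dist_triangle[of \<eta>0 "\<eta> + v" \<eta>] by (simp add: dist_norm)
      then have "\<eta> \<in> ball \<eta>0 r" "\<eta> + v \<in> ball \<eta>0 r" using \<eta> vr r'r r'(2) by auto
      from hk(2)[OF this] have "dist (step z1 \<eta>) (step z2 (\<eta> + v))
           \<le> \<Lambda> * (norm (T (h, k, v)) + \<epsilon> * (norm (h, k) + norm v))" .
      also have "\<dots> \<le> \<Lambda> * (\<delta>' * norm (h, k) + \<epsilon> * (norm (h, k) + K * norm (h, k)))"
      proof (intro mult_left_mono add_mono order_refl)
        have "T (h, k, v) = T (h, k, 0) + T (0, 0, v)" by (simp add: T.add[symmetric])
        then show "norm (T (h, k, v)) \<le> \<delta>' * norm (h, k)" using v(3) by simp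
      qed (use v(2) \<epsilon> \<Lambda>(1) in auto)
      also have "\<epsilon> * (norm (h, k) + K * norm (h, k)) = \<delta>' * norm (h, k)"
      proof -
        have "\<epsilon> * (norm (h, k) + K * norm (h, k)) = (\<epsilon> * (1 + K)) * norm (h, k)"
          by (simp add: algebra_simps)
        then show ?thesis using K by (simp add: \<epsilon>_def)
      qed
      also have "\<Lambda> * (\<delta>' * norm (h, k) + \<delta>' * norm (h, k)) = 2 * \<Lambda> * \<delta>' * norm (h, k)" by simp
      also have "\<dots> \<le> 2 * \<Lambda> * \<delta>' * (\<Lambda> * dist z1 z2)"
        using hk(1) \<Lambda>(1) \<delta>' by (intro mult_left_mono) auto
      also have "\<dots> = \<delta> * dist z1 z2"
        using \<Lambda>(1) by (simp add: \<delta>'_def power2_eq_square)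
      finally show ?thesis .
    qed
    then show ?thesis using v(1) vd by blast
  qed
  then show ?thesis using r'(1) K\<Lambda> I by blast
qed

end

section \<open>The law of the noise under translations\<close>

text \<open>
  For short shifts the integrand is at most \<open>L * \<bar>s\<bar>\<close> on a bounded interval and zero elsewhere; for
  long ones the trivial bound 2 is enough. A Lipschitz density with unbounded support need not have
  this property.
\<close>

lemma lipschitz_density_shift:
  fixes \<rho> :: "real \<Rightarrow> real"
  assumes \<rho>: "integrable lborel \<rho>" "L-lipschitz_on UNIV \<rho>" "\<And>x. \<rho> x \<ge> 0" "(\<integral>x. \<rho> x \<partial>lborel) = 1"
    and supp: "\<And>x. \<bar>x\<bar> > R \<Longrightarrow> \<rho> x = 0"
  obtains C where "C \<ge> 0" "\<And>s. (\<integral>x. \<bar>\<rho> (x - s) - \<rho> x\<bar> \<partial>lborel) \<le> C * \<bar>s\<bar>"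
proof -
  have L: "L \<ge> 0" using \<rho>(2) by (rule lipschitz_on_nonneg)
  have int: "integrable lborel (\<lambda>x. \<rho> (x - s))" for s
    using lborel_integrable_real_affine[OF \<rho>(1), of 1 "- s"] by simp
  have one: "(\<integral>x. \<rho> (x - s) \<partial>lborel) = 1" for s
    using lborel_integral_real_affine[of 1 \<rho> "- s"] \<rho>(4) by simp
  define C where "C = L * (2 * (\<bar>R\<bar> + 1)) + 2"
  show ?thesis
  proof (rule that[of C])
    show "C \<ge> 0" using L by (simp add: C_def)
    show "(\<integral>x. \<bar>\<rho> (x - s) - \<rho> x\<bar> \<partial>lborel) \<le> C * \<bar>s\<bar>" for s
    proof (cases "\<bar>s\<bar> \<le> 1")
      case True
      let ?I = "{- (\<bar>R\<bar> + 1)..\<bar>R\<bar> + 1}"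
      have "(\<integral>x. \<bar>\<rho> (x - s) - \<rho> x\<bar> \<partial>lborel) \<le> (\<integral>x. L * \<bar>s\<bar> * indicator ?I x \<partial>lborel)"
      proof (rule integral_mono)
        show "integrable lborel (\<lambda>x. \<bar>\<rho> (x - s) - \<rho> x\<bar>)" using int \<rho>(1) by simp
        show "integrable lborel (\<lambda>x. L * \<bar>s\<bar> * indicator ?I x)" by simp
        show "\<bar>\<rho> (x - s) - \<rho> x\<bar> \<le> L * \<bar>s\<bar> * indicator ?I x" for x
        proof (cases "x \<in> ?I")
          case True
          then show ?thesis using lipschitz_onD[OF \<rho>(2), of "x - s" x] by (simp add: dist_real_def)
        next
          case False
          then have "\<bar>x\<bar> > R" "\<bar>x - s\<bar> > R" using \<open>\<bar>s\<bar> \<le> 1\<close> by (auto simp: abs_if split: if_splits)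
          then show ?thesis using supp False by simp
        qed
      qed
      also have "\<dots> = L * \<bar>s\<bar> * (2 * (\<bar>R\<bar> + 1))" by simp
      also have "\<dots> \<le> C * \<bar>s\<bar>" by (simp add: C_def algebra_simps)
      finally show ?thesis .
    next
      case False
      have "(\<integral>x. \<bar>\<rho> (x - s) - \<rho> x\<bar> \<partial>lborel) \<le> (\<integral>x. \<rho> (x - s) + \<rho> x \<partial>lborel)"
        using int \<rho>(1) \<rho>(3) by (intro integral_mono) (auto simp: abs_diff_le_iff abs_le_iff add_increasing2)
      also have "\<dots> = 2" using int \<rho>(1,4) one by simp
      also have "\<dots> \<le> C * \<bar>s\<bar>"
      proof -
        have "2 \<le> C" using L by (simp add: C_def)
        then have "2 * 1 \<le> C * \<bar>s\<bar>" using False by (intro mult_mono) auto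
        then show ?thesis by simp
      qed
      finally show ?thesis .
    qed
  qed
qed

text \<open>
  \<open>C\<close> bounds the total variation distance, in the normalization where it is at most 2, between \<open>\<mu>\<close> and
  its translate by \<open>v\<close>.
\<close>

definition translation_bound :: "'e::real_normed_vector measure \<Rightarrow> real \<Rightarrow> 'e \<Rightarrow> bool" where
  "translation_bound \<mu> C v \<longleftrightarrow> (\<forall>F\<in>borel_measurable borel. \<forall>B. (\<forall>e. \<bar>F e\<bar> \<le> B) \<longrightarrow>
     \<bar>(\<integral>e. F (e + v) \<partial>\<mu>) - (\<integral>e. F e \<partial>\<mu>)\<bar> \<le> C * B)"

text \<open>
  Conditionally on \<open>Z\<close>, a shift along \<open>\<phi>\<close> is a shift of the real variable \<open>\<xi>\<close>, which can be moved to
  the density. Independence is expressed by the product law since \<open>Z\<close> and \<open>\<xi>\<close> have different types.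
\<close>

lemma (in prob_space) translation_along_independent_coordinate:
  fixes Z :: "'a \<Rightarrow> 'e::{real_normed_vector, second_countable_topology}" and \<phi> :: 'e
  assumes Z[measurable]: "Z \<in> borel_measurable M" and \<xi>[measurable]: "\<xi> \<in> borel_measurable M"
    and joint: "distr M borel Z \<Otimes>\<^sub>M distr M borel \<xi> = distr M (borel \<Otimes>\<^sub>M borel) (\<lambda>\<omega>. (Z \<omega>, \<xi> \<omega>))"
    and dens: "distributed M lborel \<xi> (\<lambda>x. ennreal (\<rho> x))"
    and \<rho>: "L-lipschitz_on UNIV \<rho>" "\<And>x. \<rho> x \<ge> 0" "\<And>x. \<bar>x\<bar> > R \<Longrightarrow> \<rho> x = 0" and b: "b \<noteq> 0"
  shows "\<exists>C\<ge>0. \<forall>t. translation_bound (distr M borel (\<lambda>\<omega>. (b * \<xi> \<omega>) *\<^sub>R \<phi> + Z \<omega>)) (C * \<bar>t\<bar>) (t *\<^sub>R \<phi>)"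
proof -
  have \<rho>m[measurable]: "\<rho> \<in> borel_measurable borel"
    by (intro borel_measurable_continuous_onI lipschitz_on_continuous_on[OF \<rho>(1)])
  have nn: "(\<integral>\<^sup>+x. ennreal (\<rho> x) \<partial>lborel) = 1"
  proof -
    have "emeasure (distr M lborel \<xi>) UNIV = 1" by (simp add: emeasure_distr emeasure_space_1)
    also have "distr M lborel \<xi> = density lborel (\<lambda>x. ennreal (\<rho> x))" using dens by (simp add: distributed_distr_eq_density)
    finally show ?thesis by (simp add: emeasure_density)
  qed
  have \<rho>i: "integrable lborel \<rho>" and \<rho>1: "(\<integral>x. \<rho> x \<partial>lborel) = 1"
    using nn \<rho>(2) by (auto intro!: integrableI_nonneg simp: integral_eq_nn_integral)
  obtain C where C: "C \<ge> 0" "\<And>s. (\<integral>x. \<bar>\<rho> (x - s) - \<rho> x\<bar> \<partial>lborel) \<le> C * \<bar>s\<bar>"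
    by (rule lipschitz_density_shift[OF \<rho>i \<rho>(1,2) \<rho>1 \<rho>(3)]) auto
  let ?MZ = "distr M borel Z" and ?M\<xi> = "distr M borel \<xi>"
  interpret MZ: prob_space ?MZ by (rule prob_space_distr) simp
  interpret M\<xi>: prob_space ?M\<xi> by (rule prob_space_distr) simp
  interpret pp: pair_prob_space ?MZ ?M\<xi> ..
  have M\<xi>: "?M\<xi> = density lborel (\<lambda>x. ennreal (\<rho> x))"
  proof -
    have "?M\<xi> = distr M lborel \<xi>" by (rule distr_cong) simp_all
    then show ?thesis using dens by (simp add: distributed_distr_eq_density)
  qed
  show ?thesis
    unfolding translation_bound_def
  proof (rule exI[of _ "C / \<bar>b\<bar>"], intro conjI allI ballI impI)
    show "C / \<bar>b\<bar> \<ge> 0" using C by simp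
    fix t :: real and F :: "'e \<Rightarrow> real" and B :: real
    assume F[measurable]: "F \<in> borel_measurable borel" and FB': "\<forall>e. \<bar>F e\<bar> \<le> B"
    note FB = FB'[rule_format]
    have B: "B \<ge> 0" using FB[of 0] by linarith
    let ?\<eta> = "\<lambda>\<omega>. (b * \<xi> \<omega>) *\<^sub>R \<phi> + Z \<omega>"
    define H where "H s z = (\<integral>x. \<rho> (x - s) * F ((b * x) *\<^sub>R \<phi> + z) \<partial>lborel)" for s z
    have inti: "integrable lborel (\<lambda>x. \<rho> (x - s) * F ((b * x) *\<^sub>R \<phi> + z))" for s z
    proof (rule Bochner_Integration.integrable_bound[of _ "\<lambda>x. \<rho> (x - s) * B"])
      show "integrable lborel (\<lambda>x. \<rho> (x - s) * B)"
        using lborel_integrable_real_affine[OF \<rho>i, of 1 "- s"] by simp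
      show "AE x in lborel. norm (\<rho> (x - s) * F ((b * x) *\<^sub>R \<phi> + z)) \<le> norm (\<rho> (x - s) * B)"
        using FB \<rho>(2) B by (intro always_eventually) (auto simp: abs_mult intro!: mult_left_mono)
    qed simp
    have Hint: "(\<integral>e. F (e + u *\<^sub>R \<phi>) \<partial>distr M borel ?\<eta>) = (\<integral>z. H (u / b) z \<partial>?MZ)"
      "integrable ?MZ (H (u / b))" for u
    proof -
      let ?f = "\<lambda>(z, x). F ((b * x) *\<^sub>R \<phi> + z + u *\<^sub>R \<phi>)"
      have fm: "?f \<in> borel_measurable (borel \<Otimes>\<^sub>M borel)" by measurable
      have fi: "integrable (?MZ \<Otimes>\<^sub>M ?M\<xi>) ?f"
        by (rule pp.integrable_const_bound[where B = B]) (use FB fm in auto)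
      have inner: "(\<integral>x. F ((b * x) *\<^sub>R \<phi> + z + u *\<^sub>R \<phi>) \<partial>?M\<xi>) = H (u / b) z" for z
      proof -
        have "(\<integral>x. F ((b * x) *\<^sub>R \<phi> + z + u *\<^sub>R \<phi>) \<partial>?M\<xi>) = (\<integral>x. \<rho> x * F ((b * x) *\<^sub>R \<phi> + z + u *\<^sub>R \<phi>) \<partial>lborel)"
          unfolding M\<xi> using \<rho>(2) by (subst integral_density) auto
        also have "\<dots> = (\<integral>x. \<rho> (- (u / b) + 1 * x) * F ((b * (- (u / b) + 1 * x)) *\<^sub>R \<phi> + z + u *\<^sub>R \<phi>) \<partial>lborel)"
          by (subst lborel_integral_real_affine[where c = 1 and t = "- (u / b)"]) simp_all
        also have "\<dots> = H (u / b) z"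
          unfolding H_def using b by (intro Bochner_Integration.integral_cong) (simp_all add: algebra_simps)
        finally show ?thesis .
      qed
      have "(\<integral>e. F (e + u *\<^sub>R \<phi>) \<partial>distr M borel ?\<eta>) = (\<integral>\<omega>. F (?\<eta> \<omega> + u *\<^sub>R \<phi>) \<partial>M)"
        by (rule integral_distr) simp_all
      also have "\<dots> = integral\<^sup>L (?MZ \<Otimes>\<^sub>M ?M\<xi>) ?f"
        unfolding joint by (subst integral_distr) (use fm in auto)
      also have "\<dots> = (\<integral>z. \<integral>x. F ((b * x) *\<^sub>R \<phi> + z + u *\<^sub>R \<phi>) \<partial>?M\<xi> \<partial>?MZ)"
        using pp.integral_fst'[OF fi] by simp
      finally show "(\<integral>e. F (e + u *\<^sub>R \<phi>) \<partial>distr M borel ?\<eta>) = (\<integral>z. H (u / b) z \<partial>?MZ)"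
        unfolding inner .
      show "integrable ?MZ (H (u / b))"
        using pp.integrable_fst'[OF fi] by (simp add: inner)
    qed
    have diff: "\<bar>H (t / b) z - H 0 z\<bar> \<le> C / \<bar>b\<bar> * B * \<bar>t\<bar>" for z
    proof -
      have "H (t / b) z - H 0 z = (\<integral>x. (\<rho> (x - t / b) - \<rho> x) * F ((b * x) *\<^sub>R \<phi> + z) \<partial>lborel)"
        unfolding H_def using inti[of "t / b" z] inti[of 0 z]
        by (simp add: left_diff_distrib flip: Bochner_Integration.integral_diff)
      also have "\<bar>\<dots>\<bar> \<le> (\<integral>x. \<bar>(\<rho> (x - t / b) - \<rho> x) * F ((b * x) *\<^sub>R \<phi> + z)\<bar> \<partial>lborel)"
        by (rule integral_abs_bound)
      also have "\<dots> \<le> (\<integral>x. \<bar>\<rho> (x - t / b) - \<rho> x\<bar> * B \<partial>lborel)"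
      proof (rule integral_mono)
        show "integrable lborel (\<lambda>x. \<bar>(\<rho> (x - t / b) - \<rho> x) * F ((b * x) *\<^sub>R \<phi> + z)\<bar>)"
          using inti[of "t / b" z] inti[of 0 z] by (simp add: left_diff_distrib)
        show "integrable lborel (\<lambda>x. \<bar>\<rho> (x - t / b) - \<rho> x\<bar> * B)"
          using lborel_integrable_real_affine[OF \<rho>i, of 1 "- (t / b)"] \<rho>i by simp
        show "\<bar>(\<rho> (x - t / b) - \<rho> x) * F ((b * x) *\<^sub>R \<phi> + z)\<bar> \<le> \<bar>\<rho> (x - t / b) - \<rho> x\<bar> * B" for x
          unfolding abs_mult using FB by (intro mult_left_mono) auto
      qed
      also have "\<dots> = (\<integral>x. \<bar>\<rho> (x - t / b) - \<rho> x\<bar> \<partial>lborel) * B" by simp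
      also have "\<dots> \<le> C * \<bar>t / b\<bar> * B" using C(2)[of "t / b"] B by (rule mult_right_mono)
      finally show ?thesis by (simp add: abs_divide algebra_simps)
    qed
    have "\<bar>(\<integral>z. H (t / b) z \<partial>?MZ) - (\<integral>z. H (0 / b) z \<partial>?MZ)\<bar> \<le> (\<integral>z. C / \<bar>b\<bar> * B * \<bar>t\<bar> \<partial>?MZ)"
    proof -
      have "\<bar>(\<integral>z. H (t / b) z \<partial>?MZ) - (\<integral>z. H (0 / b) z \<partial>?MZ)\<bar> = \<bar>\<integral>z. H (t / b) z - H (0 / b) z \<partial>?MZ\<bar>"
        by (simp only: Bochner_Integration.integral_diff[OF Hint(2)[of t] Hint(2)[of 0]])
      also have "\<dots> \<le> (\<integral>z. \<bar>H (t / b) z - H (0 / b) z\<bar> \<partial>?MZ)" by (rule integral_abs_bound)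
      also have "\<dots> \<le> (\<integral>z. C / \<bar>b\<bar> * B * \<bar>t\<bar> \<partial>?MZ)"
        using Hint(2)[of t] Hint(2)[of 0] diff by (intro integral_mono) auto
      finally show ?thesis .
    qed
    also have "\<dots> = C / \<bar>b\<bar> * B * \<bar>t\<bar>" using MZ.prob_space by simp
    finally show "\<bar>(\<integral>e. F (e + t *\<^sub>R \<phi>) \<partial>distr M borel ?\<eta>) - (\<integral>e. F e \<partial>distr M borel ?\<eta>)\<bar> \<le> C / \<bar>b\<bar> * \<bar>t\<bar> * B"
      using Hint(1)[of t] Hint(1)[of 0] by (simp add: mult_ac)
  qed
qed

lemma has_sum_nat_partial_sums:
  fixes f :: "nat \<Rightarrow> 'a::{comm_monoid_add, topological_space}"
  assumes "(f has_sum s) A"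
  shows "(\<lambda>n. sum f (A \<inter> {..n})) \<longlonglongrightarrow> s"
proof -
  have "filterlim (\<lambda>n. A \<inter> {..n}) (finite_subsets_at_top A) sequentially"
    unfolding filterlim_finite_subsets_at_top
  proof safe
    fix X assume X: "finite X" "X \<subseteq> A"
    then obtain n where "X \<subseteq> {..n}" by (auto simp: finite_nat_set_iff_bounded_le)
    then show "\<forall>\<^sub>F n in sequentially. finite (A \<inter> {..n}) \<and> X \<subseteq> A \<inter> {..n} \<and> A \<inter> {..n} \<subseteq> A"
      using X(2) by (intro eventually_mono[OF eventually_ge_at_top[of n]]) auto
  qed
  then show ?thesis using assms unfolding has_sum_def by (rule filterlim_compose[rotated])
qed

text \<open>
  The rest of the series is a measurable function of the other coordinates, hence independent of the
  coordinate \<open>j\<close>. To have such a function everywhere, and not only almost everywhere, the partial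
  sums are replaced by 0 where they do not form a Cauchy sequence.
\<close>

lemma noise_split_coordinate:
  fixes \<eta> :: "nat \<Rightarrow> 'w \<Rightarrow> 'e::{real_inner, polish_space}"
  assumes P: "prob_space P" and nd: "noise_decomposition P \<eta> J \<phi> b \<xi> \<rho>" and j: "j \<in> J"
  obtains Z where "Z \<in> borel_measurable P" "\<xi> j 1 \<in> borel_measurable P"
    "distr P borel Z \<Otimes>\<^sub>M distr P borel (\<xi> j 1) = distr P (borel \<Otimes>\<^sub>M borel) (\<lambda>\<omega>. (Z \<omega>, \<xi> j 1 \<omega>))"
    "AE \<omega> in P. \<eta> 1 \<omega> = (b j * \<xi> j 1 \<omega>) *\<^sub>R \<phi> j + Z \<omega>"
    "AE \<omega> in P. Z \<omega> \<bullet> \<phi> j = 0"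
proof -
  interpret prob_space P by fact
  have on: "\<And>i k. i \<in> J \<Longrightarrow> k \<in> J \<Longrightarrow> \<phi> i \<bullet> \<phi> k = (if i = k then 1 else 0)"
    and ind: "indep_vars (\<lambda>_. borel) (\<lambda>(j, k). \<xi> j k) (J \<times> {1..})"
    and hs: "AE \<omega> in P. ((\<lambda>j. (b j * \<xi> j 1 \<omega>) *\<^sub>R \<phi> j) has_sum \<eta> 1 \<omega>) J"
    using nd unfolding noise_decomposition_def orthonormal_basis_on_def by auto
  let ?A = "(J - {j}) \<times> {1::nat}" and ?B = "{(j, 1::nat)}"
  let ?J = "\<lambda>n. (J - {j}) \<inter> {..n::nat}"
  define s where "s n f = (\<Sum>i\<in>?J n. (b i * f (i, 1)) *\<^sub>R \<phi> i)" for n and f :: "nat \<times> nat \<Rightarrow> real"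
  have sm: "s n \<in> borel_measurable (PiM ?A (\<lambda>_. borel))" for n
    unfolding s_def by measurable
  define u where "u n f = (if Cauchy (\<lambda>n. s n f) then s n f else 0)" for n f
  have um: "u n \<in> borel_measurable (PiM ?A (\<lambda>_. borel))" for n
    unfolding u_def using sets_Collect_Cauchy[OF sm] sm by (intro measurable_If) auto
  have "\<exists>g. (\<lambda>n. u n f) \<longlonglongrightarrow> g" for f
    using Cauchy_convergent_iff[of "\<lambda>n. s n f"] by (cases "Cauchy (\<lambda>n. s n f)") (auto simp: u_def convergent_def)
  then obtain g where g: "\<And>f. (\<lambda>n. u n f) \<longlonglongrightarrow> g f" by metis
  have gm: "g \<in> borel_measurable (PiM ?A (\<lambda>_. borel))"
    by (rule borel_measurable_LIMSEQ_metric[OF um g])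
  let ?X = "\<lambda>\<omega>. restrict (\<lambda>i. (case i of (j, k) \<Rightarrow> \<xi> j k) \<omega>) ?A"
  define Z where "Z \<omega> = g (?X \<omega>)" for \<omega>
  let ?U = "\<lambda>\<omega>. restrict (\<lambda>i. (case i of (j, k) \<Rightarrow> \<xi> j k) \<omega>) ?A"
    and ?V = "\<lambda>\<omega>. restrict (\<lambda>i. (case i of (j, k) \<Rightarrow> \<xi> j k) \<omega>) ?B"
    and ?MA = "PiM ?A (\<lambda>_. borel :: real measure)" and ?MB = "PiM ?B (\<lambda>_. borel :: real measure)"
  have "indep_var ?MA ?U ?MB ?V"
    using j by (intro indep_var_restrict[OF ind]) auto
  then have U: "?U \<in> measurable P ?MA" and V: "?V \<in> measurable P ?MB"
    and UV: "distr P ?MA ?U \<Otimes>\<^sub>M distr P ?MB ?V = distr P (?MA \<Otimes>\<^sub>M ?MB) (\<lambda>\<omega>. (?U \<omega>, ?V \<omega>))"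
    unfolding indep_var_distribution_eq by auto
  have hm: "(\<lambda>f. f (j, 1)) \<in> borel_measurable ?MB" by simp
  have ZU: "Z = g \<circ> ?U" by (simp add: Z_def fun_eq_iff)
  have \<xi>V: "\<xi> j 1 = (\<lambda>f. f (j, 1)) \<circ> ?V" by (auto simp: fun_eq_iff)
  have Zm: "Z \<in> borel_measurable P" unfolding ZU by (rule measurable_comp[OF U gm])
  have \<xi>m: "\<xi> j 1 \<in> borel_measurable P" unfolding \<xi>V by (rule measurable_comp[OF V hm])
  have dZ: "distr P borel Z = distr (distr P ?MA ?U) borel g"
    unfolding ZU by (rule distr_distr[OF gm U, symmetric])
  have d\<xi>: "distr P borel (\<xi> j 1) = distr (distr P ?MB ?V) borel (\<lambda>f. f (j, 1))"
    unfolding \<xi>V by (rule distr_distr[OF hm V, symmetric])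
  have sf: "sigma_finite_measure (distr P borel (\<xi> j 1))"
    using prob_space_distr[OF \<xi>m] by (simp add: prob_space_imp_sigma_finite)
  have gh: "(\<lambda>(f, f'). (g f, f' (j, 1))) \<in> measurable (?MA \<Otimes>\<^sub>M ?MB) (borel \<Otimes>\<^sub>M borel)"
    unfolding case_prod_beta
    by (intro measurable_Pair measurable_compose[OF measurable_fst gm] measurable_compose[OF measurable_snd hm])
  have "distr P borel Z \<Otimes>\<^sub>M distr P borel (\<xi> j 1) =
      distr (distr P ?MA ?U \<Otimes>\<^sub>M distr P ?MB ?V) (borel \<Otimes>\<^sub>M borel) (\<lambda>(f, f'). (g f, f' (j, 1)))"
    using sf unfolding dZ d\<xi> by (intro pair_measure_distr) (use gm hm in simp_all)
  also have "\<dots> = distr P (borel \<Otimes>\<^sub>M borel) ((\<lambda>(f, f'). (g f, f' (j, 1))) \<circ> (\<lambda>\<omega>. (?U \<omega>, ?V \<omega>)))"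
    unfolding UV by (rule distr_distr[OF gh measurable_Pair[OF U V]])
  also have "(\<lambda>(f, f'). (g f, f' (j, 1))) \<circ> (\<lambda>\<omega>. (?U \<omega>, ?V \<omega>)) = (\<lambda>\<omega>. (Z \<omega>, \<xi> j 1 \<omega>))"
    unfolding ZU by (auto simp: fun_eq_iff)
  finally have iv: "distr P borel Z \<Otimes>\<^sub>M distr P borel (\<xi> j 1) = distr P (borel \<Otimes>\<^sub>M borel) (\<lambda>\<omega>. (Z \<omega>, \<xi> j 1 \<omega>))" .
  have eq: "\<eta> 1 \<omega> = (b j * \<xi> j 1 \<omega>) *\<^sub>R \<phi> j + Z \<omega> \<and> Z \<omega> \<bullet> \<phi> j = 0"
    if h: "((\<lambda>j. (b j * \<xi> j 1 \<omega>) *\<^sub>R \<phi> j) has_sum \<eta> 1 \<omega>) J" for \<omega>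
  proof -
    have sX: "s n (?X \<omega>) = (\<Sum>i\<in>?J n. (b i * \<xi> i 1 \<omega>) *\<^sub>R \<phi> i)" for n
      unfolding s_def by (intro sum.cong) auto
    have "(\<lambda>n. \<Sum>i\<in>J \<inter> {..n}. (b i * \<xi> i 1 \<omega>) *\<^sub>R \<phi> i) \<longlonglongrightarrow> \<eta> 1 \<omega>"
      by (rule has_sum_nat_partial_sums[OF h])
    then have "(\<lambda>n. (\<Sum>i\<in>J \<inter> {..n}. (b i * \<xi> i 1 \<omega>) *\<^sub>R \<phi> i) - (b j * \<xi> j 1 \<omega>) *\<^sub>R \<phi> j)
        \<longlonglongrightarrow> \<eta> 1 \<omega> - (b j * \<xi> j 1 \<omega>) *\<^sub>R \<phi> j"
      by (intro tendsto_diff tendsto_const)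
    moreover have "\<forall>\<^sub>F n in sequentially.
        (\<Sum>i\<in>J \<inter> {..n}. (b i * \<xi> i 1 \<omega>) *\<^sub>R \<phi> i) - (b j * \<xi> j 1 \<omega>) *\<^sub>R \<phi> j = s n (?X \<omega>)"
      using eventually_ge_at_top[of j]
    proof eventually_elim
      case (elim n)
      have "J \<inter> {..n} = insert j (?J n)" using j elim by auto
      then show ?case unfolding sX by simp
    qed
    ultimately have lim: "(\<lambda>n. s n (?X \<omega>)) \<longlonglongrightarrow> \<eta> 1 \<omega> - (b j * \<xi> j 1 \<omega>) *\<^sub>R \<phi> j"
      by (rule Lim_transform_eventually)
    then have "Cauchy (\<lambda>n. s n (?X \<omega>))" by (rule LIMSEQ_imp_Cauchy)
    then have "(\<lambda>n. s n (?X \<omega>)) \<longlonglongrightarrow> Z \<omega>"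
      using g[of "?X \<omega>"] by (simp add: u_def Z_def)
    then have ZL: "Z \<omega> = \<eta> 1 \<omega> - (b j * \<xi> j 1 \<omega>) *\<^sub>R \<phi> j" and Zl: "(\<lambda>n. s n (?X \<omega>)) \<longlonglongrightarrow> Z \<omega>"
      using lim LIMSEQ_unique by auto
    have "(\<lambda>n. s n (?X \<omega>) \<bullet> \<phi> j) \<longlonglongrightarrow> Z \<omega> \<bullet> \<phi> j" by (intro tendsto_inner Zl tendsto_const)
    moreover have "s n (?X \<omega>) \<bullet> \<phi> j = 0" for n
      unfolding sX inner_sum_left using on j by (intro sum.neutral) auto
    ultimately have "Z \<omega> \<bullet> \<phi> j = 0" by (simp add: LIMSEQ_const_iff)
    then show ?thesis using ZL by simp
  qed
  show ?thesis
    by (rule that[OF Zm \<xi>m iv]) (use hs eq in \<open>auto elim!: eventually_mono\<close>)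
qed

lemma continuous_AE_zero_imp_zero:
  fixes \<rho> :: "real \<Rightarrow> real"
  assumes "continuous_on UNIV \<rho>" "AE x in lborel. 0 < \<rho> x \<longrightarrow> \<bar>x\<bar> \<le> R" "\<bar>x\<bar> > R" "\<rho> x \<ge> 0"
  shows "\<rho> x = 0"
proof (rule ccontr)
  assume "\<rho> x \<noteq> 0"
  define U where "U = {x. \<bar>x\<bar> > R} \<inter> {x. \<rho> x > 0}"
  have "open U" unfolding U_def using assms(1)
    by (intro open_Int open_Collect_less continuous_intros)
  moreover have "x \<in> U" using assms \<open>\<rho> x \<noteq> 0\<close> by (simp add: U_def)
  ultimately have nn: "\<not> negligible U" using open_not_negligible by blast
  have "AE x in lborel. x \<notin> U" using assms(2) by eventually_elim (auto simp: U_def)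
  moreover have "U \<in> sets borel" using \<open>open U\<close> by simp
  ultimately have "U \<in> null_sets lborel" by (subst (asm) AE_iff_null_sets[symmetric]) auto
  then show False using nn by (simp add: negligible_iff_null_sets null_sets_completionI)
qed

text \<open>
  The noise is bounded and \<open>b j\<close> is nonzero, so the coordinate \<open>j\<close> is bounded; hence its continuous
  density vanishes outside a bounded interval.
\<close>

lemma noise_translation_coordinate:
  fixes \<eta> :: "nat \<Rightarrow> 'w \<Rightarrow> 'e::{real_inner, polish_space}"
  assumes P: "prob_space P" and nd: "noise_decomposition P \<eta> J \<phi> b \<xi> \<rho>" and j: "j \<in> J"
    and \<eta>: "\<eta> 1 \<in> borel_measurable P" and bdd: "AE \<omega> in P. norm (\<eta> 1 \<omega>) \<le> R"
  shows "\<exists>C\<ge>0. \<forall>t. translation_bound (distr P borel (\<eta> 1)) (C * \<bar>t\<bar>) (t *\<^sub>R \<phi> j)"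
proof -
  interpret prob_space P by fact
  obtain L where bj: "b j \<noteq> 0" and \<rho>: "\<And>x. \<rho> j x \<ge> 0" "L-lipschitz_on UNIV (\<rho> j)"
    and dens: "distributed P lborel (\<xi> j 1) (\<lambda>x. ennreal (\<rho> j x))" and n1: "\<phi> j \<bullet> \<phi> j = 1"
    using nd j unfolding noise_decomposition_def orthonormal_basis_on_def by force
  obtain Z where Zm[measurable]: "Z \<in> borel_measurable P" and \<xi>m[measurable]: "\<xi> j 1 \<in> borel_measurable P"
    and Z: "distr P borel Z \<Otimes>\<^sub>M distr P borel (\<xi> j 1) = distr P (borel \<Otimes>\<^sub>M borel) (\<lambda>\<omega>. (Z \<omega>, \<xi> j 1 \<omega>))"
    "AE \<omega> in P. \<eta> 1 \<omega> = (b j * \<xi> j 1 \<omega>) *\<^sub>R \<phi> j + Z \<omega>"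
    "AE \<omega> in P. Z \<omega> \<bullet> \<phi> j = 0"
    by (rule noise_split_coordinate[OF P nd j])
  have "AE \<omega> in P. \<bar>\<xi> j 1 \<omega>\<bar> \<le> R / \<bar>b j\<bar>"
    using Z(2,3) bdd
  proof eventually_elim
    case (elim \<omega>)
    have "\<eta> 1 \<omega> \<bullet> \<phi> j = b j * \<xi> j 1 \<omega>" using elim by (simp add: inner_add_left n1)
    moreover have "\<bar>\<eta> 1 \<omega> \<bullet> \<phi> j\<bar> \<le> norm (\<eta> 1 \<omega>)"
      using Cauchy_Schwarz_ineq2[of "\<eta> 1 \<omega>" "\<phi> j"] n1 by (simp add: norm_eq_sqrt_inner[of "\<phi> j"])
    ultimately have "\<bar>b j\<bar> * \<bar>\<xi> j 1 \<omega>\<bar> \<le> R" using elim by (simp add: abs_mult)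
    then show ?case using bj by (simp add: field_simps)
  qed
  then have "AE x in lborel. 0 < \<rho> j x \<longrightarrow> \<bar>x\<bar> \<le> R / \<bar>b j\<bar>"
    using distributed_AE2[OF dens, of "\<lambda>x. \<bar>x\<bar> \<le> R / \<bar>b j\<bar>"] by simp
  then have supp: "\<rho> j x = 0" if "\<bar>x\<bar> > R / \<bar>b j\<bar>" for x
    using continuous_AE_zero_imp_zero[OF lipschitz_on_continuous_on[OF \<rho>(2)] _ that \<rho>(1)] by blast
  have "distr P borel (\<eta> 1) = distr P borel (\<lambda>\<omega>. (b j * \<xi> j 1 \<omega>) *\<^sub>R \<phi> j + Z \<omega>)"
    by (rule distr_cong_AE[OF HOL.refl HOL.refl Z(2) \<eta>]) measurable
  then show ?thesis
    using translation_along_independent_coordinate[OF Zm \<xi>m Z(1) dens \<rho>(2,1) supp bj] by simp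
qed

text \<open>
  The coordinates of \<open>v\<close> are shifted one after the other. By orthogonality each of them is bounded by
  the norm of \<open>v\<close>.
\<close>

lemma noise_translation:
  fixes \<eta> :: "nat \<Rightarrow> 'w \<Rightarrow> 'e::{real_inner, polish_space}"
  assumes P: "prob_space P" and nd: "noise_decomposition P \<eta> J \<phi> b \<xi> \<rho>"
    and \<eta>: "\<eta> 1 \<in> borel_measurable P" and bdd: "AE \<omega> in P. norm (\<eta> 1 \<omega>) \<le> R"
    and I: "finite I" "I \<subseteq> \<phi> ` J"
  shows "\<exists>C\<ge>0. \<forall>v\<in>span I. translation_bound (distr P borel (\<eta> 1)) (C * norm v) v"
  using I
proof (induction I rule: finite_induct)
  case empty
  show ?case by (intro exI[of _ 0]) (auto simp: translation_bound_def)
next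
  case (insert a I)
  let ?\<mu> = "distr P borel (\<eta> 1)"
  obtain C where C: "C \<ge> 0" "\<And>v. v \<in> span I \<Longrightarrow> translation_bound ?\<mu> (C * norm v) v"
    using insert by (metis insert_subset)
  obtain j where j: "j \<in> J" "a = \<phi> j" using insert.prems by auto
  obtain C' where C': "C' \<ge> 0" "\<And>t. translation_bound ?\<mu> (C' * \<bar>t\<bar>) (t *\<^sub>R \<phi> j)"
    using noise_translation_coordinate[OF P nd j(1) \<eta> bdd] by metis
  have on: "\<And>i k. i \<in> J \<Longrightarrow> k \<in> J \<Longrightarrow> \<phi> i \<bullet> \<phi> k = (if i = k then 1 else 0)"
    using nd unfolding noise_decomposition_def orthonormal_basis_on_def by auto
  have "translation_bound ?\<mu> ((C' + 2 * C) * norm v) v" if v: "v \<in> span (insert a I)" for v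
    unfolding translation_bound_def
  proof (intro ballI allI impI)
    fix F :: "'e \<Rightarrow> real" and B :: real
    assume F[measurable]: "F \<in> borel_measurable borel" and FB: "\<forall>e. \<bar>F e\<bar> \<le> B"
    have B: "B \<ge> 0" using FB[rule_format, of 0] by linarith
    obtain t where t: "v - t *\<^sub>R a \<in> span I" using v span_breakdown_eq by blast
    define w where "w = v - t *\<^sub>R a"
    have "w \<bullet> a = 0"
    proof -
      have "x \<bullet> a = 0" if "x \<in> I" for x using that insert.hyps(2) insert.prems on j by fastforce
      then have "span I \<subseteq> {x. x \<bullet> a = 0}"
        by (intro span_minimal) (auto simp: subspace_def inner_add_left)
      then show ?thesis using t by (auto simp: w_def)
    qed
    moreover have a1: "a \<bullet> a = 1" using on j by simp
    ultimately have "v \<bullet> a = t" by (simp add: w_def inner_diff_left)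
    then have tv: "\<bar>t\<bar> \<le> norm v" using Cauchy_Schwarz_ineq2[of v a] a1 by (simp add: norm_eq_sqrt_inner[of a])
    have "norm w \<le> norm v + norm (t *\<^sub>R a)" unfolding w_def by (rule norm_triangle_ineq4)
    then have wv: "norm w \<le> 2 * norm v" using tv a1 by (simp add: norm_eq_sqrt_inner[of a])
    have vw: "e + v = (e + t *\<^sub>R \<phi> j) + w" for e using j by (simp add: w_def)
    have "\<bar>(\<integral>e. F (e + v) \<partial>?\<mu>) - (\<integral>e. F (e + w) \<partial>?\<mu>)\<bar> \<le> C' * \<bar>t\<bar> * B"
      unfolding vw using C'(2)[of t, unfolded translation_bound_def, rule_format, of "\<lambda>e. F (e + w)" B] FB by simp
    moreover have "\<bar>(\<integral>e. F (e + w) \<partial>?\<mu>) - (\<integral>e. F e \<partial>?\<mu>)\<bar> \<le> C * norm w * B"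
      using C(2)[of w] t F FB by (simp add: w_def translation_bound_def)
    moreover have "C' * \<bar>t\<bar> * B \<le> C' * norm v * B" using tv C'(1) B by (intro mult_right_mono mult_left_mono)
    moreover have "C * norm w * B \<le> C * (2 * norm v) * B" using wv C(1) B by (intro mult_right_mono mult_left_mono)
    ultimately have "\<bar>(\<integral>e. F (e + v) \<partial>?\<mu>) - (\<integral>e. F e \<partial>?\<mu>)\<bar> \<le> C' * norm v * B + C * (2 * norm v) * B"
      by linarith
    then show "\<bar>(\<integral>e. F (e + v) \<partial>?\<mu>) - (\<integral>e. F e \<partial>?\<mu>)\<bar> \<le> (C' + 2 * C) * norm v * B"
      by (simp add: algebra_simps)
  qed
  moreover have "C' + 2 * C \<ge> 0" using C(1) C'(1) by simp
  ultimately show ?case by blast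
qed

section \<open>From steering to the Hoelder estimate\<close>

lemma sup_norm_on_nonneg:
  assumes "bdd_above ((\<lambda>z. \<bar>f z\<bar>) ` Z)"
  shows "sup_norm_on Z f \<ge> 0"
  unfolding sup_norm_on_def using assms by (intro cSup_upper) auto

lemma abs_le_sup_norm_on:
  assumes "bdd_above ((\<lambda>z. \<bar>f z\<bar>) ` Z)" "z \<in> Z"
  shows "\<bar>f z\<bar> \<le> sup_norm_on Z f"
  unfolding sup_norm_on_def using assms by (intro cSup_upper) auto

text \<open>
  The Hoelder quotients only involve pairs at distance at most 1; for the others the supremum norm
  takes over, at the price of the factor 2.
\<close>

lemma holder_space_oscillation:
  assumes g: "g \<in> holder_space (1/2) Z" and xy: "x \<in> Z" "y \<in> Z"
  shows "\<bar>g x - g y\<bar> \<le> 2 * holder_norm (1/2) Z g * sqrt (dist x y)"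
proof -
  have bd: "bdd_above ((\<lambda>z. \<bar>g z\<bar>) ` Z)" "bdd_above (holder_quotients (1/2) Z g)"
    using g by (auto simp: holder_space_def)
  define s where "s = sup_norm_on Z g"
  define q where "q = Sup (insert 0 (holder_quotients (1/2) Z g))"
  have s: "s \<ge> 0" unfolding s_def by (rule sup_norm_on_nonneg[OF bd(1)])
  have q: "q \<ge> 0" unfolding q_def using bd(2) by (intro cSup_upper) auto
  have H: "holder_norm (1/2) Z g = s + q" by (simp add: holder_norm_def s_def q_def)
  consider "dist x y = 0" | "0 < dist x y" "dist x y \<le> 1" | "dist x y > 1" by fastforce
  then show ?thesis
  proof cases
    case 2
    have "\<bar>g x - g y\<bar> / dist x y powr (1/2) \<in> holder_quotients (1/2) Z g"
      unfolding holder_quotients_def using xy 2 by blast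
    then have "\<bar>g x - g y\<bar> / dist x y powr (1/2) \<le> q"
      unfolding q_def using bd(2) by (intro cSup_upper) auto
    then have "\<bar>g x - g y\<bar> \<le> q * sqrt (dist x y)" using 2 by (simp add: powr_half_sqrt field_simps)
    also have "\<dots> \<le> 2 * (s + q) * sqrt (dist x y)" using s q by (intro mult_right_mono) auto
    finally show ?thesis unfolding H .
  next
    case 3
    have "\<bar>g x - g y\<bar> \<le> 2 * s * 1"
      using abs_le_sup_norm_on[OF bd(1) xy(1)] abs_le_sup_norm_on[OF bd(1) xy(2)] by (simp add: s_def)
    also have "\<dots> \<le> 2 * (s + q) * sqrt (dist x y)" using s q 3 by (intro mult_mono) auto
    finally show ?thesis unfolding H .
  qed auto
qed

text \<open>
  From here on the step is an abstract family of maps \<open>\<psi> z\<close> of a random variable with law \<open>\<mu>\<close>; what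
  matters about it is summarized in \<open>steerable_at\<close> and in a Lipschitz condition.
\<close>

locale noisy_step = prob_space \<mu>
  for \<mu> :: "'e::{real_normed_vector, second_countable_topology} measure" +
  fixes Q :: "'e set" and \<psi> :: "'z::metric_space \<Rightarrow> 'e \<Rightarrow> 'y::metric_space"
    and X :: "'z set" and Y :: "'y set"
  assumes sets_\<mu>[measurable_cong, simp]: "sets \<mu> = sets borel"
    and Q_compact: "compact Q" and Q_full: "measure \<mu> Q = 1"
    and \<psi>_cont: "\<And>z. continuous_on UNIV (\<psi> z)"
    and \<psi>_in: "\<And>z e. z \<in> X \<Longrightarrow> e \<in> Q \<Longrightarrow> \<psi> z e \<in> Y"
begin

abbreviation test_functions :: "('y \<Rightarrow> real) set" where
  "test_functions \<equiv> holder_space (1/2) Y"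

abbreviation snorm :: "('y \<Rightarrow> real) \<Rightarrow> real" where "snorm \<equiv> sup_norm_on Y"

abbreviation hnorm :: "('y \<Rightarrow> real) \<Rightarrow> real" where "hnorm \<equiv> holder_norm (1/2) Y"

text \<open>
  A test function says nothing outside \<open>Y\<close>, and \<open>\<psi> z e\<close> may leave \<open>Y\<close> for \<open>e\<close> outside \<open>Q\<close>, in
  particular after a shift of the noise; there the pullback is set to 0.
\<close>

definition pullback :: "('y \<Rightarrow> real) \<Rightarrow> 'z \<Rightarrow> 'e \<Rightarrow> real" where
  "pullback g z e = indicator Q e * g (\<psi> z e)"

abbreviation mean :: "('y \<Rightarrow> real) \<Rightarrow> 'z \<Rightarrow> real" where
  "mean g z \<equiv> \<integral>e. pullback g z e \<partial>\<mu>"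

lemma Q_borel [measurable]: "Q \<in> sets borel"
  using Q_compact by (simp add: compact_imp_closed)

lemma space_\<mu> [simp]: "space \<mu> = UNIV"
  using sets_eq_imp_space_eq[OF sets_\<mu>] by simp

lemma AE_Q: "AE e in \<mu>. e \<in> Q"
  using Q_full prob_eq_1[of Q] Q_borel by simp

lemma snorm_nonneg: "g \<in> test_functions \<Longrightarrow> snorm g \<ge> 0"
  by (rule sup_norm_on_nonneg) (simp add: holder_space_def)

lemma hnorm_nonneg: "g \<in> test_functions \<Longrightarrow> hnorm g \<ge> 0"
  unfolding holder_norm_def using snorm_nonneg
  by (intro add_nonneg_nonneg cSup_upper) (auto simp: holder_space_def)

lemma pullback_bound: "g \<in> test_functions \<Longrightarrow> z \<in> X \<Longrightarrow> \<bar>pullback g z e\<bar> \<le> snorm g"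
  using abs_le_sup_norm_on[of g Y "\<psi> z e"] snorm_nonneg[of g] \<psi>_in[of z e]
  by (auto simp: pullback_def holder_space_def split: split_indicator)

lemma pullback_measurable:
  assumes "g \<in> test_functions" "z \<in> X"
  shows "pullback g z \<in> borel_measurable borel"
proof -
  have "continuous_on Q (\<lambda>e. g (\<psi> z e))"
    using assms \<psi>_in by (intro continuous_on_compose2[of Y g Q "\<psi> z"] continuous_on_subset[OF \<psi>_cont])
      (auto simp: holder_space_def)
  then have "(\<lambda>e. indicator Q e *\<^sub>R g (\<psi> z e)) \<in> borel_measurable borel"
    by (intro borel_measurable_continuous_on_indicator) simp_all
  then show ?thesis by (simp add: pullback_def[abs_def])
qed

lemma integrable_bounded:
  fixes f :: "'e \<Rightarrow> real"
  assumes "f \<in> borel_measurable borel" "\<And>e. \<bar>f e\<bar> \<le> B"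
  shows "integrable \<mu> f"
  using assms by (intro integrable_const_bound[where B = B]) auto

text \<open>
  The estimate of the theorem localized by a weight \<open>w\<close> on the noise. Only the Hoelder part carries
  the integral of \<open>w\<close>: it has to add up to a small total over many weights, whereas the constants \<open>C\<close>
  may grow with their number.
\<close>

definition weighted_estimate_on :: "'z set \<Rightarrow> real \<Rightarrow> real \<Rightarrow> ('e \<Rightarrow> real) \<Rightarrow> bool" where
  "weighted_estimate_on U C c w \<longleftrightarrow> (\<forall>g\<in>test_functions. \<forall>z1\<in>U. \<forall>z2\<in>U.
     \<bar>\<integral>e. w e * (pullback g z1 e - pullback g z2 e) \<partial>\<mu>\<bar>
       \<le> (C * snorm g + c * hnorm g * (\<integral>e. w e \<partial>\<mu>)) * sqrt (dist z1 z2))"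

definition insensitive_on :: "'z \<Rightarrow> real \<Rightarrow> ('e \<Rightarrow> real) \<Rightarrow> bool" where
  "insensitive_on z0 c w \<longleftrightarrow> (\<exists>C\<ge>0. \<exists>r>0. weighted_estimate_on (X \<inter> ball z0 r) C c w)"

definition holder_estimate_on :: "'z set \<Rightarrow> real \<Rightarrow> real \<Rightarrow> bool" where
  "holder_estimate_on U C c \<longleftrightarrow> (\<forall>g\<in>test_functions. \<forall>z1\<in>U. \<forall>z2\<in>U.
     \<bar>mean g z1 - mean g z2\<bar> \<le> (C * snorm g + c * hnorm g) * sqrt (dist z1 z2))"

definition cutoff :: "real \<Rightarrow> ('e \<Rightarrow> real) \<Rightarrow> bool" where
  "cutoff L w \<longleftrightarrow> L-lipschitz_on UNIV w \<and> (\<forall>e. 0 \<le> w e \<and> w e \<le> 1)"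

lemma cutoff_measurable: "cutoff L w \<Longrightarrow> w \<in> borel_measurable borel"
  by (auto simp: cutoff_def intro: borel_measurable_continuous_onI lipschitz_on_continuous_on)

text \<open>
  Near \<open>z0\<close>, a shift \<open>v\<close> of the noise that nearly preserves its law brings the images of two points
  together up to the factor \<open>\<delta>\<close>; the shift is the same for all noise values in the ball around \<open>e0\<close>.
\<close>

definition steerable_at :: "'z \<Rightarrow> real \<Rightarrow> 'e \<Rightarrow> real \<Rightarrow> bool" where
  "steerable_at z0 \<delta> e0 r \<longleftrightarrow> r > 0 \<and> (\<exists>C\<ge>0. \<forall>z1\<in>ball z0 r. \<forall>z2\<in>ball z0 r. \<exists>v.
     norm v \<le> C * dist z1 z2 \<and> translation_bound \<mu> (C * dist z1 z2) v \<and>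
     (\<forall>e\<in>ball e0 r. dist (\<psi> z1 e) (\<psi> z2 (e + v)) \<le> \<delta> * dist z1 z2))"

text \<open>
  The difference of the two integrals splits into three parts. Steering compares \<open>z1\<close> at \<open>e\<close> with \<open>z2\<close>
  at \<open>e + v\<close>, and this is the only place where the Hoelder norm enters. Then the weight is moved from
  \<open>e\<close> to \<open>e + v\<close>, which costs its Lipschitz constant times the norm of \<open>v\<close>. Finally the shift is undone
  by the near invariance of the law. Near invariance also bounds the probability that the shifted
  noise leaves \<open>Q\<close>.
\<close>

lemma insensitive_near_steerable:
  assumes st: "steerable_at z0 \<delta> e0 r" and \<delta>: "\<delta> > 0"
    and w: "cutoff L w" "\<And>e. e \<notin> ball e0 r \<Longrightarrow> w e = 0"
  shows "insensitive_on z0 (2 * sqrt \<delta>) w"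
proof -
  obtain C where r: "r > 0" and C: "C \<ge> 0" and steer: "\<And>z1 z2. z1 \<in> ball z0 r \<Longrightarrow> z2 \<in> ball z0 r \<Longrightarrow> \<exists>v.
     norm v \<le> C * dist z1 z2 \<and> translation_bound \<mu> (C * dist z1 z2) v \<and>
     (\<forall>e\<in>ball e0 r. dist (\<psi> z1 e) (\<psi> z2 (e + v)) \<le> \<delta> * dist z1 z2)"
    using st unfolding steerable_at_def by blast
  have wm[measurable]: "w \<in> borel_measurable borel" by (rule cutoff_measurable[OF w(1)])
  have lip: "L-lipschitz_on UNIV w" and w01: "\<And>e. 0 \<le> w e" "\<And>e. w e \<le> 1"
    using w(1) by (auto simp: cutoff_def)
  have L: "L \<ge> 0" by (rule lipschitz_on_nonneg[OF lip])
  \<comment> \<open>distances at most 1 are needed to replace \<open>dist z1 z2\<close> by its square root\<close>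
  define r' where "r' = min r (1/2)"
  have "\<bar>\<integral>e. w e * (pullback g z1 e - pullback g z2 e) \<partial>\<mu>\<bar>
       \<le> ((2 * C + L * C) * snorm g + 2 * sqrt \<delta> * hnorm g * (\<integral>e. w e \<partial>\<mu>)) * sqrt (dist z1 z2)"
    if g: "g \<in> test_functions" and z: "z1 \<in> X \<inter> ball z0 r'" "z2 \<in> X \<inter> ball z0 r'" for g z1 z2
  proof -
    define d where "d = dist z1 z2"
    have "d \<le> 1" using z dist_triangle2[of z1 z2 z0] by (simp add: d_def r'_def dist_commute)
    then have d: "0 \<le> d" "d \<le> sqrt d" by (auto simp: d_def intro: real_le_rsqrt simp: power2_eq_square mult_left_le)
    have zr: "z1 \<in> ball z0 r" "z2 \<in> ball z0 r" "z1 \<in> X" "z2 \<in> X" using z by (auto simp: r'_def)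
    obtain v where v: "norm v \<le> C * d" "translation_bound \<mu> (C * d) v" "\<And>e. e \<in> ball e0 r \<Longrightarrow> dist (\<psi> z1 e) (\<psi> z2 (e + v)) \<le> \<delta> * d"
      using steer[OF zr(1,2)] unfolding d_def by blast
    note tr = v(2)[unfolded translation_bound_def, rule_format]
    let ?h1 = "pullback g z1" and ?h2 = "pullback g z2"
    note [measurable] = pullback_measurable[OF g zr(3)] pullback_measurable[OF g zr(4)]
    define s where "s = snorm g"
    have s: "s \<ge> 0" unfolding s_def by (rule snorm_nonneg[OF g])
    have h1: "\<bar>?h1 e\<bar> \<le> s" and h2: "\<bar>?h2 e\<bar> \<le> s" for e
      unfolding s_def by (rule pullback_bound[OF g zr(3)], rule pullback_bound[OF g zr(4)])
    have prod: "\<bar>w e * x\<bar> \<le> s" if "\<bar>x\<bar> \<le> s" for e x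
      using mult_mono[of "w e" 1 "\<bar>x\<bar>" s] that w01[of e] by (simp add: abs_mult)
    have i1: "integrable \<mu> (\<lambda>e. w e * ?h1 e)" and i2: "integrable \<mu> (\<lambda>e. w e * ?h2 e)"
      and i3: "integrable \<mu> (\<lambda>e. w e * ?h2 (e + v))" and i4: "integrable \<mu> (\<lambda>e. w (e + v) * ?h2 (e + v))"
      using prod[OF h1] prod[OF h2] by (auto intro!: integrable_bounded[where B = s])
    have iw: "integrable \<mu> w" using w01 by (intro integrable_bounded[where B = 1]) auto
    have iQ: "integrable \<mu> (\<lambda>e. indicator (- Q) (e + v) :: real)"
      by (intro integrable_bounded[where B = 1]) (auto split: split_indicator)
    \<comment> \<open>the unshifted noise is almost surely in \<open>Q\<close>, so the shifted one rarely leaves it\<close>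
    have escape: "(\<integral>e. indicator (- Q) (e + v) \<partial>\<mu>) \<le> C * d"
    proof -
      have "(\<integral>e. indicator (- Q) e \<partial>\<mu>) = (\<integral>e. (0::real) \<partial>\<mu>)"
        using AE_Q by (intro integral_cong_AE) (auto elim!: eventually_mono)
      moreover have "\<bar>(\<integral>e. indicator (- Q) (e + v) \<partial>\<mu>) - (\<integral>e. indicator (- Q) e \<partial>\<mu>)\<bar> \<le> C * d * 1"
        by (rule tr) (auto split: split_indicator)
      ultimately show ?thesis by simp
    qed
    have "\<bar>(\<integral>e. w e * ?h1 e \<partial>\<mu>) - (\<integral>e. w e * ?h2 (e + v) \<partial>\<mu>)\<bar>
      = \<bar>\<integral>e. w e * ?h1 e - w e * ?h2 (e + v) \<partial>\<mu>\<bar>"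
      by (simp only: Bochner_Integration.integral_diff[OF i1 i3])
    also have "\<dots> \<le> (\<integral>e. \<bar>w e * ?h1 e - w e * ?h2 (e + v)\<bar> \<partial>\<mu>)" by (rule integral_abs_bound)
    also have "\<dots> \<le> (\<integral>e. 2 * hnorm g * sqrt (\<delta> * d) * w e + s * indicator (- Q) (e + v) \<partial>\<mu>)"
    proof (rule integral_mono_AE)
      show "integrable \<mu> (\<lambda>e. \<bar>w e * ?h1 e - w e * ?h2 (e + v)\<bar>)" using i1 i3 by simp
      show "integrable \<mu> (\<lambda>e. 2 * hnorm g * sqrt (\<delta> * d) * w e + s * indicator (- Q) (e + v))"
        using iw iQ by simp
      show "AE e in \<mu>. \<bar>w e * ?h1 e - w e * ?h2 (e + v)\<bar>
          \<le> 2 * hnorm g * sqrt (\<delta> * d) * w e + s * indicator (- Q) (e + v)"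
        using AE_Q
      proof eventually_elim
        case (elim e)
        show ?case
        proof (cases "e + v \<in> Q")
          case True
          show ?thesis
          proof (cases "e \<in> ball e0 r")
            case e: True
            have "\<bar>g (\<psi> z1 e) - g (\<psi> z2 (e + v))\<bar> \<le> 2 * hnorm g * sqrt (dist (\<psi> z1 e) (\<psi> z2 (e + v)))"
              using True elim zr by (intro holder_space_oscillation[OF g] \<psi>_in)
            also have "\<dots> \<le> 2 * hnorm g * sqrt (\<delta> * d)"
              using v(3)[OF e] hnorm_nonneg[OF g] by (intro mult_left_mono) auto
            finally have "w e * \<bar>g (\<psi> z1 e) - g (\<psi> z2 (e + v))\<bar> \<le> w e * (2 * hnorm g * sqrt (\<delta> * d))"
              using w01 by (intro mult_left_mono)
            then show ?thesis using True elim w01[of e]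
              by (simp add: pullback_def abs_mult mult.commute flip: right_diff_distrib)
          qed (use True w(2) in simp)
        next
          case False
          then have "\<bar>w e * ?h1 e - w e * ?h2 (e + v)\<bar> \<le> s"
            using prod[OF h1, of e e] by (simp add: pullback_def)
          moreover have "0 \<le> 2 * hnorm g * sqrt (\<delta> * d) * w e"
            using hnorm_nonneg[OF g] w01 d \<delta> by simp
          moreover have "indicator (- Q) (e + v) = (1::real)" using False by simp
          ultimately show ?thesis by (simp only: mult_1_right)
        qed
      qed
    qed
    also have "\<dots> = 2 * hnorm g * sqrt (\<delta> * d) * (\<integral>e. w e \<partial>\<mu>) + s * (\<integral>e. indicator (- Q) (e + v) \<partial>\<mu>)"
      using iw iQ by simp
    also have "\<dots> \<le> 2 * hnorm g * sqrt (\<delta> * d) * (\<integral>e. w e \<partial>\<mu>) + s * (C * d)"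
      using escape s by (intro add_left_mono mult_left_mono)
    finally have p1: "\<bar>(\<integral>e. w e * ?h1 e \<partial>\<mu>) - (\<integral>e. w e * ?h2 (e + v) \<partial>\<mu>)\<bar>
      \<le> 2 * hnorm g * sqrt (\<delta> * d) * (\<integral>e. w e \<partial>\<mu>) + s * (C * d)" .
    have "\<bar>(\<integral>e. w e * ?h2 (e + v) \<partial>\<mu>) - (\<integral>e. w (e + v) * ?h2 (e + v) \<partial>\<mu>)\<bar>
      = \<bar>\<integral>e. w e * ?h2 (e + v) - w (e + v) * ?h2 (e + v) \<partial>\<mu>\<bar>"
      by (simp only: Bochner_Integration.integral_diff[OF i3 i4])
    also have "\<dots> \<le> (\<integral>e. \<bar>w e * ?h2 (e + v) - w (e + v) * ?h2 (e + v)\<bar> \<partial>\<mu>)" by (rule integral_abs_bound)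
    also have "\<dots> \<le> (\<integral>e. L * (C * d) * s \<partial>\<mu>)"
    proof (rule integral_mono)
      show "integrable \<mu> (\<lambda>e. \<bar>w e * ?h2 (e + v) - w (e + v) * ?h2 (e + v)\<bar>)" using i3 i4 by simp
      show "\<bar>w e * ?h2 (e + v) - w (e + v) * ?h2 (e + v)\<bar> \<le> L * (C * d) * s" for e
      proof -
        have "\<bar>w e - w (e + v)\<bar> \<le> L * norm v"
          using lipschitz_onD[OF lip, of e "e + v"] by (simp add: dist_norm)
        also have "\<dots> \<le> L * (C * d)" using v(1) L by (rule mult_left_mono)
        finally have "\<bar>w e - w (e + v)\<bar> * \<bar>?h2 (e + v)\<bar> \<le> L * (C * d) * s"
          using h2 L C d by (intro mult_mono) auto
        then show ?thesis by (simp add: abs_mult flip: left_diff_distrib)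
      qed
    qed simp
    also have "\<dots> = L * (C * d) * s" using prob_space by simp
    finally have p2: "\<bar>(\<integral>e. w e * ?h2 (e + v) \<partial>\<mu>) - (\<integral>e. w (e + v) * ?h2 (e + v) \<partial>\<mu>)\<bar> \<le> L * (C * d) * s" .
    have p3: "\<bar>(\<integral>e. w (e + v) * ?h2 (e + v) \<partial>\<mu>) - (\<integral>e. w e * ?h2 e \<partial>\<mu>)\<bar> \<le> C * d * s"
      using prod[OF h2] by (intro tr[of "\<lambda>e. w e * ?h2 e" s]) auto
    have "(\<integral>e. w e * (?h1 e - ?h2 e) \<partial>\<mu>) = (\<integral>e. w e * ?h1 e \<partial>\<mu>) - (\<integral>e. w e * ?h2 e \<partial>\<mu>)"
      unfolding right_diff_distrib by (rule Bochner_Integration.integral_diff[OF i1 i2])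
    then have "\<bar>\<integral>e. w e * (?h1 e - ?h2 e) \<partial>\<mu>\<bar>
      \<le> 2 * hnorm g * sqrt (\<delta> * d) * (\<integral>e. w e \<partial>\<mu>) + s * (C * d) + L * (C * d) * s + C * d * s"
      using p1 p2 p3 by linarith
    also have "\<dots> = (2 * C + L * C) * s * d + 2 * hnorm g * sqrt (\<delta> * d) * (\<integral>e. w e \<partial>\<mu>)"
      by (simp add: algebra_simps)
    also have "\<dots> \<le> (2 * C + L * C) * s * sqrt d + 2 * hnorm g * sqrt (\<delta> * d) * (\<integral>e. w e \<partial>\<mu>)"
      using d C L s by (intro add_right_mono mult_left_mono) auto
    also have "\<dots> = ((2 * C + L * C) * snorm g + 2 * sqrt \<delta> * hnorm g * (\<integral>e. w e \<partial>\<mu>)) * sqrt d"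
      by (simp add: real_sqrt_mult s_def algebra_simps)
    finally show ?thesis unfolding d_def .
  qed
  moreover have "2 * C + L * C \<ge> 0" "r' > 0" using C L r by (auto simp: r'_def)
  ultimately show ?thesis unfolding insensitive_on_def weighted_estimate_on_def by blast
qed

lemma insensitive_on_add:
  assumes "insensitive_on z0 c w1" "insensitive_on z0 c w2"
    and w1: "w1 \<in> borel_measurable borel" "\<And>e. \<bar>w1 e\<bar> \<le> 1"
    and w2: "w2 \<in> borel_measurable borel" "\<And>e. \<bar>w2 e\<bar> \<le> 1"
  shows "insensitive_on z0 c (\<lambda>e. w1 e + w2 e)"
proof -
  obtain C1 r1 where 1: "C1 \<ge> 0" "r1 > 0" "weighted_estimate_on (X \<inter> ball z0 r1) C1 c w1"
    using assms(1) unfolding insensitive_on_def by blast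
  obtain C2 r2 where 2: "C2 \<ge> 0" "r2 > 0" "weighted_estimate_on (X \<inter> ball z0 r2) C2 c w2"
    using assms(2) unfolding insensitive_on_def by blast
  have i: "integrable \<mu> w1" "integrable \<mu> w2" using w1 w2 by (auto intro: integrable_bounded[where B = 1])
  have "\<bar>\<integral>e. (w1 e + w2 e) * (pullback g z1 e - pullback g z2 e) \<partial>\<mu>\<bar>
       \<le> ((C1 + C2) * snorm g + c * hnorm g * (\<integral>e. w1 e + w2 e \<partial>\<mu>)) * sqrt (dist z1 z2)"
    if g: "g \<in> test_functions" and z: "z1 \<in> X \<inter> ball z0 (min r1 r2)" "z2 \<in> X \<inter> ball z0 (min r1 r2)" for g z1 z2
  proof -
    note [measurable] = w1(1) w2(1) pullback_measurable[OF g, of z1] pullback_measurable[OF g, of z2]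
    have zX: "z1 \<in> X" "z2 \<in> X" using z by auto
    have b: "\<bar>pullback g z1 e - pullback g z2 e\<bar> \<le> 2 * snorm g" for e
      using pullback_bound[OF g zX(1), of e] pullback_bound[OF g zX(2), of e] by linarith
    have "\<bar>w1 e * (pullback g z1 e - pullback g z2 e)\<bar> \<le> 1 * (2 * snorm g)"
      "\<bar>w2 e * (pullback g z1 e - pullback g z2 e)\<bar> \<le> 1 * (2 * snorm g)" for e
      unfolding abs_mult using w1(2) w2(2) b by (intro mult_mono; simp)+
    then have j: "integrable \<mu> (\<lambda>e. w1 e * (pullback g z1 e - pullback g z2 e))"
      "integrable \<mu> (\<lambda>e. w2 e * (pullback g z1 e - pullback g z2 e))"
      using zX by (auto intro!: integrable_bounded)
    have "(\<integral>e. (w1 e + w2 e) * (pullback g z1 e - pullback g z2 e) \<partial>\<mu>) =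
      (\<integral>e. w1 e * (pullback g z1 e - pullback g z2 e) \<partial>\<mu>) + (\<integral>e. w2 e * (pullback g z1 e - pullback g z2 e) \<partial>\<mu>)"
      unfolding distrib_right by (rule Bochner_Integration.integral_add[OF j])
    moreover have "(\<integral>e. w1 e + w2 e \<partial>\<mu>) = (\<integral>e. w1 e \<partial>\<mu>) + (\<integral>e. w2 e \<partial>\<mu>)"
      by (rule Bochner_Integration.integral_add[OF i])
    ultimately show ?thesis
      using 1(3)[unfolded weighted_estimate_on_def, rule_format, OF g, of z1 z2]
        2(3)[unfolded weighted_estimate_on_def, rule_format, OF g, of z1 z2] z by (simp add: algebra_simps abs_le_iff)
  qed
  moreover have "C1 + C2 \<ge> 0" "min r1 r2 > 0" using 1 2 by auto
  ultimately show ?thesis unfolding insensitive_on_def weighted_estimate_on_def by blast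
qed

lemma ball_cutoff:
  assumes "r > 0"
  obtains L \<beta> where "cutoff L \<beta>" "\<And>e. e \<in> ball e0 (r / 2) \<Longrightarrow> \<beta> e = 1" "\<And>e. e \<notin> ball e0 r \<Longrightarrow> \<beta> e = 0"
proof (rule that[of "2 / r" "\<lambda>e. max 0 (min 1 (2 - 2 / r * dist e0 e))"])
  show "cutoff (2 / r) (\<lambda>e. max 0 (min 1 (2 - 2 / r * dist e0 e)))"
    unfolding cutoff_def
  proof (intro conjI lipschitz_onI)
    fix x y :: 'e
    have "\<bar>2 / r * dist e0 x - 2 / r * dist e0 y\<bar> = 2 / r * \<bar>dist e0 x - dist e0 y\<bar>"
      unfolding right_diff_distrib[symmetric] abs_mult using assms by simp
    also have "\<dots> \<le> 2 / r * dist x y"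
      using assms dist_triangle[of e0 x y] dist_triangle[of e0 y x]
      by (intro mult_left_mono) (auto simp: dist_commute abs_le_iff)
    finally show "dist (max 0 (min 1 (2 - 2 / r * dist e0 x))) (max 0 (min 1 (2 - 2 / r * dist e0 y))) \<le> 2 / r * dist x y"
      unfolding dist_real_def by linarith
  qed (use assms in auto)
  show "max 0 (min 1 (2 - 2 / r * dist e0 e)) = 1" if "e \<in> ball e0 (r / 2)" for e
    using that assms by (simp add: field_simps)
  show "max 0 (min 1 (2 - 2 / r * dist e0 e)) = 0" if "e \<notin> ball e0 r" for e
  proof -
    have "2 / r * dist e0 e \<ge> 2 / r * r" using that assms by (intro mult_left_mono) auto
    then show ?thesis using assms by simp
  qed
qed

lemma cutoff_mult:
  assumes "cutoff L f" "cutoff L' f'"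
  shows "cutoff (L + L') (\<lambda>e. f e * f' e)"
  unfolding cutoff_def
proof (intro conjI lipschitz_onI allI)
  have f: "L-lipschitz_on UNIV f" "\<And>e. 0 \<le> f e" "\<And>e. f e \<le> 1"
    and f': "L'-lipschitz_on UNIV f'" "\<And>e. 0 \<le> f' e" "\<And>e. f' e \<le> 1"
    using assms by (auto simp: cutoff_def)
  show "0 \<le> L + L'" using lipschitz_on_nonneg[OF f(1)] lipschitz_on_nonneg[OF f'(1)] by simp
  show "0 \<le> f e * f' e" "f e * f' e \<le> 1" for e
    using f f' by (simp_all add: mult_le_one)
  fix x y
  have "f x * f' x - f y * f' y = f x * (f' x - f' y) + (f x - f y) * f' y" by (simp add: algebra_simps)
  then have "\<bar>f x * f' x - f y * f' y\<bar> \<le> \<bar>f x * (f' x - f' y)\<bar> + \<bar>(f x - f y) * f' y\<bar>"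
    by (simp only: abs_triangle_ineq)
  also have "\<dots> \<le> 1 * \<bar>f' x - f' y\<bar> + \<bar>f x - f y\<bar> * 1"
    unfolding abs_mult using f f' by (intro add_mono mult_mono) auto
  also have "\<dots> \<le> (L + L') * dist x y"
    using lipschitz_onD[OF f(1), of x y] lipschitz_onD[OF f'(1), of x y] by (simp add: dist_real_def algebra_simps)
  finally show "dist (f x * f' x) (f y * f' y) \<le> (L + L') * dist x y" by (simp add: dist_real_def)
qed

lemma cutoff_complement: "cutoff L f \<Longrightarrow> cutoff L (\<lambda>e. 1 - f e)"
  unfolding cutoff_def lipschitz_on_def by (auto simp: dist_real_def abs_minus_commute)

text \<open>
  A partition of unity built one ball at a time: multiplying the remaining weight \<open>f\<close> by \<open>1 - \<beta>\<close>, with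
  \<open>\<beta>\<close> a cutoff function of the next ball, moves the weight \<open>f * \<beta>\<close> from \<open>f\<close> to \<open>1 - f\<close>.
\<close>

lemma insensitive_near_finitely_many:
  assumes "finite N" and \<delta>: "\<delta> > 0" and "\<And>e. e \<in> N \<Longrightarrow> steerable_at z0 \<delta> e (\<rho> e)"
  shows "\<exists>L f. cutoff L f \<and> (\<forall>e\<in>N. \<forall>x\<in>ball e (\<rho> e / 2). f x = 0) \<and> insensitive_on z0 (2 * sqrt \<delta>) (\<lambda>x. 1 - f x)"
  using assms(1,3)
proof (induction N rule: finite_induct)
  case empty
  have "insensitive_on z0 (2 * sqrt \<delta>) (\<lambda>x. 1 - 1)"
    unfolding insensitive_on_def weighted_estimate_on_def
    by (rule exI[of _ 0], simp, rule exI[of _ 1], simp)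
  moreover have "cutoff 0 (\<lambda>x. 1)" by (simp add: cutoff_def lipschitz_on_def)
  ultimately show ?case by (intro exI[of _ 0] exI[of _ "\<lambda>x. 1"]) simp
next
  case (insert a N)
  then obtain L f where f: "cutoff L f" "\<And>e x. e \<in> N \<Longrightarrow> x \<in> ball e (\<rho> e / 2) \<Longrightarrow> f x = 0"
    "insensitive_on z0 (2 * sqrt \<delta>) (\<lambda>x. 1 - f x)" by blast
  have st: "steerable_at z0 \<delta> a (\<rho> a)" using insert by simp
  then have "\<rho> a > 0" by (simp add: steerable_at_def)
  then obtain L' \<beta> where \<beta>: "cutoff L' \<beta>" "\<And>e. e \<in> ball a (\<rho> a / 2) \<Longrightarrow> \<beta> e = 1" "\<And>e. e \<notin> ball a (\<rho> a) \<Longrightarrow> \<beta> e = 0"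
    using ball_cutoff[of "\<rho> a" a] by blast
  have f\<beta>: "cutoff (L + L') (\<lambda>x. f x * \<beta> x)" by (rule cutoff_mult[OF f(1) \<beta>(1)])
  have new: "cutoff (L + L') (\<lambda>x. f x * (1 - \<beta> x))" by (rule cutoff_mult[OF f(1) cutoff_complement[OF \<beta>(1)]])
  have "insensitive_on z0 (2 * sqrt \<delta>) (\<lambda>x. f x * \<beta> x)"
    using \<beta>(3) by (intro insensitive_near_steerable[OF st \<delta> f\<beta>]) auto
  then have "insensitive_on z0 (2 * sqrt \<delta>) (\<lambda>x. (1 - f x) + f x * \<beta> x)"
    using f(1) f\<beta> cutoff_complement[OF f(1)] cutoff_measurable
    by (intro insensitive_on_add[OF f(3)]) (auto simp: cutoff_def)
  moreover have "(\<lambda>x. (1 - f x) + f x * \<beta> x) = (\<lambda>x. 1 - f x * (1 - \<beta> x))" by (auto simp: algebra_simps)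
  ultimately have "insensitive_on z0 (2 * sqrt \<delta>) (\<lambda>x. 1 - f x * (1 - \<beta> x))" by simp
  moreover have "\<forall>e\<in>insert a N. \<forall>x\<in>ball e (\<rho> e / 2). f x * (1 - \<beta> x) = 0"
    using f(2) \<beta>(2) by auto
  ultimately show ?case using new by blast
qed

text \<open>
  By the Lindelof property countably many of the balls cover \<open>G\<close>; continuity of the measure leaves
  finitely many.
\<close>

lemma finitely_many_balls_almost_cover:
  assumes G: "measure \<mu> G = 1" and \<rho>: "\<And>e. e \<in> G \<Longrightarrow> \<rho> e > 0" and \<epsilon>: "\<epsilon> > 0"
  obtains N where "finite N" "N \<subseteq> G" "measure \<mu> (- (\<Union>e\<in>N. ball e (\<rho> e))) < \<epsilon>"
proof -
  obtain \<F> where \<F>: "\<F> \<subseteq> (\<lambda>e. ball e (\<rho> e)) ` G" "countable \<F>" "\<Union>\<F> = (\<Union>e\<in>G. ball e (\<rho> e))"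
    by (rule Lindelof[of "(\<lambda>e. ball e (\<rho> e)) ` G"]) auto
  obtain D where D: "D \<subseteq> G" "countable D" "\<F> = (\<lambda>e. ball e (\<rho> e)) ` D"
    using countable_subset_image[of \<F>] \<F>(1,2) by metis
  define U where "U n = (\<Union>e\<in>from_nat_into D ` {..n}. ball e (\<rho> e))" for n
  have Gcov: "G \<subseteq> (\<Union>e\<in>D. ball e (\<rho> e))"
    using \<F>(3) D(3) \<rho> by force
  have "G \<noteq> {}" using G by auto
  then have "D \<noteq> {}" using Gcov by auto
  then have UD: "(\<Union>n. U n) = (\<Union>e\<in>D. ball e (\<rho> e))"
  proof -
    have "(\<Union>n. from_nat_into D ` {..n}) = from_nat_into D ` (\<Union>n. {..n})" by (simp add: image_UN)
    also have "\<dots> = D" using range_from_nat_into[OF \<open>D \<noteq> {}\<close> D(2)] by (simp add: UN_atMost_UNIV)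
    finally show ?thesis unfolding U_def by blast
  qed
  have open_U: "open (U n)" for n by (auto simp: U_def)
  have "(\<lambda>n. measure \<mu> (U n)) \<longlonglongrightarrow> measure \<mu> (\<Union>n. U n)"
  proof (rule finite_Lim_measure_incseq)
    show "range U \<subseteq> sets \<mu>" using open_U by auto
    show "incseq U" unfolding incseq_def U_def by (auto, meson atMost_iff order_trans)
  qed
  moreover have "measure \<mu> (\<Union>n. U n) = 1"
  proof -
    have "measure \<mu> G \<le> measure \<mu> (\<Union>n. U n)"
      using Gcov open_U unfolding UD[symmetric] by (intro finite_measure_mono) auto
    then show ?thesis using G prob_le_1[of "\<Union>n. U n"] by linarith
  qed
  ultimately have "\<forall>\<^sub>F n in sequentially. measure \<mu> (U n) > 1 - \<epsilon>"
    using \<epsilon> by (auto simp: order_tendsto_iff)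
  then obtain n where n: "measure \<mu> (U n) > 1 - \<epsilon>" by (metis eventually_sequentially order_refl)
  have "measure \<mu> (- U n) = 1 - measure \<mu> (U n)"
    using prob_compl[of "U n"] open_U by (simp add: Compl_eq_Diff_UNIV)
  then have m: "measure \<mu> (- U n) < \<epsilon>" using n by simp
  have "from_nat_into D ` {..n} \<subseteq> G" using from_nat_into[OF \<open>D \<noteq> {}\<close>] D(1) by blast
  then show ?thesis using that[of "from_nat_into D ` {..n}"] m by (simp add: U_def)
qed

text \<open>
  The constant \<open>c\<close> is split in halves: \<open>\<delta>\<close> is chosen for the steered part and \<open>\<epsilon>\<close>, depending on the
  Lipschitz constant, for the set missed by the balls.
\<close>

lemma local_estimate:
  assumes lip: "r0 > 0" "L > 0" "\<And>z1 z2 e. z1 \<in> ball z0 r0 \<Longrightarrow> z2 \<in> ball z0 r0 \<Longrightarrow> e \<in> Q \<Longrightarrow>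
      dist (\<psi> z1 e) (\<psi> z2 e) \<le> L * dist z1 z2"
    and G: "measure \<mu> G = 1" and steer: "\<And>e \<delta>. e \<in> G \<Longrightarrow> \<delta> > 0 \<Longrightarrow> \<exists>r. steerable_at z0 \<delta> e r"
    and c: "c > 0"
  shows "\<exists>C\<ge>0. \<exists>r>0. holder_estimate_on (X \<inter> ball z0 r) C c"
proof -
  define \<delta> where "\<delta> = (c / 4)\<^sup>2"
  have \<delta>: "\<delta> > 0" "2 * sqrt \<delta> = c / 2" using c by (auto simp: \<delta>_def)
  define \<epsilon> where "\<epsilon> = c / (4 * sqrt L)"
  have \<epsilon>: "\<epsilon> > 0" "2 * sqrt L * \<epsilon> = c / 2" using c lip(2) by (auto simp: \<epsilon>_def)
  have "\<forall>e\<in>G. \<exists>r. steerable_at z0 \<delta> e r" using steer \<delta>(1) by blast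
  from bchoice[OF this] obtain \<rho> where \<rho>: "\<And>e. e \<in> G \<Longrightarrow> steerable_at z0 \<delta> e (\<rho> e)" by blast
  then have \<rho>0: "\<And>e. e \<in> G \<Longrightarrow> \<rho> e / 2 > 0" by (simp add: steerable_at_def)
  obtain N where N: "finite N" "N \<subseteq> G" "measure \<mu> (- (\<Union>e\<in>N. ball e (\<rho> e / 2))) < \<epsilon>"
    by (rule finitely_many_balls_almost_cover[OF G \<rho>0 \<epsilon>(1)])
  have "\<And>e. e \<in> N \<Longrightarrow> steerable_at z0 \<delta> e (\<rho> e)" using \<rho> N(2) by auto
  from insensitive_near_finitely_many[OF N(1) \<delta>(1) this]
  obtain L' f where f: "cutoff L' f" "\<And>e x. e \<in> N \<Longrightarrow> x \<in> ball e (\<rho> e / 2) \<Longrightarrow> f x = 0"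
    "insensitive_on z0 (2 * sqrt \<delta>) (\<lambda>x. 1 - f x)" by blast
  obtain C r where C: "C \<ge> 0" "r > 0" "weighted_estimate_on (X \<inter> ball z0 r) C (2 * sqrt \<delta>) (\<lambda>x. 1 - f x)"
    using f(3) unfolding insensitive_on_def by blast
  have fm[measurable]: "f \<in> borel_measurable borel" by (rule cutoff_measurable[OF f(1)])
  have f01: "0 \<le> f e" "f e \<le> 1" for e using f(1) by (auto simp: cutoff_def)
  define U where "U = - (\<Union>e\<in>N. ball e (\<rho> e / 2))"
  have U_meas: "measure \<mu> U < \<epsilon>" using N(3) by (simp add: U_def)
  have "closed U" unfolding U_def by (intro closed_Compl open_UN) auto
  then have Um[measurable]: "U \<in> sets borel" by simp
  have fU: "f e \<le> indicator U e" for e using f(2)[of _ e] f01[of e] by (auto simp: U_def split: split_indicator)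
  define r' where "r' = min r r0"
  have "\<bar>mean g z1 - mean g z2\<bar> \<le> (C * snorm g + c * hnorm g) * sqrt (dist z1 z2)"
    if g: "g \<in> test_functions" and z: "z1 \<in> X \<inter> ball z0 r'" "z2 \<in> X \<inter> ball z0 r'" for g z1 z2
  proof -
    let ?h1 = "pullback g z1" and ?h2 = "pullback g z2"
    have zX: "z1 \<in> X" "z2 \<in> X" "z1 \<in> ball z0 r0" "z2 \<in> ball z0 r0" using z by (auto simp: r'_def)
    note [measurable] = pullback_measurable[OF g zX(1)] pullback_measurable[OF g zX(2)]
    define d where "d = dist z1 z2"
    have H: "hnorm g \<ge> 0" by (rule hnorm_nonneg[OF g])
    have i1: "integrable \<mu> ?h1" and i2: "integrable \<mu> ?h2"
      using pullback_bound[OF g zX(1)] pullback_bound[OF g zX(2)] by (auto intro!: integrable_bounded)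
    have b: "\<bar>?h1 e - ?h2 e\<bar> \<le> 2 * snorm g" for e
      using pullback_bound[OF g zX(1), of e] pullback_bound[OF g zX(2), of e] by linarith
    have "\<bar>f e * (?h1 e - ?h2 e)\<bar> \<le> 1 * (2 * snorm g)" for e
      unfolding abs_mult using f01 b by (intro mult_mono) auto
    then have i3: "integrable \<mu> (\<lambda>e. f e * (?h1 e - ?h2 e))" by (auto intro!: integrable_bounded)
    have "\<bar>(1 - f e) * (?h1 e - ?h2 e)\<bar> \<le> 1 * (2 * snorm g)" for e
      unfolding abs_mult using f01[of e] b[of e] by (intro mult_mono) auto
    then have i4: "integrable \<mu> (\<lambda>e. (1 - f e) * (?h1 e - ?h2 e))" by (auto intro!: integrable_bounded)
    have iU: "integrable \<mu> (\<lambda>e. indicator U e :: real)"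
      by (intro integrable_bounded[where B = 1]) (auto split: split_indicator)
    have main: "\<bar>\<integral>e. (1 - f e) * (?h1 e - ?h2 e) \<partial>\<mu>\<bar> \<le> (C * snorm g + c / 2 * hnorm g) * sqrt d"
    proof -
      have "(\<integral>e. 1 - f e \<partial>\<mu>) \<le> (\<integral>e. 1 \<partial>\<mu>)"
        using f01 by (intro integral_mono integrable_bounded[where B = 1]) auto
      then have "(\<integral>e. 1 - f e \<partial>\<mu>) \<le> 1" using prob_space by simp
      then have "c / 2 * hnorm g * (\<integral>e. 1 - f e \<partial>\<mu>) \<le> c / 2 * hnorm g * 1"
        using H c by (intro mult_left_mono) auto
      then have "(C * snorm g + c / 2 * hnorm g * (\<integral>e. 1 - f e \<partial>\<mu>)) * sqrt d \<le> (C * snorm g + c / 2 * hnorm g) * sqrt d"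
        by (intro mult_right_mono) (auto simp: d_def)
      moreover have "\<bar>\<integral>e. (1 - f e) * (?h1 e - ?h2 e) \<partial>\<mu>\<bar>
        \<le> (C * snorm g + c / 2 * hnorm g * (\<integral>e. 1 - f e \<partial>\<mu>)) * sqrt d"
        using C(3)[unfolded weighted_estimate_on_def, rule_format, OF g, of z1 z2] z unfolding \<delta>(2) d_def r'_def by simp
      ultimately show ?thesis by linarith
    qed
    have "\<bar>\<integral>e. f e * (?h1 e - ?h2 e) \<partial>\<mu>\<bar> \<le> (\<integral>e. \<bar>f e * (?h1 e - ?h2 e)\<bar> \<partial>\<mu>)" by (rule integral_abs_bound)
    also have "\<dots> \<le> (\<integral>e. 2 * hnorm g * sqrt (L * d) * indicator U e \<partial>\<mu>)"
    proof (rule integral_mono_AE)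
      show "AE e in \<mu>. \<bar>f e * (?h1 e - ?h2 e)\<bar> \<le> 2 * hnorm g * sqrt (L * d) * indicator U e"
        using AE_Q
      proof eventually_elim
        case (elim e)
        have "\<bar>g (\<psi> z1 e) - g (\<psi> z2 e)\<bar> \<le> 2 * hnorm g * sqrt (dist (\<psi> z1 e) (\<psi> z2 e))"
          using elim zX by (intro holder_space_oscillation[OF g] \<psi>_in)
        also have "\<dots> \<le> 2 * hnorm g * sqrt (L * d)"
          using lip(3)[OF zX(3,4) elim] H by (intro mult_left_mono) (auto simp: d_def)
        finally have "\<bar>?h1 e - ?h2 e\<bar> * f e \<le> 2 * hnorm g * sqrt (L * d) * indicator U e"
          using elim fU f01 H lip(2) by (intro mult_mono) (auto simp: pullback_def d_def)
        then show ?case using f01[of e] by (simp add: abs_mult mult.commute)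
      qed
    qed (use i3 iU in auto)
    also have "\<dots> = 2 * hnorm g * sqrt (L * d) * measure \<mu> U" by simp
    also have "\<dots> \<le> 2 * hnorm g * sqrt (L * d) * \<epsilon>"
      using U_meas H lip(2) by (intro mult_left_mono) (auto simp: d_def)
    also have "\<dots> = (2 * sqrt L * \<epsilon>) * hnorm g * sqrt d" by (simp add: real_sqrt_mult)
    finally have rest: "\<bar>\<integral>e. f e * (?h1 e - ?h2 e) \<partial>\<mu>\<bar> \<le> c / 2 * hnorm g * sqrt d" unfolding \<epsilon>(2) .
    have "(\<integral>e. ?h1 e \<partial>\<mu>) - (\<integral>e. ?h2 e \<partial>\<mu>) = (\<integral>e. (1 - f e) * (?h1 e - ?h2 e) + f e * (?h1 e - ?h2 e) \<partial>\<mu>)"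
      using Bochner_Integration.integral_diff[OF i1 i2] by (simp add: algebra_simps)
    also have "\<dots> = (\<integral>e. (1 - f e) * (?h1 e - ?h2 e) \<partial>\<mu>) + (\<integral>e. f e * (?h1 e - ?h2 e) \<partial>\<mu>)"
      by (rule Bochner_Integration.integral_add[OF i4 i3])
    finally have "\<bar>(\<integral>e. ?h1 e \<partial>\<mu>) - (\<integral>e. ?h2 e \<partial>\<mu>)\<bar> \<le> (C * snorm g + c / 2 * hnorm g) * sqrt d + c / 2 * hnorm g * sqrt d"
      using main rest by linarith
    then show ?thesis by (simp add: d_def algebra_simps)
  qed
  moreover have "r' > 0" using C(2) lip(1) by (simp add: r'_def)
  ultimately show ?thesis using C(1) unfolding holder_estimate_on_def by blast
qed

text \<open>
  Points farther apart than the Lebesgue number \<open>\<rho>\<close> of a finite cover are handled by the supremum norm.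
\<close>

lemma global_estimate:
  assumes X: "compact X"
    and loc: "\<And>z0. z0 \<in> X \<Longrightarrow> \<exists>C\<ge>0. \<exists>r>0. holder_estimate_on (X \<inter> ball z0 r) C c"
    and c: "c > 0"
  shows "\<exists>C>0. holder_estimate_on X C c"
proof -
  obtain C r where Cr: "\<And>z0. z0 \<in> X \<Longrightarrow> C z0 \<ge> 0" "\<And>z0. z0 \<in> X \<Longrightarrow> r z0 > 0"
    "\<And>z0. z0 \<in> X \<Longrightarrow> holder_estimate_on (X \<inter> ball z0 (r z0)) (C z0) c"
    using loc by metis
  have cov: "X \<subseteq> (\<Union>z0\<in>X. ball z0 (r z0 / 2))" using Cr(2) by force
  obtain N where N: "N \<subseteq> X" "finite N" "X \<subseteq> (\<Union>z0\<in>N. ball z0 (r z0 / 2))"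
    by (rule compactE_image[OF X _ cov]) auto
  define \<rho> where "\<rho> = Min (insert 1 ((\<lambda>z0. r z0 / 2) ` N))"
  have \<rho>: "\<rho> > 0" "\<And>z0. z0 \<in> N \<Longrightarrow> \<rho> \<le> r z0 / 2"
  proof -
    show "\<rho> > 0" using N(1,2) Cr(2) by (auto simp: \<rho>_def)
    show "\<rho> \<le> r z0 / 2" if "z0 \<in> N" for z0 unfolding \<rho>_def using N(2) that by (intro Min_le) auto
  qed
  define C' where "C' = 2 / sqrt \<rho> + (\<Sum>z0\<in>N. C z0)"
  have sumC: "(\<Sum>z0\<in>N. C z0) \<ge> 0" using Cr(1) N(1) by (intro sum_nonneg) auto
  have C': "C' > 0" "2 / sqrt \<rho> \<le> C'" using \<rho>(1) sumC by (auto simp: C'_def add_pos_nonneg)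
  have CN: "C z0 \<le> C'" if "z0 \<in> N" for z0
  proof -
    have "C z0 \<le> sum C N" using N(1,2) Cr(1) that by (intro member_le_sum) auto
    moreover have "2 / sqrt \<rho> > 0" using \<rho>(1) by simp
    ultimately show ?thesis unfolding C'_def by linarith
  qed
  have "\<bar>mean g z1 - mean g z2\<bar> \<le> (C' * snorm g + c * hnorm g) * sqrt (dist z1 z2)"
    if g: "g \<in> test_functions" and z: "z1 \<in> X" "z2 \<in> X" for g z1 z2
  proof (cases "dist z1 z2 < \<rho>")
    case True
    obtain z0 where z0: "z0 \<in> N" "z1 \<in> ball z0 (r z0 / 2)" using z(1) N(3) by blast
    have "dist z0 z2 < r z0" using z0 True \<rho>(2)[OF z0(1)] dist_triangle[of z0 z2 z1] by simp
    moreover have "dist z0 z1 < r z0" using z0 Cr(2)[of z0] N(1) by auto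
    ultimately have "\<bar>mean g z1 - mean g z2\<bar> \<le> (C z0 * snorm g + c * hnorm g) * sqrt (dist z1 z2)"
      using z z0 N(1) g Cr(3)[of z0] unfolding holder_estimate_on_def by auto
    also have "\<dots> \<le> (C' * snorm g + c * hnorm g) * sqrt (dist z1 z2)"
      using CN[OF z0(1)] snorm_nonneg[OF g] by (intro mult_right_mono add_right_mono) auto
    finally show ?thesis .
  next
    case False
    have b: "\<bar>\<integral>e. pullback g z e \<partial>\<mu>\<bar> \<le> snorm g" if "z \<in> X" for z
    proof -
      have "\<bar>\<integral>e. pullback g z e \<partial>\<mu>\<bar> \<le> (\<integral>e. \<bar>pullback g z e\<bar> \<partial>\<mu>)" by (rule integral_abs_bound)
      also have "\<dots> \<le> (\<integral>e. snorm g \<partial>\<mu>)"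
        using pullback_bound[OF g that] pullback_measurable[OF g that]
        by (intro integral_mono) (auto intro!: integrable_bounded)
      finally show ?thesis using prob_space by simp
    qed
    have "\<bar>mean g z1 - mean g z2\<bar> \<le> 2 * snorm g"
      using b[OF z(1)] b[OF z(2)] by linarith
    also have "\<dots> = 2 / sqrt \<rho> * snorm g * sqrt \<rho>" using \<rho>(1) by simp
    also have "\<dots> \<le> (C' * snorm g + c * hnorm g) * sqrt (dist z1 z2)"
    proof (rule mult_mono)
      have "2 / sqrt \<rho> * snorm g \<le> C' * snorm g" using C'(2) snorm_nonneg[OF g] by (rule mult_right_mono)
      then show "2 / sqrt \<rho> * snorm g \<le> C' * snorm g + c * hnorm g" using c hnorm_nonneg[OF g] by (simp add: add_increasing2)
    qed (use False \<rho>(1) c C'(1) snorm_nonneg[OF g] hnorm_nonneg[OF g] in auto)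
    finally show ?thesis .
  qed
  then show ?thesis using C'(1) unfolding holder_estimate_on_def by blast
qed

end

section \<open>The estimate for the extended transition function\<close>

theorem lemma3p3:
  fixes \<A> :: "('m::metric_space, 'b::real_inner) chart set"
    and G :: "('m, 'b) metric_tensor"
    and S :: "'h::{real_inner, polish_space} \<times> 'm \<Rightarrow> 'e::{real_inner, polish_space} \<Rightarrow> 'h \<times> 'm"
    and A :: "'h \<times> 'm \<Rightarrow> 'e \<Rightarrow> real^'d^'d"
    and P :: "'w measure"
    and \<eta> :: "nat \<Rightarrow> 'w \<Rightarrow> 'e"
    and \<mu> :: "'e measure"
    and X :: "('h \<times> 'm) set"
    and \<iota> :: "'v::{real_inner, complete_space} \<Rightarrow> 'h"
    and SV :: "'h \<times> 'm \<Rightarrow> 'e \<Rightarrow> 'v"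
    and J :: "nat set"
    and \<phi> :: "nat \<Rightarrow> 'e"
    and b :: "nat \<Rightarrow> real"
    and \<xi> :: "nat \<Rightarrow> nat \<Rightarrow> 'w \<Rightarrow> real"
    and \<rho> :: "nat \<Rightarrow> real \<Rightarrow> real"
    and c :: real
  assumes dim: "CARD('d) \<ge> 2"
    and manifold: "compact_riemannian_manifold \<A> G"
    and S_cont: "continuous_on UNIV (\<lambda>(z, e). S z e)"
    and A_cont: "continuous_on UNIV (\<lambda>(z, e). A z e)"
    and A_SL: "\<And>z e. A z e \<in> SL"
    and prob: "prob_space P"
    and iid: "iid_with_law P \<eta> \<mu>"
    and supp_compact: "compact (measure_support \<mu>)"
    and X_compact: "compact X"
    and X_invariant: "\<And>z e. z \<in> X \<Longrightarrow> e \<in> measure_support \<mu> \<Longrightarrow> S z e \<in> X"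
    and H1_embedding: "compact_embedding \<iota>"
    and H1_factor: "\<And>z e. fst (S z e) = \<iota> (SV z e)"
    and H1_C2: "C2_bounded_into_product \<A> (\<lambda>z e. (SV z e, snd (S z e)))"
    and H4: "noise_decomposition P \<eta> J \<phi> b \<xi> \<rho>"
    and H5: "C2_bounded_into_vector \<A> A"
    and H7: "\<And>z. z \<in> X \<Longrightarrow> measure \<mu> (dense_image_set \<A> \<mu> S A z) = 1"
    and c_pos: "c > 0"
  shows "\<exists>C>0. \<forall>g \<in> holder_space (1/2) (X \<times> SL). \<forall>z1\<in>X. \<forall>z2\<in>X.
     \<bar>(\<integral>y. g y \<partial>ext_transition X \<mu> S A z1) - (\<integral>y. g y \<partial>ext_transition X \<mu> S A z2)\<bar>
       \<le> (C * sup_norm_on (X \<times> SL) g + c * holder_norm (1/2) (X \<times> SL) g) * dist z1 z2 powr (1/2)"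
proof (cases "X = {}")
  case True
  then show ?thesis by (intro exI[of _ 1]) simp
next
  case False
  interpret P: prob_space P by (rule prob)
  interpret driven_cocycle \<A> G S A \<iota> SV
    by unfold_locales (use manifold S_cont A_SL H1_embedding H1_factor H1_C2 H5 in auto)
  define Q where "Q = measure_support \<mu>"
  have \<eta>m: "\<eta> 1 \<in> borel_measurable P" and \<mu>: "\<mu> = distr P borel (\<eta> 1)"
    using iid unfolding iid_with_law_def P.indep_vars_def by auto
  have Q: "compact Q" using supp_compact by (simp add: Q_def)
  interpret M: prob_space \<mu> unfolding \<mu> by (rule P.prob_space_distr[OF \<eta>m])
  have sets_\<mu>: "sets \<mu> = sets borel" by (simp add: \<mu>)
  \<comment> \<open>the set of noise values with dense image is contained in the support\<close>
  have Q1: "measure \<mu> Q = 1"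
  proof -
    obtain z where "z \<in> X" using False by blast
    then have "1 = measure \<mu> (dense_image_set \<A> \<mu> S A z)" using H7 by simp
    also have "\<dots> \<le> measure \<mu> Q"
      using compact_imp_closed[OF Q] by (intro M.finite_measure_mono) (auto simp: dense_image_set_def Q_def sets_\<mu>)
    finally show ?thesis using M.prob_le_1[of Q] by linarith
  qed
  define \<psi> where "\<psi> z e = (S z e, A z e)" for z e
  have \<psi>_cont: "continuous_on UNIV (\<psi> z)" for z
  proof -
    have "continuous_on UNIV (\<lambda>e. (\<lambda>(z, e). S z e) (z, e))" "continuous_on UNIV (\<lambda>e. (\<lambda>(z, e). A z e) (z, e))"
      by (intro continuous_on_compose2[OF S_cont] continuous_on_compose2[OF A_cont] continuous_intros; simp)+
    then show ?thesis unfolding \<psi>_def by (auto intro: continuous_on_Pair)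
  qed
  interpret N: noisy_step \<mu> Q \<psi> X "X \<times> SL"
    by unfold_locales (use sets_\<mu> Q Q1 \<psi>_cont X_invariant A_SL in \<open>auto simp: Q_def \<psi>_def\<close>)
  obtain R where R: "\<And>e. e \<in> Q \<Longrightarrow> norm e \<le> R"
    using compact_imp_bounded[OF Q] unfolding bounded_iff by blast
  have "AE e in \<mu>. norm e \<le> R" using N.AE_Q R by (auto elim: eventually_mono)
  then have bdd: "AE \<omega> in P. norm (\<eta> 1 \<omega>) \<le> R"
    unfolding \<mu> by (rule AE_distrD[OF \<eta>m])
  have W: "closure (span (\<phi> ` J)) = UNIV"
    using H4 by (simp add: noise_decomposition_def orthonormal_basis_on_def)
  have steer: "\<exists>r. N.steerable_at z0 \<delta> e r"
    if e: "e \<in> dense_image_set \<A> \<mu> S A z0" and \<delta>: "\<delta> > 0" for z0 e \<delta>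
  proof -
    obtain \<kappa> D where \<kappa>: "\<kappa> \<in> \<A>" "snd (S z0 e) \<in> chart_dom \<kappa>"
      and D: "((\<lambda>\<zeta>. (fst (S z0 \<zeta>), chart_map \<kappa> (snd (S z0 \<zeta>)), A z0 \<zeta>)) has_derivative D) (at e)"
      "closure (range D) = UNIV \<times> UNIV \<times> tangent_SL (A z0 e)"
      using e unfolding dense_image_set_def by blast
    obtain r K I where r: "r > 0" "K > 0" and I: "finite I" "I \<subseteq> \<phi> ` J"
      and st: "\<forall>z1\<in>ball z0 r. \<forall>z2\<in>ball z0 r. \<exists>v\<in>span I. norm v \<le> K * dist z1 z2 \<and>
        (\<forall>\<eta>\<in>ball e r. dist (S z1 \<eta>, A z1 \<eta>) (S z2 (\<eta> + v), A z2 (\<eta> + v)) \<le> \<delta> * dist z1 z2)"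
      using noise_steering[OF \<kappa> D W \<delta>] by (elim exE conjE)
    obtain C where C: "C \<ge> 0" "\<forall>v\<in>span I. translation_bound \<mu> (C * norm v) v"
      using noise_translation[OF prob H4 \<eta>m bdd I] unfolding \<mu>[symmetric] by (elim exE conjE)
    have "N.steerable_at z0 \<delta> e r"
      unfolding N.steerable_at_def
    proof (intro conjI r(1) exI[of _ "K + C * K"] ballI)
      show "0 \<le> K + C * K" using r(2) C(1) by simp
      fix z1 z2 assume "z1 \<in> ball z0 r" "z2 \<in> ball z0 r"
      then obtain v where v: "v \<in> span I" "norm v \<le> K * dist z1 z2"
        "\<forall>\<eta>\<in>ball e r. dist (S z1 \<eta>, A z1 \<eta>) (S z2 (\<eta> + v), A z2 (\<eta> + v)) \<le> \<delta> * dist z1 z2"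
        using st by blast
      have "0 \<le> C * K * dist z1 z2" using C(1) r(2) by simp
      then have "norm v \<le> (K + C * K) * dist z1 z2" using v(2) by (simp add: distrib_right)
      moreover have "translation_bound \<mu> ((K + C * K) * dist z1 z2) v"
        unfolding translation_bound_def
      proof (intro ballI allI impI)
        fix F :: "'e \<Rightarrow> real" and B :: real
        assume F: "F \<in> borel_measurable borel" and FB: "\<forall>e. \<bar>F e\<bar> \<le> B"
        have "\<bar>F 0\<bar> \<le> B" using FB by blast
        then have B: "B \<ge> 0" by linarith
        have "\<bar>(\<integral>e. F (e + v) \<partial>\<mu>) - (\<integral>e. F e \<partial>\<mu>)\<bar> \<le> C * norm v * B"
          using C(2) v(1) F FB by (simp add: translation_bound_def)
        also have "\<dots> \<le> C * (K * dist z1 z2) * B"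
          using v(2) C(1) B by (intro mult_right_mono mult_left_mono)
        also have "\<dots> \<le> (K + C * K) * dist z1 z2 * B" using B r(2) by (simp add: algebra_simps)
        finally show "\<bar>(\<integral>e. F (e + v) \<partial>\<mu>) - (\<integral>e. F e \<partial>\<mu>)\<bar> \<le> (K + C * K) * dist z1 z2 * B" .
      qed
      ultimately show "\<exists>v. norm v \<le> (K + C * K) * dist z1 z2 \<and> translation_bound \<mu> ((K + C * K) * dist z1 z2) v \<and>
         (\<forall>e\<in>ball e r. dist (\<psi> z1 e) (\<psi> z2 (e + v)) \<le> \<delta> * dist z1 z2)"
        using v(3) unfolding \<psi>_def by blast
    qed
    then show ?thesis by blast
  qed
  have integral: "(\<integral>y. g y \<partial>ext_transition X \<mu> S A z) = N.mean g z"
    if g: "g \<in> holder_space (1/2) (X \<times> SL)" and z: "z \<in> X" for g z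
  proof -
    have "\<psi> z \<in> borel_measurable \<mu>"
      using borel_measurable_continuous_onI[OF \<psi>_cont] by (simp add: measurable_cong_sets[OF sets_\<mu> HOL.refl])
    then have m: "\<psi> z \<in> measurable (restrict_space \<mu> Q) (restrict_space borel (X \<times> SL))"
      using N.\<psi>_in[OF z] by (intro measurable_restrict_space2 measurable_restrict_space1) (auto simp: space_restrict_space)
    have "g \<in> borel_measurable (restrict_space borel (X \<times> SL))"
      using g by (intro borel_measurable_continuous_on_restrict) (simp add: holder_space_def)
    then have "(\<integral>y. g y \<partial>ext_transition X \<mu> S A z) = (\<integral>e. g (\<psi> z e) \<partial>restrict_space \<mu> Q)"
      unfolding ext_transition_def Q_def[symmetric] using m by (subst integral_distr) (simp_all add: \<psi>_def[abs_def])
    also have "\<dots> = N.mean g z"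
      using N.Q_borel by (subst integral_restrict_space) (simp_all add: sets_\<mu> N.pullback_def[abs_def])
    finally show ?thesis .
  qed
  have "\<exists>C>0. N.holder_estimate_on X C c"
  proof (rule N.global_estimate[OF X_compact _ c_pos])
    fix z0 assume z0: "z0 \<in> X"
    obtain r L where rL: "r > 0" "L > 0" "\<And>z1 z2 e. z1 \<in> ball z0 r \<Longrightarrow> z2 \<in> ball z0 r \<Longrightarrow> e \<in> Q \<Longrightarrow>
       dist (S z1 e, A z1 e) (S z2 e, A z2 e) \<le> L * dist z1 z2"
      using step_lipschitz_on_compact[OF Q, of z0] by blast
    show "\<exists>C\<ge>0. \<exists>r>0. N.holder_estimate_on (X \<inter> ball z0 r) C c"
      by (rule N.local_estimate[OF rL(1,2) _ H7[OF z0] steer c_pos]) (use rL(3) in \<open>auto simp: \<psi>_def\<close>)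
  qed
  then show ?thesis unfolding N.holder_estimate_on_def by (simp add: integral powr_half_sqrt)
qed

end
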